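(* Let $d_1, d_2 \geq 2$ be integers and let $p$ be an odd prime with $p\equiv \pm1 \pmod {d_1}$ and $p\equiv \pm1 \pmod {d_2}$. Let $s(p):=\Gamma_p\!\left(\tfrac{1}{d_1}\right)\Gamma_p\!\left(\tfrac{d_1-1}{d_1}\right)\Gamma_p\!\left(\tfrac{1}{d_2}\right)\Gamma_p\!\left(\tfrac{d_2-1}{d_2}\right)$, which equals $(-1)^{\lfloor \frac{p-1}{d_1} \rfloor+\lfloor \frac{p-1}{d_2} \rfloor}$. Then \[ {}_{4}G\left(\tfrac{1}{d_1} , 1-\tfrac{1}{d_1}, \tfrac{1}{d_2} , 1-\tfrac{1}{d_2}\right)_p \equiv {}_{4}F_3\left[ \begin{array}{cccc} \frac{1}{d_1}, & 1-\frac{1}{d_1}, & \frac{1}{d_2}, & 1-\frac{1}{d_2}\\ & 1, & 1, & 1 \end{array} \Big| \; 1 \right]_{p-1} + s(p)\,p \pmod {p^3}. \]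
   Context: $\Gamma_p$ is Morita's $p$-adic gamma function. For real $x$, $\lfloor x\rfloor$ is the floor and $\langle x\rangle:=x-\lfloor x\rfloor$. For an odd prime $p$, $n\in\mathbb{Z}^+$ and $\frac{m_i}{d_i}\in\mathbb{Q}\cap\mathbb{Z}_p$ with $0<\frac{m_i}{d_i}<1$, define ${}_{n+1}G\left(\tfrac{m_1}{d_1},\dots,\tfrac{m_{n+1}}{d_{n+1}}\right)_p:=\frac{-1}{p-1}\sum_{j=0}^{p-2}\left((-1)^j\Gamma_p(\tfrac{j}{p-1})\right)^{n+1}\prod_{i=1}^{n+1}\frac{\Gamma_p(\langle \frac{m_i}{d_i}-\frac{j}{p-1}\rangle)}{\Gamma_p(\frac{m_i}{d_i})}(-p)^{-\lfloor \frac{m_i}{d_i}-\frac{j}{p-1}\rfloor}$. Rising factorial: $(a)_0:=1$, $(a)_k:=a(a+1)\cdots(a+k-1)$. Truncated hypergeometric series: ${}_rF_s\left[\begin{array}{ccc}a_1,&\dots,&a_r\\ &b_1,\dots,&b_s\end{array}\Big|\,z\right]_m:=\sum_{k=0}^{m}\frac{(a_1)_k\cdots(a_r)_k}{(b_1)_k\cdots(b_s)_k}\frac{z^k}{k!}$. Congruences are in $\mathbb{Z}_p$. *)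

theory Defs
  imports Complex_Main "HOL-Algebra.Ideal" "HOL-Number_Theory.Cong"
    "HOL-Computational_Algebra.Primes"
begin

section \<open>The ring of p-adic integers\<close>

text \<open>
  The p-adic integers are the inverse limit of the rings of integers modulo \<open>p ^ n\<close>.
  An element is a compatible sequence whose \<open>n\<close>-th entry is the least nonnegative
  residue modulo \<open>p ^ n\<close>; the case \<open>m = n\<close> of the compatibility condition says that the
  entries are reduced.
\<close>

definition Zp :: "nat \<Rightarrow> (nat \<Rightarrow> int) ring" where
  "Zp p =
    \<lparr>carrier = {x. \<forall>m n. m \<le> n \<longrightarrow> x n mod int p ^ m = x m},
     monoid.mult = (\<lambda>x y n. x n * y n mod int p ^ n),
     one = (\<lambda>n. 1 mod int p ^ n),
     zero = (\<lambda>n. 0),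
     add = (\<lambda>x y n. (x n + y n) mod int p ^ n)\<rparr>"

definition Zp_of_int :: "nat \<Rightarrow> int \<Rightarrow> nat \<Rightarrow> int" where
  "Zp_of_int p a = (\<lambda>n. a mod int p ^ n)"

text \<open>
  The next function embeds the rationals that are p-adic integers, i.e. those whose reduced
  denominator is prime to \<open>p\<close>; its value at any other rational is unspecified.
\<close>

definition Zp_of_rat :: "nat \<Rightarrow> rat \<Rightarrow> nat \<Rightarrow> int" where
  "Zp_of_rat p q =
    Zp_of_int p (fst (quotient_of q)) \<otimes>\<^bsub>Zp p\<^esub> inv\<^bsub>Zp p\<^esub> Zp_of_int p (snd (quotient_of q))"

definition Zp_cong :: "nat \<Rightarrow> nat \<Rightarrow> (nat \<Rightarrow> int) \<Rightarrow> (nat \<Rightarrow> int) \<Rightarrow> bool" where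
  "Zp_cong p k x y \<longleftrightarrow> x \<ominus>\<^bsub>Zp p\<^esub> y \<in> PIdl\<^bsub>Zp p\<^esub> (Zp_of_int p (int p ^ k))"

lemma Zp_compat:
  assumes "x \<in> carrier (Zp p)" "m \<le> n"
  shows "x n mod int p ^ m = x m"
  using assms by (simp add: Zp_def)

lemma Zp_of_int_closed: "Zp_of_int p a \<in> carrier (Zp p)"
  by (simp add: Zp_def Zp_of_int_def mod_mod_cancel le_imp_power_dvd)

lemma Zp_cring: "cring (Zp p)"
proof (rule cringI)
  have red: "x n mod int p ^ n = x n" if "x \<in> carrier (Zp p)" for x n
    using Zp_compat[OF that] by blast
  have mm: "a mod int p ^ n mod int p ^ m = a mod int p ^ m" if "m \<le> n" for a m n
    using that by (simp add: mod_mod_cancel le_imp_power_dvd)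
  show "abelian_group (Zp p)"
  proof (rule abelian_groupI)
    fix x y assume xy: "x \<in> carrier (Zp p)" "y \<in> carrier (Zp p)"
    have "(x n + y n) mod int p ^ n mod int p ^ m = (x m + y m) mod int p ^ m"
      if "m \<le> n" for m n
      using mod_add_eq[of "x n" "int p ^ m" "y n"] Zp_compat[OF xy(1) that]
        Zp_compat[OF xy(2) that] mm[OF that] by simp
    then show "x \<oplus>\<^bsub>Zp p\<^esub> y \<in> carrier (Zp p)"
      by (simp add: Zp_def)
    show "x \<oplus>\<^bsub>Zp p\<^esub> y = y \<oplus>\<^bsub>Zp p\<^esub> x"
      by (simp add: Zp_def add.commute)
  next
    show "\<zero>\<^bsub>Zp p\<^esub> \<in> carrier (Zp p)" by (simp add: Zp_def)
  next
    fix x y z :: "nat \<Rightarrow> int"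
    show "x \<oplus>\<^bsub>Zp p\<^esub> y \<oplus>\<^bsub>Zp p\<^esub> z = x \<oplus>\<^bsub>Zp p\<^esub> (y \<oplus>\<^bsub>Zp p\<^esub> z)"
      by (simp add: Zp_def mod_simps add.assoc)
  next
    fix x assume x: "x \<in> carrier (Zp p)"
    then show "\<zero>\<^bsub>Zp p\<^esub> \<oplus>\<^bsub>Zp p\<^esub> x = x"
      using red[OF x] by (simp add: Zp_def)
    have "(- x n) mod int p ^ n mod int p ^ m = (- x m) mod int p ^ m" if "m \<le> n" for m n
      using mod_minus_eq[of "x n" "int p ^ m"] Zp_compat[OF x that] mm[OF that] by simp
    then have "(\<lambda>n. (- x n) mod int p ^ n) \<in> carrier (Zp p)"
      by (simp add: Zp_def)
    moreover have "(\<lambda>n. (- x n) mod int p ^ n) \<oplus>\<^bsub>Zp p\<^esub> x = \<zero>\<^bsub>Zp p\<^esub>"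
      by (simp add: Zp_def mod_simps)
    ultimately show "\<exists>y\<in>carrier (Zp p). y \<oplus>\<^bsub>Zp p\<^esub> x = \<zero>\<^bsub>Zp p\<^esub>"
      by blast
  qed
  show "comm_monoid (Zp p)"
  proof (rule comm_monoidI)
    fix x y assume xy: "x \<in> carrier (Zp p)" "y \<in> carrier (Zp p)"
    have "(x n * y n) mod int p ^ n mod int p ^ m = (x m * y m) mod int p ^ m"
      if "m \<le> n" for m n
      using mod_mult_eq[of "x n" "int p ^ m" "y n"] Zp_compat[OF xy(1) that]
        Zp_compat[OF xy(2) that] mm[OF that] by simp
    then show "x \<otimes>\<^bsub>Zp p\<^esub> y \<in> carrier (Zp p)"
      by (simp add: Zp_def)
    show "x \<otimes>\<^bsub>Zp p\<^esub> y = y \<otimes>\<^bsub>Zp p\<^esub> x"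
      by (simp add: Zp_def mult.commute)
  next
    show "\<one>\<^bsub>Zp p\<^esub> \<in> carrier (Zp p)"
      using mm by (simp add: Zp_def)
  next
    fix x y z :: "nat \<Rightarrow> int"
    show "x \<otimes>\<^bsub>Zp p\<^esub> y \<otimes>\<^bsub>Zp p\<^esub> z = x \<otimes>\<^bsub>Zp p\<^esub> (y \<otimes>\<^bsub>Zp p\<^esub> z)"
      by (simp add: Zp_def mod_simps mult.assoc)
  next
    fix x assume x: "x \<in> carrier (Zp p)"
    then show "\<one>\<^bsub>Zp p\<^esub> \<otimes>\<^bsub>Zp p\<^esub> x = x"
      using red[OF x] by (simp add: Zp_def mod_simps)
  qed
  fix x y z :: "nat \<Rightarrow> int"
  show "(x \<oplus>\<^bsub>Zp p\<^esub> y) \<otimes>\<^bsub>Zp p\<^esub> z = x \<otimes>\<^bsub>Zp p\<^esub> z \<oplus>\<^bsub>Zp p\<^esub> y \<otimes>\<^bsub>Zp p\<^esub> z"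
    by (simp add: Zp_def mod_simps distrib_right)
qed


section \<open>Morita's p-adic gamma function\<close>

definition gammap_nat :: "nat \<Rightarrow> nat \<Rightarrow> int" where
  "gammap_nat p n = (-1) ^ n * (\<Prod>j\<in>{j. 0 < j \<and> j < n \<and> \<not> p dvd j}. int j)"

text \<open>
  For \<open>x \<noteq> 0\<close> the value is the limit of \<open>gammap_nat p n\<close> as the positive integers \<open>n\<close> tend
  p-adically to \<open>x\<close>, where two p-adic integers are within distance \<open>p ^ (-M)\<close> of each other
  iff their \<open>M\<close>-th entries agree.
\<close>

definition gammap :: "nat \<Rightarrow> (nat \<Rightarrow> int) \<Rightarrow> nat \<Rightarrow> int" where
  "gammap p x =
    (if x = \<zero>\<^bsub>Zp p\<^esub> then \<one>\<^bsub>Zp p\<^esub>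
     else THE y. y \<in> carrier (Zp p) \<and>
       (\<forall>N. \<exists>M. \<forall>n>0. Zp_of_int p (int n) M = x M \<longrightarrow> Zp_of_int p (gammap_nat p n) N = y N))"

abbreviation gammap_rat :: "nat \<Rightarrow> rat \<Rightarrow> nat \<Rightarrow> int" where
  "gammap_rat p q \<equiv> gammap p (Zp_of_rat p q)"


section \<open>The function G and truncated hypergeometric series\<close>

text \<open>
  In \<open>hyperG p ms\<close> the list \<open>ms\<close> contains the \<open>n + 1\<close> parameters, which are meant to lie
  strictly between 0 and 1 and to have denominators prime to \<open>p\<close>. The exponent of \<open>- p\<close> is
  then 0 or 1, so that the integer power below is an ordinary power.
\<close>

definition hyperG :: "nat \<Rightarrow> rat list \<Rightarrow> nat \<Rightarrow> int" where
  "hyperG p ms =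
    Zp_of_rat p (- 1 / (of_nat p - 1)) \<otimes>\<^bsub>Zp p\<^esub>
    (\<Oplus>\<^bsub>Zp p\<^esub>j\<in>{0..p - 2}. let t = of_nat j / (of_nat p - 1) in
       (Zp_of_int p ((- 1) ^ j) \<otimes>\<^bsub>Zp p\<^esub> gammap_rat p t) [^]\<^bsub>Zp p\<^esub> length ms \<otimes>\<^bsub>Zp p\<^esub>
       (\<Otimes>\<^bsub>Zp p\<^esub>i\<in>{..<length ms}.
          gammap_rat p (frac (ms ! i - t)) \<otimes>\<^bsub>Zp p\<^esub> inv\<^bsub>Zp p\<^esub> gammap_rat p (ms ! i) \<otimes>\<^bsub>Zp p\<^esub>
          Zp_of_int p (- int p) [^]\<^bsub>Zp p\<^esub> (- \<lfloor>ms ! i - t\<rfloor>)))"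

definition trunc_hypergeom ::
  "'a::field_char_0 list \<Rightarrow> 'a list \<Rightarrow> 'a \<Rightarrow> nat \<Rightarrow> 'a" where
  "trunc_hypergeom as bs z m =
    (\<Sum>k = 0..m. (\<Prod>a\<leftarrow>as. pochhammer a k) / (\<Prod>b\<leftarrow>bs. pochhammer b k) * (z ^ k / fact k))"

definition s_sign :: "nat \<Rightarrow> nat \<Rightarrow> nat \<Rightarrow> nat \<Rightarrow> int" where
  "s_sign p d1 d2 =
    gammap_rat p (1 / of_nat d1) \<otimes>\<^bsub>Zp p\<^esub> gammap_rat p ((of_nat d1 - 1) / of_nat d1) \<otimes>\<^bsub>Zp p\<^esub>
    gammap_rat p (1 / of_nat d2) \<otimes>\<^bsub>Zp p\<^esub> gammap_rat p ((of_nat d2 - 1) / of_nat d2)"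

end

(*
Write alpha = 1 / d1, beta = 1 / d2, choose r, s such that p * alpha - r is 1 / d1 or 1 - 1 / d1
and similarly for beta, and put
  R(t) = (prod_{1 <= i <= r} (t + i - p alpha) / prod_{0 <= i <= r} (t - i + p alpha))
       * (the same with s, beta).
Up to a factor that is irrelevant modulo p^3, the k-th summand of the hypergeometric series is
  (-1)^(r + s) p^2 alpha beta R(k),
and the functional equation of Gamma_p, with Gamma_p(p y) == (-(p - 1)!)^y modulo p^3 for p > 3,
shows that the j-th summand of G is
  (-1)^(r + s) p^2 (t + alpha) (t + beta) R(t)   at   t = j / (1 - p).
Expanding both sums over j < p in partial fractions, the poles tau of R contribute
s(p) p sum_tau tau Res_tau(R) = s(p) p to the difference (the residues of t R(t) add up to 1,
and s(p) = (-1)^(r + s)), and a rest that vanishes modulo p^3 because the sums of 1 / u and of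
1 / u^2 over 0 < u < p are divisible by p. Two poles that are congruent modulo p have residues
with a denominator divisible by p, and only their joint contribution is integral. For p = 3,
where the sum of 1 / u^2 is not divisible by p, d1 and d2 are 2 or 4 and one computes directly.
*)

theory Submission
  imports Defs "HOL-Number_Theory.Number_Theory" "HOL-Computational_Algebra.Polynomial"
begin


section \<open>Rationals integral at a prime\<close>

text \<open>All computations take place in the rationals with denominator prime to \<open>p\<close>,
  where field arithmetic and cancellation are available; p-adic integers enter only through rational
  approximations modulo \<open>p ^ N\<close> (\<open>represents\<close>). The point
  \<open>x = j / (1 - p)\<close> is the solution of \<open>x = j + p x\<close>. Hence
  \<open>j\<close> steps of the functional equation lead from gamma values at \<open>x\<close>,
  shifted by parameters, to values at multiples of \<open>p\<close>. These are powers of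
  \<open>- (p - 1)!\<close>, and they cancel because their arguments add up to 0. What remains is a
  ratio of Pochhammer symbols (\<open>term_ratio\<close>) whose value at \<open>x = 0\<close> is the
  hypergeometric summand, so both sums come from one function. The factor that is irrelevant modulo
  \<open>p ^ 3\<close> (\<open>correction\<close>) is 1 only modulo \<open>p ^ 2\<close>. It drops
  out because the sums are compared term by term: it is the same for both terms modulo
  \<open>p ^ 3\<close>, and their difference is divisible by \<open>p\<close>. This forces the
  treatment of a single difference instead of two separate evaluations. G has no summand for
  \<open>j = p - 1\<close>; the one supplied by \<open>term_ratio\<close> vanishes modulo
  \<open>p ^ 3\<close>.\<close>

locale localization =
  fixes p :: nat
  assumes prime_p: "prime p"
begin

definition Z :: "rat set" where
  "Z = {x. \<exists>a b :: int. \<not> int p dvd b \<and> x = of_int a / of_int b}"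

definition U :: "rat set" where
  "U = {x. \<exists>a b :: int. \<not> int p dvd a \<and> \<not> int p dvd b \<and> x = of_int a / of_int b}"

text \<open>Only the difference has to be integral, not the two sides. Sums of residues with
  denominators divisible by \<open>p\<close> can thus be handled before they are known to be
  integral; in return, products of congruences need integrality hypotheses.\<close>

definition lcong :: "nat \<Rightarrow> rat \<Rightarrow> rat \<Rightarrow> bool" where
  "lcong k x y \<longleftrightarrow> (\<exists>c\<in>Z. x - y = of_nat p ^ k * c)"

lemma prime_ip: "prime (int p)"
  using prime_p by simp

lemma p_pos: "p > 0" and p_ge_2: "p \<ge> 2"
  using prime_gt_0_nat[OF prime_p] prime_ge_2_nat[OF prime_p] by auto

lemma not_dvd_mult: "\<not> int p dvd a \<Longrightarrow> \<not> int p dvd b \<Longrightarrow> \<not> int p dvd a * b"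
  using prime_dvd_mult_iff[OF prime_ip] by blast

lemma Z_I: "\<not> int p dvd b \<Longrightarrow> of_int a / of_int b \<in> Z"
  unfolding Z_def by blast

lemma Z_of_int [simp, intro]: "of_int a \<in> Z"
  using Z_I[of 1 a] prime_ip not_prime_unit by fastforce

lemma Z_of_nat [simp, intro]: "of_nat a \<in> Z"
  using Z_of_int[of "int a"] by simp

lemma Z_0 [simp, intro]: "0 \<in> Z" and Z_1 [simp, intro]: "1 \<in> Z"
  and Z_numeral [simp, intro]: "numeral n \<in> Z"
  using Z_of_int[of 0] Z_of_int[of 1] Z_of_int[of "numeral n"] by simp_all

lemma Z_add [intro]: assumes "x \<in> Z" "y \<in> Z" shows "x + y \<in> Z"
proof -
  obtain a b c d where ab: "\<not> int p dvd b" "x = of_int a / of_int b"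
    and cd: "\<not> int p dvd d" "y = of_int c / of_int d"
    using assms unfolding Z_def by blast
  have "b \<noteq> 0" "d \<noteq> 0" using ab cd by auto
  then have "x + y = of_int (a * d + c * b) / of_int (b * d)"
    by (simp add: ab cd field_simps)
  then show ?thesis using not_dvd_mult[OF ab(1) cd(1)] Z_I by metis
qed

lemma Z_mult [intro]: assumes "x \<in> Z" "y \<in> Z" shows "x * y \<in> Z"
proof -
  obtain a b c d where ab: "\<not> int p dvd b" "x = of_int a / of_int b"
    and cd: "\<not> int p dvd d" "y = of_int c / of_int d"
    using assms unfolding Z_def by blast
  have "x * y = of_int (a * c) / of_int (b * d)"
    by (simp add: ab cd)
  then show ?thesis using not_dvd_mult[OF ab(1) cd(1)] Z_I by metis
qed

lemma Z_minus [intro]: "x \<in> Z \<Longrightarrow> - x \<in> Z"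
  using Z_mult[OF Z_of_int[of "-1"], of x] by simp

lemma Z_diff [intro]: "x \<in> Z \<Longrightarrow> y \<in> Z \<Longrightarrow> x - y \<in> Z"
  using Z_add[of x "- y"] Z_minus[of y] by simp

lemma Z_power [intro]: "x \<in> Z \<Longrightarrow> x ^ n \<in> Z"
  by (induction n) auto

lemma Z_sum [intro]: "(\<And>i. i \<in> A \<Longrightarrow> f i \<in> Z) \<Longrightarrow> sum f A \<in> Z"
  by (induction A rule: infinite_finite_induct) auto

lemma Z_prod [intro]: "(\<And>i. i \<in> A \<Longrightarrow> f i \<in> Z) \<Longrightarrow> prod f A \<in> Z"
  by (induction A rule: infinite_finite_induct) auto

lemma U_Z: "x \<in> U \<Longrightarrow> x \<in> Z"
  unfolding U_def Z_def by blast

lemma U_nonzero: "x \<in> U \<Longrightarrow> x \<noteq> 0"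
  unfolding U_def by auto

lemma zero_notin_U [simp]: "0 \<notin> U"
  using U_nonzero by blast

lemma U_inverse [intro]: assumes "x \<in> U" shows "inverse x \<in> U"
proof -
  obtain a b where "\<not> int p dvd b" "\<not> int p dvd a" "x = of_int a / of_int b"
    using assms unfolding U_def by blast
  then have "inverse x = of_int b / of_int a" by simp
  then show ?thesis using \<open>\<not> int p dvd b\<close> \<open>\<not> int p dvd a\<close> unfolding U_def by blast
qed

lemma U_mult [intro]: assumes "x \<in> U" "y \<in> U" shows "x * y \<in> U"
proof -
  obtain a b c d where ab: "\<not> int p dvd a" "\<not> int p dvd b" "x = of_int a / of_int b"
    and cd: "\<not> int p dvd c" "\<not> int p dvd d" "y = of_int c / of_int d"
    using assms unfolding U_def by blast
  have "x * y = of_int (a * c) / of_int (b * d)"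
    by (simp add: ab cd)
  then show ?thesis using not_dvd_mult[OF ab(1) cd(1)] not_dvd_mult[OF ab(2) cd(2)]
    unfolding U_def by blast
qed

lemma U_divide [intro]: "x \<in> U \<Longrightarrow> y \<in> U \<Longrightarrow> x / y \<in> U"
  using U_mult[of x "inverse y"] U_inverse[of y] by (simp add: field_simps)

lemma Z_divide [intro]: "x \<in> Z \<Longrightarrow> y \<in> U \<Longrightarrow> x / y \<in> Z"
  using Z_mult[of x "inverse y"] U_Z[OF U_inverse[of y]] by (simp add: field_simps)

lemma U_of_int: "\<not> int p dvd a \<Longrightarrow> of_int a \<in> U"
  unfolding U_def using prime_ip not_prime_unit
  by (intro CollectI exI[of _ a] exI[of _ 1]) auto

lemma U_of_nat: "\<not> p dvd a \<Longrightarrow> of_nat a \<in> U"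
  using U_of_int[of "int a"] by simp

lemma U_1 [simp, intro]: "1 \<in> U"
  using U_of_nat[of 1] prime_p not_prime_unit by fastforce

lemma U_minus [intro]: "x \<in> U \<Longrightarrow> - x \<in> U"
  using U_mult[OF U_of_int[of "-1"], of x] p_ge_2 by auto

lemma U_power [intro]: "x \<in> U \<Longrightarrow> x ^ n \<in> U"
  by (induction n) auto

lemma U_prod [intro]: "(\<And>i. i \<in> A \<Longrightarrow> f i \<in> U) \<Longrightarrow> prod f A \<in> U"
  by (induction A rule: infinite_finite_induct) auto

lemma lcong_refl [simp, intro]: "lcong k x x"
  unfolding lcong_def by (intro bexI[of _ 0]) auto

lemma lcong_sym: assumes "lcong k x y" shows "lcong k y x"
proof -
  obtain c where "c \<in> Z" "x - y = of_nat p ^ k * c" using assms unfolding lcong_def by blast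
  then have "y - x = of_nat p ^ k * (- c)" by (simp add: algebra_simps)
  then show ?thesis using Z_minus[OF \<open>c \<in> Z\<close>] unfolding lcong_def by blast
qed

lemma lcong_trans [trans]: assumes "lcong k x y" "lcong k y z" shows "lcong k x z"
proof -
  obtain c d where "c \<in> Z" "x - y = of_nat p ^ k * c" "d \<in> Z" "y - z = of_nat p ^ k * d"
    using assms unfolding lcong_def by blast
  then have "x - z = of_nat p ^ k * (c + d)" by (simp add: algebra_simps)
  then show ?thesis using \<open>c \<in> Z\<close> \<open>d \<in> Z\<close> unfolding lcong_def by blast
qed

lemma lcong_add: assumes "lcong k x y" "lcong k x' y'" shows "lcong k (x + x') (y + y')"
proof -
  obtain c d where "c \<in> Z" "x - y = of_nat p ^ k * c" "d \<in> Z" "x' - y' = of_nat p ^ k * d"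
    using assms unfolding lcong_def by blast
  then have "x + x' - (y + y') = of_nat p ^ k * (c + d)" by (simp add: algebra_simps)
  then show ?thesis using \<open>c \<in> Z\<close> \<open>d \<in> Z\<close> unfolding lcong_def by blast
qed

lemma lcong_mult_left: assumes "lcong k x y" "z \<in> Z" shows "lcong k (z * x) (z * y)"
proof -
  obtain c where "c \<in> Z" "x - y = of_nat p ^ k * c" using assms unfolding lcong_def by blast
  then have "z * x - z * y = of_nat p ^ k * (z * c)"
    by (metis mult.left_commute right_diff_distrib)
  then show ?thesis using Z_mult[OF assms(2) \<open>c \<in> Z\<close>] unfolding lcong_def by blast
qed

lemma lcong_minus: "lcong k x y \<Longrightarrow> lcong k (- x) (- y)"
  using lcong_mult_left[of k x y "of_int (-1)"] Z_of_int[of "-1"] by simp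

lemma lcong_diff: "lcong k x y \<Longrightarrow> lcong k x' y' \<Longrightarrow> lcong k (x - x') (y - y')"
  using lcong_add[OF _ lcong_minus[of k x' y']] by simp

lemma lcong_Z: "lcong k x y \<Longrightarrow> x \<in> Z \<longleftrightarrow> y \<in> Z"
proof -
  have "y \<in> Z" if xy: "lcong k x y" and x: "x \<in> Z" for x y
  proof -
    obtain c where c: "c \<in> Z" "x - y = of_nat p ^ k * c" using xy unfolding lcong_def by blast
    then have "y = x - of_nat p ^ k * c" by simp
    then show ?thesis using c x by (metis Z_diff Z_mult Z_power Z_of_nat)
  qed
  then show "lcong k x y \<Longrightarrow> x \<in> Z \<longleftrightarrow> y \<in> Z" using lcong_sym by blast
qed

lemma lcong_mult:
  assumes "lcong k x y" "lcong k x' y'" "x \<in> Z" "x' \<in> Z" shows "lcong k (x * x') (y * y')"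
proof -
  have "y \<in> Z" using lcong_Z assms by blast
  have "lcong k (x' * x) (x' * y)" using assms lcong_mult_left by blast
  moreover have "lcong k (y * x') (y * y')" using assms \<open>y \<in> Z\<close> lcong_mult_left by blast
  ultimately show ?thesis using lcong_trans by (simp add: mult.commute)
qed

lemma lcong_power: "lcong k x y \<Longrightarrow> x \<in> Z \<Longrightarrow> lcong k (x ^ n) (y ^ n)"
  by (induction n) (auto intro: lcong_mult)

lemma lcong_sum: "(\<And>i. i \<in> A \<Longrightarrow> lcong k (f i) (g i)) \<Longrightarrow> lcong k (sum f A) (sum g A)"
  by (induction A rule: infinite_finite_induct) (auto intro: lcong_add)

lemma lcong_prod:
  "(\<And>i. i \<in> A \<Longrightarrow> lcong k (f i) (g i)) \<Longrightarrow> (\<And>i. i \<in> A \<Longrightarrow> f i \<in> Z) \<Longrightarrow> lcong k (prod f A) (prod g A)"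
  by (induction A rule: infinite_finite_induct) (auto intro!: lcong_mult)

lemma lcong_mono: assumes "lcong k x y" "l \<le> k" shows "lcong l x y"
proof -
  obtain c where c: "c \<in> Z" "x - y = of_nat p ^ k * c" using assms unfolding lcong_def by blast
  have "x - y = of_nat p ^ l * (of_nat p ^ (k - l) * c)"
    using assms(2) by (simp add: c(2) power_add[symmetric] mult.assoc[symmetric])
  then show ?thesis using c(1) unfolding lcong_def by blast
qed

lemma lcong_iff_diff: "lcong k x y \<longleftrightarrow> lcong k (x - y) 0"
  unfolding lcong_def by simp

lemma lcong_0_mult:
  assumes "lcong k x 0" "lcong l y 0" shows "lcong (k + l) (x * y) 0"
proof -
  obtain c d where "c \<in> Z" "x = of_nat p ^ k * c" "d \<in> Z" "y = of_nat p ^ l * d"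
    using assms unfolding lcong_def by auto
  then have "x * y - 0 = of_nat p ^ (k + l) * (c * d)" by (simp add: power_add)
  then show ?thesis using \<open>c \<in> Z\<close> \<open>d \<in> Z\<close> unfolding lcong_def by blast
qed

lemma lcong_0_iff_Z: "lcong 0 x 0 \<longleftrightarrow> x \<in> Z"
  unfolding lcong_def by auto

lemma lcong_p_power: "lcong k (of_nat p ^ k) 0"
  unfolding lcong_def by (intro bexI[of _ 1]) auto

lemma lcong_p_mult: "x \<in> Z \<Longrightarrow> lcong k (of_nat p ^ k * x) 0"
  unfolding lcong_def by auto

lemma lcong_1_p_mult: "x \<in> Z \<Longrightarrow> lcong 1 (of_nat p * x) 0"
  using lcong_p_mult[of x 1] by simp

text \<open>A denominator prime to \<open>p\<close> can be cleared from a divisibility by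
  \<open>p ^ k\<close>, so no further integers become congruent in \<open>Z\<close>. Facts about
  \<open>gammap_nat\<close> enter this way.\<close>

lemma lcong_of_int_iff: "lcong k (of_int a) (of_int b) \<longleftrightarrow> [a = b] (mod int p ^ k)"
proof
  assume "lcong k (of_int a) (of_int b)"
  then obtain c d where cd: "\<not> int p dvd d"
    "(of_int a - of_int b :: rat) = of_nat p ^ k * (of_int c / of_int d)"
    unfolding lcong_def Z_def by blast
  then have "d \<noteq> 0" by auto
  with cd have "(of_int (d * (a - b)) :: rat) = of_int (int p ^ k * c)" by (simp add: field_simps)
  then have "d * (a - b) = int p ^ k * c" by (metis of_int_eq_iff)
  then have "int p ^ k dvd d * (a - b)" by simp
  moreover have "coprime (int p ^ k) d"
    using cd(1) prime_ip by (simp add: prime_imp_coprime)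
  ultimately have "int p ^ k dvd a - b" using coprime_dvd_mult_right_iff by blast
  then show "[a = b] (mod int p ^ k)" by (simp add: cong_iff_dvd_diff)
next
  assume "[a = b] (mod int p ^ k)"
  then obtain c where "a - b = int p ^ k * c" by (auto simp: cong_iff_dvd_diff elim: dvdE)
  then have "(of_int (a - b) :: rat) = of_int (int p ^ k * c)" by simp
  then have "(of_int a - of_int b :: rat) = of_nat p ^ k * of_int c" by simp
  then show "lcong k (of_int a) (of_int b)" unfolding lcong_def by blast
qed

lemma Z_cases: assumes "x \<in> Z" shows "x \<in> U \<or> lcong 1 x 0"
proof -
  obtain a b where ab: "\<not> int p dvd b" "x = of_int a / of_int b"
    using assms unfolding Z_def by blast
  show ?thesis
  proof (cases "int p dvd a")
    case True
    then obtain c where "a = int p * c" by (elim dvdE)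
    then have "x = of_nat p * (of_int c / of_int b)" using ab by simp
    then show ?thesis using Z_I[OF ab(1)] lcong_1_p_mult by blast
  next
    case False then show ?thesis using ab unfolding U_def by blast
  qed
qed

lemma U_not_lcong_0: assumes "x \<in> U" shows "\<not> lcong 1 x 0"
proof
  assume "lcong 1 x 0"
  then have "lcong 1 (inverse x * x) (inverse x * 0)"
    using lcong_mult_left U_Z U_inverse assms by blast
  then have "lcong 1 (of_int 1) (of_int 0)" using U_nonzero[OF assms] by simp
  then have "int p dvd 1" unfolding lcong_of_int_iff by (simp add: cong_iff_dvd_diff)
  then show False using prime_ip not_prime_unit by blast
qed

lemma lcong_U: assumes "lcong k x y" "k \<ge> 1" "x \<in> U" shows "y \<in> U"
proof -
  have "lcong 1 x y" using assms lcong_mono by blast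
  then show ?thesis
    using Z_cases[of y] U_not_lcong_0[OF assms(3)] lcong_trans lcong_Z U_Z assms(3) by blast
qed

lemma lcong_inverse:
  assumes "lcong k x y" "x \<in> U" "y \<in> U" shows "lcong k (inverse x) (inverse y)"
proof -
  have "lcong k (inverse x * inverse y * y) (inverse x * inverse y * x)"
    using assms by (intro lcong_mult_left lcong_sym[OF assms(1)] U_Z) auto
  then show ?thesis using U_nonzero[OF assms(2)] U_nonzero[OF assms(3)] by (simp add: field_simps)
qed

lemma lcong_divide:
  assumes "lcong k x y" "lcong k x' y'" "x \<in> Z" "x' \<in> U" "y' \<in> U"
  shows "lcong k (x / x') (y / y')"
  using lcong_mult[OF assms(1) lcong_inverse[OF assms(2,4,5)] assms(3) U_Z[OF U_inverse[OF assms(4)]]]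
  by (simp add: divide_inverse)

lemma lcong_cancel_left: assumes "lcong k (z * x) (z * y)" "z \<in> U" shows "lcong k x y"
  using lcong_mult_left[OF assms(1) U_Z[OF U_inverse[OF assms(2)]]] U_nonzero[OF assms(2)]
  by (simp add: mult.assoc[symmetric])

lemma lcong_cancel_p: assumes "lcong (k + l) (of_nat p ^ l * x) (of_nat p ^ l * y)"
  shows "lcong k x y"
proof -
  obtain c where c: "c \<in> Z" "of_nat p ^ l * x - of_nat p ^ l * y = of_nat p ^ (k + l) * c"
    using assms unfolding lcong_def by blast
  have "of_nat p ^ l * (x - y) = of_nat p ^ l * (of_nat p ^ k * c)"
    using c(2) by (simp add: algebra_simps power_add)
  then have "x - y = of_nat p ^ k * c" using p_pos by simp
  then show ?thesis using c(1) unfolding lcong_def by blast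
qed

lemma lcong_lift_p: assumes "lcong k x y" shows "lcong (k + l) (of_nat p ^ l * x) (of_nat p ^ l * y)"
proof -
  obtain c where c: "c \<in> Z" "x - y = of_nat p ^ k * c"
    using assms unfolding lcong_def by blast
  have "of_nat p ^ l * x - of_nat p ^ l * y = of_nat p ^ l * (x - y)" by (simp add: algebra_simps)
  then have "of_nat p ^ l * x - of_nat p ^ l * y = of_nat p ^ (k + l) * c"
    unfolding c(2) by (simp add: power_add)
  then show ?thesis using c(1) unfolding lcong_def by blast
qed

lemma ex_int_lcong: assumes "x \<in> Z" shows "\<exists>a. lcong k x (of_int a)"
proof -
  obtain a b where ab: "\<not> int p dvd b" "x = of_int a / of_int b"
    using assms unfolding Z_def by blast
  have "coprime b (int p ^ k)"
    using ab(1) prime_ip by (metis prime_imp_coprime coprime_commute coprime_power_left_iff)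
  then obtain c where c: "[b * c = 1] (mod int p ^ k)" using cong_solve_coprime_int by blast
  have "lcong k (of_int (a * (b * c))) (of_int (a * 1))"
    unfolding lcong_of_int_iff using c cong_scalar_left by blast
  then have "lcong k (of_int b * of_int (a * c)) (of_int b * x)"
    using ab by (auto simp: mult_ac)
  then have "lcong k (of_int (a * c)) x" using U_of_int[OF ab(1)] lcong_cancel_left by blast
  then show ?thesis using lcong_sym by blast
qed

text \<open>The lower bound \<open>m\<close> later allows \<open>\<alpha>\<close> and
  \<open>\<beta>\<close> to be moved to distinct integers above 1.\<close>

lemma ex_nat_lcong: assumes "x \<in> Z" shows "\<exists>n>m. lcong k x (of_nat n)"
proof -
  obtain a where a: "lcong k x (of_int a)" using ex_int_lcong assms by blast
  define b where "b = a mod int p ^ k + int p ^ k * (int m + 1)"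
  have "[a = b] (mod int p ^ k)" unfolding b_def by (simp add: cong_def)
  then have "lcong k x (of_int b)" using a lcong_of_int_iff lcong_trans by blast
  moreover have "b \<ge> 1 * (int m + 1)" unfolding b_def using p_pos
    by (intro order_trans[OF mult_right_mono[of 1 "int p ^ k"]]) auto
  ultimately show ?thesis by (intro exI[of _ "nat b"]) auto
qed

end


section \<open>Lagrange interpolation and sums of inverse powers\<close>

text \<open>Both sides have degree below \<open>card I\<close> and agree at the
  \<open>card I\<close> distinct nodes \<open>z i\<close>.\<close>

lemma lagrange_poly:
  fixes f :: "'a :: field poly" and z :: "'b \<Rightarrow> 'a"
  assumes fin: "finite I" and inj: "inj_on z I" and deg: "degree f < card I"
  shows "f = (\<Sum>i\<in>I. smult (poly f (z i) / (\<Prod>k\<in>I - {i}. z i - z k)) (\<Prod>k\<in>I - {i}. [:- z k, 1:]))"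
    (is "f = ?g")
proof (rule poly_eqI_degree[of "z ` I"])
  fix x assume "x \<in> z ` I"
  then obtain l where l: "l \<in> I" "x = z l" by auto
  have "poly ?g x = (\<Sum>i\<in>I. if i = l then poly f x else 0)"
    unfolding poly_sum
  proof (rule sum.cong[OF refl])
    fix i assume i: "i \<in> I"
    show "poly (smult (poly f (z i) / (\<Prod>k\<in>I - {i}. z i - z k)) (\<Prod>k\<in>I - {i}. [:- z k, 1:])) x
      = (if i = l then poly f x else 0)"
    proof (cases "i = l")
      case True
      have "(\<Prod>k\<in>I - {l}. z l - z k) \<noteq> 0"
        using inj l fin by (auto simp: inj_on_def)
      then show ?thesis using True l by (simp add: poly_prod)
    next
      case False
      then have "(\<Prod>k\<in>I - {i}. x - z k) = 0"
        using l fin by (intro prod_zero) auto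
      then show ?thesis using False by (simp add: poly_prod)
    qed
  qed
  also have "\<dots> = poly f x" using l fin by simp
  finally show "poly f x = poly ?g x" by simp
next
  have deg_term: "degree (smult c (\<Prod>k\<in>I - {i}. [:- z k, 1:])) < card I" if "i \<in> I" for i c
  proof -
    have "degree (\<Prod>k\<in>I - {i}. [:- z k, 1:]) \<le> card (I - {i})"
      using degree_prod_sum_le[of "I - {i}" "\<lambda>k. [:- z k, 1:]"] fin by simp
    also have "\<dots> < card I" using that fin by (intro psubset_card_mono) auto
    finally show ?thesis by (meson degree_smult_le le_less_trans)
  qed
  then show "card (z ` I) > degree ?g"
    unfolding card_image[OF inj]
    by (intro degree_sum_less deg_term) (use deg in auto)
qed (use deg card_image[OF inj] in auto)

text \<open>The interpolation formula divided by the node polynomial.\<close>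

lemma lagrange_partial_fractions:
  fixes f :: "'a :: field poly"
  assumes "finite I" "inj_on z I" "degree f < card I" "x \<notin> z ` I"
  shows "poly f x / (\<Prod>k\<in>I. x - z k)
    = (\<Sum>i\<in>I. poly f (z i) / (\<Prod>k\<in>I - {i}. z i - z k) / (x - z i))"
proof -
  have nz: "(\<Prod>k\<in>I. x - z k) \<noteq> 0" using assms by auto
  have "poly f x = poly (\<Sum>i\<in>I. smult (poly f (z i) / (\<Prod>k\<in>I - {i}. z i - z k))
      (\<Prod>k\<in>I - {i}. [:- z k, 1:])) x"
    using lagrange_poly[OF assms(1-3)] by simp
  also have "\<dots> = (\<Sum>i\<in>I. poly f (z i) / (\<Prod>k\<in>I - {i}. z i - z k) * (\<Prod>k\<in>I - {i}. x - z k))"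
    by (simp add: poly_sum poly_prod)
  also have "\<dots> / (\<Prod>k\<in>I. x - z k)
    = (\<Sum>i\<in>I. poly f (z i) / (\<Prod>k\<in>I - {i}. z i - z k) / (x - z i))"
    unfolding sum_divide_distrib
  proof (rule sum.cong[OF refl])
    fix i assume i: "i \<in> I"
    have "(\<Prod>k\<in>I. x - z k) = (x - z i) * (\<Prod>k\<in>I - {i}. x - z k)"
      using i assms(1) by (simp add: prod.remove)
    then show "poly f (z i) / (\<Prod>k\<in>I - {i}. z i - z k) * (\<Prod>k\<in>I - {i}. x - z k) / (\<Prod>k\<in>I. x - z k)
      = poly f (z i) / (\<Prod>k\<in>I - {i}. z i - z k) / (x - z i)"
      using nz by simp
  qed
  finally show ?thesis .
qed

lemma monic_prod_linear:
  fixes z :: "'b \<Rightarrow> 'a :: field"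
  shows "degree (\<Prod>k\<in>I. [:- z k, 1:]) = card I" "coeff (\<Prod>k\<in>I. [:- z k, 1:]) (card I) = 1"
proof -
  show 1: "degree (\<Prod>k\<in>I. [:- z k, 1:]) = card I"
    using degree_prod_eq_sum_degree[of I "\<lambda>k. [:- z k, 1:]"] by simp
  have "lead_coeff (\<Prod>k\<in>I. [:- z k, 1:]) = 1"
    by (simp add: lead_coeff_prod)
  then show "coeff (\<Prod>k\<in>I. [:- z k, 1:]) (card I) = 1" using 1 by simp
qed

text \<open>Subtracting the node polynomial \<open>D\<close> lowers the degree and keeps the values
  at the nodes, so the previous formula applies to \<open>f - D\<close>; the quotient by
  \<open>D\<close> changes by 1.\<close>

lemma lagrange_partial_fractions_monic:
  fixes f :: "'a :: field poly"
  assumes "finite I" "inj_on z I" "degree f = card I" "lead_coeff f = 1" "x \<notin> z ` I" "I \<noteq> {}"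
  shows "poly f x / (\<Prod>k\<in>I. x - z k)
    = 1 + (\<Sum>i\<in>I. poly f (z i) / (\<Prod>k\<in>I - {i}. z i - z k) / (x - z i))"
proof -
  define D where "D = (\<Prod>k\<in>I. [:- z k, 1:])"
  have D: "poly D y = (\<Prod>k\<in>I. y - z k)" for y unfolding D_def by (simp add: poly_prod)
  have nz: "poly D x \<noteq> 0" unfolding D using assms by auto
  have Dz: "poly D (z i) = 0" if "i \<in> I" for i unfolding D using that assms(1) by auto
  have "degree (f - D) < card I"
  proof (rule le_neq_implies_less)
    have "degree D = card I" unfolding D_def by (rule monic_prod_linear)
    then show "degree (f - D) \<le> card I" using assms(3) by (simp add: degree_diff_le)
    have "coeff (f - D) (card I) = 0" using assms(3,4) monic_prod_linear[of z I]
      unfolding D_def by simp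
    \<comment> \<open>This covers \<open>f = D\<close>: the zero polynomial has degree 0, which must
      be smaller than \<open>card I\<close>.\<close>
    moreover have "card I > 0" using assms by (simp add: card_gt_0_iff)
    ultimately show "degree (f - D) \<noteq> card I"
      using leading_coeff_0_iff[of "f - D"] by auto
  qed
  from lagrange_partial_fractions[OF assms(1,2) this assms(5)]
  have "(poly f x - poly D x) / poly D x
      = (\<Sum>i\<in>I. poly f (z i) / (\<Prod>k\<in>I - {i}. z i - z k) / (x - z i))"
    by (simp add: D[symmetric] Dz)
  moreover have "(poly f x - poly D x) / poly D x = poly f x / poly D x - 1"
    using nz by (simp add: field_simps)
  ultimately show ?thesis unfolding D by (simp add: diff_eq_eq add.commute)
qed

text \<open>Comparison of the coefficients of degree \<open>card I - 1\<close> in the interpolation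
  formula, where each basis polynomial is monic of that degree.\<close>

lemma lagrange_sum_monic:
  fixes f :: "'a :: field poly"
  assumes "finite I" "inj_on z I" "Suc (degree f) = card I" "lead_coeff f = 1"
  shows "(\<Sum>i\<in>I. poly f (z i) / (\<Prod>k\<in>I - {i}. z i - z k)) = 1"
proof -
  have "1 = coeff f (degree f)" using assms by simp
  also have "\<dots> = coeff (\<Sum>i\<in>I. smult (poly f (z i) / (\<Prod>k\<in>I - {i}. z i - z k))
      (\<Prod>k\<in>I - {i}. [:- z k, 1:])) (degree f)"
    using lagrange_poly[OF assms(1,2), of f] assms(3) by simp
  also have "\<dots> = (\<Sum>i\<in>I. poly f (z i) / (\<Prod>k\<in>I - {i}. z i - z k))"
    unfolding coeff_sum coeff_smult
  proof (rule sum.cong[OF refl])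
    fix i assume "i \<in> I"
    then have "card (I - {i}) = degree f" using assms by simp
    then have "coeff (\<Prod>k\<in>I - {i}. [:- z k, 1:]) (degree f) = 1"
      using monic_prod_linear(2)[of z "I - {i}"] by simp
    then show "poly f (z i) / (\<Prod>k\<in>I - {i}. z i - z k) * coeff (\<Prod>k\<in>I - {i}. [:- z k, 1:]) (degree f)
      = poly f (z i) / (\<Prod>k\<in>I - {i}. z i - z k)" by simp
  qed
  finally show ?thesis by simp
qed

context localization
begin

lemma not_dvd_diff_nat:
  assumes "i < p" "j < p" "i \<noteq> j" shows "\<not> int p dvd int j - int i"
proof
  assume "int p dvd int j - int i"
  then have "int j mod int p = int i mod int p" by (simp add: mod_eq_dvd_iff)
  then show False using assms by (simp add: zmod_int[symmetric])
qed

lemma U_diff_nat: "i < p \<Longrightarrow> j < p \<Longrightarrow> i \<noteq> j \<Longrightarrow> of_nat j - of_nat i \<in> U"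
  using U_of_int[OF not_dvd_diff_nat] by simp

lemma U_of_nat_less: "0 < i \<Longrightarrow> i < p \<Longrightarrow> of_nat i \<in> U"
  using U_diff_nat[of 0 i] p_pos by simp

lemma lcong_of_nat_iff: "lcong k (of_nat a) (of_nat b) \<longleftrightarrow> [a = b] (mod p ^ k)"
  using lcong_of_int_iff[of k "int a" "int b"] by (simp add: cong_int_iff[symmetric])

text \<open>Doubling permutes the nonzero residues, so multiplication by \<open>2 ^ k\<close> leaves
  the sum unchanged modulo \<open>p\<close>. The first hypothesis always holds for
  \<open>k = 1\<close>; for \<open>k = 2\<close> it excludes exactly \<open>p = 3\<close>.\<close>

lemma sum_inverse_powers_lcong_0:
  assumes "\<not> p dvd 2 ^ k - 1" "odd p"
  shows "lcong 1 (\<Sum>u\<in>{0<..<p}. inverse (of_nat u) ^ k) 0"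
proof -
  define f :: "nat \<Rightarrow> rat" where "f u = inverse (of_nat u) ^ k" for u
  define \<sigma> where "\<sigma> u = (2 * u) mod p" for u
  have cop: "coprime 2 p" using assms by simp
  have \<sigma>_in: "\<sigma> u \<in> {0<..<p}" if "u \<in> {0<..<p}" for u
  proof -
    have "\<not> p dvd u" using that by (auto dest: dvd_imp_le)
    then have "\<not> p dvd 2 * u" using cop by (simp add: coprime_commute coprime_dvd_mult_right_iff)
    then show ?thesis using p_pos unfolding \<sigma>_def by (auto simp: mod_greater_zero_iff_not_dvd)
  qed
  have inj: "inj_on \<sigma> {0<..<p}"
  proof (rule inj_onI)
    fix u v assume "u \<in> {0<..<p}" "v \<in> {0<..<p}" "\<sigma> u = \<sigma> v"
    then have "[2 * u = 2 * v] (mod p)" unfolding \<sigma>_def cong_def by simp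
    then have "[u = v] (mod p)" using cop by (simp add: cong_mult_lcancel_nat)
    then show "u = v" using \<open>u \<in> _\<close> \<open>v \<in> _\<close> by (auto simp: cong_def)
  qed
  have "\<sigma> ` {0<..<p} = {0<..<p}"
    using \<sigma>_in by (intro card_subset_eq) (auto simp: card_image[OF inj])
  then have bij: "bij_betw \<sigma> {0<..<p} {0<..<p}" using inj by (simp add: bij_betw_def)
  have "lcong 1 (2 ^ k * (\<Sum>u\<in>{0<..<p}. f (\<sigma> u))) (\<Sum>u\<in>{0<..<p}. f u)"
    unfolding sum_distrib_left
  proof (rule lcong_sum)
    fix u assume u: "u \<in> {0<..<p}"
    have c: "lcong 1 (of_nat (\<sigma> u)) (of_nat (2 * u))"
      unfolding lcong_of_nat_iff \<sigma>_def by (simp add: cong_def)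
    have Uu: "of_nat u \<in> U" "of_nat (\<sigma> u) \<in> U" using u \<sigma>_in[OF u] U_of_nat_less by auto
    have U2: "of_nat (2 * u) \<in> U" by (rule lcong_U[OF c]) (use Uu in auto)
    have "lcong 1 (2 * inverse (of_nat (\<sigma> u))) (2 * inverse (of_nat (2 * u)))"
      using c Uu U2 by (intro lcong_mult_left lcong_inverse) auto
    also have "2 * inverse (of_nat (2 * u)) = inverse (of_nat u :: rat)" by simp
    finally have "lcong 1 ((2 * inverse (of_nat (\<sigma> u))) ^ k) (inverse (of_nat u) ^ k)"
      using Uu by (intro lcong_power Z_mult) (auto intro: U_Z)
    then show "lcong 1 (2 ^ k * f (\<sigma> u)) (f u)" unfolding f_def by (simp add: power_mult_distrib)
  qed
  also have "(\<Sum>u\<in>{0<..<p}. f (\<sigma> u)) = (\<Sum>u\<in>{0<..<p}. f u)"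
    using sum.reindex_bij_betw[OF bij] .
  finally have "lcong 1 ((2 ^ k - 1) * (\<Sum>u\<in>{0<..<p}. f u)) ((2 ^ k - 1) * 0)"
    unfolding lcong_iff_diff[of _ "2 ^ k * _"] by (simp add: algebra_simps)
  moreover have "(2 ^ k - 1 :: rat) \<in> U"
    using U_of_nat[OF assms(1)] by (simp add: of_nat_diff)
  ultimately show ?thesis unfolding f_def using lcong_cancel_left by blast
qed

text \<open>Translation carries the residues other than \<open>i\<close> to the nonzero
  residues.\<close>

lemma sum_inverse_powers_shift_lcong_0:
  assumes "\<not> p dvd 2 ^ k - 1" "odd p" "i < p"
  shows "lcong 1 (\<Sum>j\<in>{..<p} - {i}. inverse (of_nat j - of_nat i) ^ k) 0"
proof -
  \<comment> \<open>Adding \<open>p - i\<close> in place of subtracting \<open>i\<close> avoids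
    truncated subtraction.\<close>
  define \<tau> where "\<tau> j = (j + (p - i)) mod p" for j
  have c: "lcong 1 (of_nat j - of_nat i) (of_nat (\<tau> j))" for j
  proof -
    have "lcong 1 (of_int (int j - int i)) (of_int (int (\<tau> j)))"
      unfolding lcong_of_int_iff \<tau>_def using assms(3)
      by (simp add: cong_def zmod_int of_nat_diff mod_simps) (metis add_diff_eq diff_add_eq minus_mod_self2 mod_add_self2 diff_add_cancel add.commute)
    then show ?thesis by simp
  qed
  have inj: "inj_on \<tau> ({..<p} - {i})"
  proof (rule inj_onI)
    fix u v assume "u \<in> {..<p} - {i}" "v \<in> {..<p} - {i}" "\<tau> u = \<tau> v"
    then have "[u = v] (mod p)" unfolding \<tau>_def cong_def[symmetric]
      by (metis cong_add_rcancel_nat cong_def)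
    then show "u = v" using \<open>u \<in> _\<close> \<open>v \<in> _\<close> by (auto simp: cong_def)
  qed
  have \<tau>_in: "\<tau> j \<in> {0<..<p}" if "j \<in> {..<p} - {i}" for j
  proof -
    have "of_nat j - of_nat i \<in> U" using that assms(3) U_diff_nat by auto
    then have "of_nat (\<tau> j) \<in> U" using lcong_U[OF c] by simp
    then have "\<tau> j \<noteq> 0" using U_nonzero by force
    then show ?thesis using p_pos unfolding \<tau>_def by auto
  qed
  have "\<tau> ` ({..<p} - {i}) \<subseteq> {0<..<p}" using \<tau>_in by blast
  then have "\<tau> ` ({..<p} - {i}) = {0<..<p}"
    using assms(3) by (intro card_subset_eq) (simp_all add: card_image[OF inj])
  then have bij: "bij_betw \<tau> ({..<p} - {i}) {0<..<p}" using inj by (simp add: bij_betw_def)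
  have "lcong 1 (\<Sum>j\<in>{..<p} - {i}. inverse (of_nat j - of_nat i) ^ k)
      (\<Sum>j\<in>{..<p} - {i}. inverse (of_nat (\<tau> j)) ^ k)"
  proof (rule lcong_sum)
    fix j assume j: "j \<in> {..<p} - {i}"
    have "of_nat j - of_nat i \<in> U" using j assms(3) U_diff_nat by auto
    moreover have "of_nat (\<tau> j) \<in> U" using \<tau>_in[OF j] U_of_nat_less by auto
    ultimately show "lcong 1 (inverse (of_nat j - of_nat i) ^ k) (inverse (of_nat (\<tau> j)) ^ k)"
      using c by (intro lcong_power lcong_inverse U_Z U_inverse) auto
  qed
  also have "(\<Sum>j\<in>{..<p} - {i}. inverse (of_nat (\<tau> j)) ^ k) = (\<Sum>u\<in>{0<..<p}. inverse (of_nat u :: rat) ^ k)"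
    using sum.reindex_bij_betw[OF bij, of "\<lambda>u. inverse (of_nat u) ^ k"] .
  also have "lcong 1 \<dots> 0" using sum_inverse_powers_lcong_0[OF assms(1,2)] .
  finally show ?thesis .
qed

end


section \<open>Ratios of Pochhammer symbols\<close>

text \<open>The shifts by \<open>e\<close> and \<open>- e\<close> cancel to first order. If
  \<open>p\<close> divides \<open>e\<close>, the quotient is therefore 1 modulo \<open>p ^ 2\<close>
  and not just modulo \<open>p\<close>.\<close>

lemma pochhammer_divide_square:
  fixes x e :: "'a :: field_char_0"
  assumes "pochhammer x n \<noteq> 0"
  shows "pochhammer (x - e) n * pochhammer (x + e) n / pochhammer x n ^ 2
    = (\<Prod>i\<in>{0..<n}. 1 - e ^ 2 * inverse (x + of_nat i) ^ 2)"
proof -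
  have "pochhammer (x - e) n * pochhammer (x + e) n / pochhammer x n ^ 2
    = (\<Prod>i\<in>{0..<n}. (x - e + of_nat i) * (x + e + of_nat i) / (x + of_nat i) ^ 2)"
    by (simp add: pochhammer_prod prod.distrib prod_dividef prod_power_distrib)
  also have "\<dots> = (\<Prod>i\<in>{0..<n}. 1 - e ^ 2 * inverse (x + of_nat i) ^ 2)"
  proof (rule prod.cong[OF refl])
    fix i assume "i \<in> {0..<n}"
    then have "x + of_nat i \<noteq> 0" using assms by (auto simp: pochhammer_prod)
    then show "(x - e + of_nat i) * (x + e + of_nat i) / (x + of_nat i) ^ 2
      = 1 - e ^ 2 * inverse (x + of_nat i) ^ 2"
      by (simp add: divide_simps) (simp add: power2_eq_square algebra_simps)
  qed
  finally show ?thesis .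
qed

text \<open>The common form of both kinds of summands. Put \<open>a = e - r\<close> and
  \<open>e = p \<alpha>\<close>: for \<open>x = 0\<close> this is
  \<open>(a)_j (1 - a)_j / j! ^ 2\<close>, and for \<open>x = p j / (1 - p)\<close> it is, modulo
  \<open>p ^ 3\<close>, what the parameters \<open>a\<close> and \<open>1 - a\<close> contribute to
  the \<open>j\<close>-th summand of G. Keeping \<open>e\<close> and \<open>r\<close> apart allows
  \<open>e\<close> to vary modulo \<open>p ^ 3\<close> for fixed \<open>r\<close>.\<close>

definition term_ratio :: "nat \<Rightarrow> rat \<Rightarrow> nat \<Rightarrow> rat \<Rightarrow> rat" where
  "term_ratio r e j x = (- 1) ^ r * pochhammer (1 + x - e) (r + j) * pochhammer (x + e - of_nat r) j
    / (pochhammer (x + e - of_nat r) r * pochhammer (1 + x) j ^ 2)"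

context localization
begin

lemma pochhammer_Z: "x \<in> Z \<Longrightarrow> pochhammer x n \<in> Z"
  unfolding pochhammer_prod by (intro Z_prod Z_add) auto

lemma pochhammer_lcong:
  "lcong k x y \<Longrightarrow> x \<in> Z \<Longrightarrow> lcong k (pochhammer x n) (pochhammer y n)"
  unfolding pochhammer_prod by (intro lcong_prod lcong_add) auto

lemma lcong_0_mult': "lcong k x 0 \<Longrightarrow> lcong l y 0 \<Longrightarrow> n = k + l \<Longrightarrow> lcong n (x * y) 0"
  using lcong_0_mult by simp

lemma lcong_0_Z: "lcong k x 0 \<Longrightarrow> x \<in> Z"
  using lcong_Z[of k x 0] by simp

text \<open>Modulo \<open>p\<close> the factors are \<open>1, ..., n\<close>; in
  \<open>pochhammer_diff_U\<close> they are \<open>- r, ..., - 1\<close>. Together these are the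
  denominators of \<open>term_ratio\<close>.\<close>

lemma pochhammer_Suc_U:
  assumes "lcong 1 x 0" "n < p" shows "pochhammer (1 + x) n \<in> U"
  unfolding pochhammer_prod
proof (rule U_prod)
  fix i assume "i \<in> {0..<n}"
  then have "of_nat (Suc i) \<in> U" using assms(2) by (intro U_of_nat_less) auto
  moreover have "lcong 1 (of_nat (Suc i)) (1 + x + of_nat i)"
    using lcong_add[OF lcong_sym[OF assms(1)], of "of_nat (Suc i)" "of_nat (Suc i)"]
    by (simp add: algebra_simps)
  ultimately show "1 + x + of_nat i \<in> U" using lcong_U by blast
qed

lemma pochhammer_diff_U:
  assumes "lcong 1 x 0" "r < p" shows "pochhammer (x - of_nat r) r \<in> U"
  unfolding pochhammer_prod
proof (rule U_prod)
  fix i assume "i \<in> {0..<r}"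
  then have "of_nat i - of_nat r \<in> U" using assms(2) by (intro U_diff_nat) auto
  moreover have "lcong 1 (of_nat i - of_nat r) (x - of_nat r + of_nat i)"
    using lcong_add[OF lcong_sym[OF assms(1)], of "of_nat i - of_nat r" "of_nat i - of_nat r"]
    by (simp add: algebra_simps)
  ultimately show "x - of_nat r + of_nat i \<in> U" using lcong_U by blast
qed

lemma lcong_0_add: "lcong k x 0 \<Longrightarrow> lcong k y 0 \<Longrightarrow> lcong k (x + y) 0"
  using lcong_add[of k x 0 y 0] by simp

lemma term_ratio_Z:
  assumes "lcong 1 e 0" "lcong 1 x 0" "r < p" "j < p"
  shows "term_ratio r e j x \<in> Z"
proof -
  have "e \<in> Z" "x \<in> Z" using assms lcong_0_Z by auto
  then show ?thesis unfolding term_ratio_def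
    using assms pochhammer_Suc_U[OF assms(2,4)] pochhammer_diff_U[OF lcong_0_add[OF assms(2,1)] assms(3)]
    by (intro Z_divide Z_mult U_mult Z_power U_power pochhammer_Z Z_minus Z_diff Z_add) auto
qed

text \<open>Used with \<open>k = 3\<close> to move the parameters, and with \<open>k = 1\<close> to
  compare the two points of evaluation.\<close>

lemma term_ratio_lcong:
  assumes "lcong k e e'" "lcong k x x'" "k \<ge> 1" "lcong 1 e 0" "lcong 1 x 0" "r < p" "j < p"
  shows "lcong k (term_ratio r e j x) (term_ratio r e' j x')"
proof -
  have Z: "e \<in> Z" "x \<in> Z" using assms lcong_0_Z by auto
  have "lcong 1 e' 0" "lcong 1 x' 0"
    using assms lcong_trans[OF lcong_sym[OF lcong_mono[OF assms(1,3)]] assms(4)]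
      lcong_trans[OF lcong_sym[OF lcong_mono[OF assms(2,3)]] assms(5)] by auto
  then show ?thesis unfolding term_ratio_def using Z assms
    by (intro lcong_divide lcong_mult lcong_power pochhammer_lcong lcong_add lcong_diff
        U_mult U_power pochhammer_Suc_U pochhammer_diff_U lcong_0_add)
      (auto intro!: Z_mult Z_power Z_diff Z_add Z_minus pochhammer_Z)
qed

definition correction :: "rat \<Rightarrow> nat \<Rightarrow> rat \<Rightarrow> rat" where
  "correction e j x = pochhammer (1 + x - e) j * pochhammer (1 + x + e) j / pochhammer (1 + x) j ^ 2"

text \<open>Splitting \<open>(x + e - r)_(r + j + 1)\<close> once after \<open>j\<close> and once
  after \<open>r\<close> factors brings in the symbol of length \<open>r + 1\<close> at
  \<open>j + x\<close>, which is the part of the denominator of \<open>R\<close> belonging to one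
  parameter. The factor with index \<open>r\<close> is \<open>x + e\<close>, whence the nonvanishing
  hypothesis.\<close>

lemma term_ratio_eq:
  assumes "lcong 1 e 0" "lcong 1 x 0" "r < p" "j < p" "x + e \<noteq> 0"
  shows "term_ratio r e j x = (- 1) ^ r * (x + e) * pochhammer (1 + (of_nat j + x) - e) r
    / pochhammer (of_nat j + x + e - of_nat r) (Suc r) * correction e j x"
proof -
  have xe: "lcong 1 (x + e) 0" using assms lcong_0_add by blast
  have 1: "pochhammer (1 + x - e) (r + j)
      = pochhammer (1 + x - e) j * pochhammer (1 + (of_nat j + x) - e) r"
    using pochhammer_product'[of "1 + x - e" j r] by (simp add: algebra_simps)
  have nz: "pochhammer (x + e - of_nat r) r \<noteq> 0" "pochhammer (1 + x + e) j \<noteq> 0"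
    using pochhammer_diff_U[OF xe assms(3)] pochhammer_Suc_U[OF xe assms(4)] U_nonzero
    by (auto simp: add.assoc)
  have "pochhammer (x + e - of_nat r) j * pochhammer (of_nat j + x + e - of_nat r) (Suc r)
      = pochhammer (x + e - of_nat r) (j + Suc r)"
    using pochhammer_product'[of "x + e - of_nat r" j "Suc r"] by (simp add: algebra_simps)
  also have "\<dots> = pochhammer (x + e - of_nat r) (r + Suc j)" by (simp add: add.commute)
  also have "\<dots> = pochhammer (x + e - of_nat r) r * ((x + e) * pochhammer (1 + x + e) j)"
    using pochhammer_product'[of "x + e - of_nat r" r "Suc j"] by (simp add: pochhammer_rec algebra_simps)
  finally have 2: "pochhammer (x + e - of_nat r) j * pochhammer (of_nat j + x + e - of_nat r) (Suc r)
      = pochhammer (x + e - of_nat r) r * ((x + e) * pochhammer (1 + x + e) j)" .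
  moreover have "pochhammer (of_nat j + x + e - of_nat r) (Suc r) \<noteq> 0"
  proof
    assume "pochhammer (of_nat j + x + e - of_nat r) (Suc r) = 0"
    with 2 have "pochhammer (x + e - of_nat r) r * ((x + e) * pochhammer (1 + x + e) j) = 0" by simp
    then show False using nz assms(5) by auto
  qed
  ultimately have "pochhammer (x + e - of_nat r) j / pochhammer (x + e - of_nat r) r
      = (x + e) * pochhammer (1 + x + e) j / pochhammer (of_nat j + x + e - of_nat r) (Suc r)"
    using nz by (simp add: frac_eq_eq mult_ac)
  then have "term_ratio r e j x = (- 1) ^ r * pochhammer (1 + x - e) (r + j)
    * ((x + e) * pochhammer (1 + x + e) j / pochhammer (of_nat j + x + e - of_nat r) (Suc r))
    / pochhammer (1 + x) j ^ 2"
    unfolding term_ratio_def by (metis (no_types, lifting) divide_divide_eq_left times_divide_eq_right)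
  then show ?thesis unfolding 1 correction_def by (simp add: mult_ac)
qed

text \<open>The factors are \<open>1 - e ^ 2 / (1 + x + i) ^ 2\<close> with \<open>e ^ 2\<close>
  divisible by \<open>p ^ 2\<close>. Replacing \<open>x\<close> by 0 changes the inverse square by a
  multiple of \<open>p\<close>, hence the factor by a multiple of \<open>p ^ 3\<close>.\<close>

lemma correction_lcong:
  assumes "lcong 1 e 0" "lcong 1 x 0" "j < p"
  shows "lcong 2 (correction e j x) 1" "lcong 3 (correction e j x) (correction e j 0)"
    "correction e j x \<in> U"
proof -
  have Z: "e \<in> Z" "x \<in> Z" using assms lcong_0_Z by auto
  have eq: "correction e j y = (\<Prod>i\<in>{0..<j}. 1 - e ^ 2 * inverse (1 + y + of_nat i) ^ 2)"
    if "lcong 1 y 0" for y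
    unfolding correction_def
    by (rule pochhammer_divide_square) (use pochhammer_Suc_U[OF that assms(3)] U_nonzero in auto)
  have e2: "lcong 2 (e ^ 2) 0"
    using lcong_0_mult[OF assms(1,1)] by (metis one_add_one power2_eq_square)
  have inv: "inverse (1 + y + of_nat i) \<in> U" if "i < j" "lcong 1 y 0" for i y
    using pochhammer_Suc_U[OF that(2), of "Suc i"] pochhammer_Suc_U[OF that(2), of i] that assms(3)
      U_divide[of "pochhammer (1 + y) (Suc i)" "pochhammer (1 + y) i"] U_nonzero
    by (auto simp: pochhammer_Suc)
  have fac: "lcong 2 (1 - e ^ 2 * inverse (1 + y + of_nat i) ^ 2) 1" if "i < j" "lcong 1 y 0" for i y
    using lcong_diff[OF lcong_refl[of 2 1] lcong_mult_left[OF e2 Z_power[OF U_Z[OF inv[OF that]], of 2]]]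
    by (simp add: mult.commute)
  have facZ: "1 - e ^ 2 * inverse (1 + y + of_nat i) ^ 2 \<in> Z" if "i < j" "lcong 1 y 0" for i y
    using lcong_Z[OF fac[OF that]] by simp
  have "lcong 2 (\<Prod>i\<in>{0..<j}. 1 - e ^ 2 * inverse (1 + x + of_nat i) ^ 2) (\<Prod>i\<in>{0..<j}. 1)"
    using fac facZ assms(2) by (intro lcong_prod) auto
  then show 2: "lcong 2 (correction e j x) 1" unfolding eq[OF assms(2)] by simp
  then show "correction e j x \<in> U" using lcong_U[OF lcong_sym[OF 2]] by simp
  have "lcong 3 (\<Prod>i\<in>{0..<j}. 1 - e ^ 2 * inverse (1 + x + of_nat i) ^ 2)
     (\<Prod>i\<in>{0..<j}. 1 - e ^ 2 * inverse (1 + 0 + of_nat i) ^ 2)"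
  proof (rule lcong_prod)
    fix i assume i: "i \<in> {0..<j}"
    show "1 - e ^ 2 * inverse (1 + x + of_nat i) ^ 2 \<in> Z" using facZ i assms(2) by simp
    have "inverse (1 + x + of_nat i) \<in> U" using inv i assms(2) by simp
    moreover have "inverse (1 + 0 + of_nat i) \<in> U" using inv[of i 0] i assms(2) by simp
    moreover have "lcong 1 (1 + x + of_nat i) (1 + 0 + of_nat i)"
      by (intro lcong_add assms) auto
    ultimately have "lcong 1 (inverse (1 + x + of_nat i) ^ 2) (inverse (1 + 0 + of_nat i) ^ 2)"
      using U_inverse by (intro lcong_power lcong_inverse U_Z) force+
    then have "lcong 1 (inverse (1 + x + of_nat i) ^ 2 - inverse (1 + 0 + of_nat i) ^ 2) 0"
      by (subst (asm) lcong_iff_diff)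
    then have "lcong 3 (e ^ 2 * (inverse (1 + x + of_nat i) ^ 2 - inverse (1 + 0 + of_nat i) ^ 2)) 0"
      by (rule lcong_0_mult'[OF e2]) simp
    then have "lcong 3 (e ^ 2 * inverse (1 + x + of_nat i) ^ 2) (e ^ 2 * inverse (1 + 0 + of_nat i) ^ 2)"
      by (subst lcong_iff_diff) (simp add: algebra_simps)
    then show "lcong 3 (1 - e ^ 2 * inverse (1 + x + of_nat i) ^ 2)
       (1 - e ^ 2 * inverse (1 + 0 + of_nat i) ^ 2)"
      by (intro lcong_diff) auto
  qed
  then show "lcong 3 (correction e j x) (correction e j 0)"
    unfolding eq[OF assms(2)] using eq[of 0] by simp
qed

end


section \<open>Partial fractions\<close>

text \<open>\<open>c True\<close> and \<open>c False\<close> are \<open>\<alpha>\<close> and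
  \<open>\<beta>\<close> after a shift modulo \<open>p ^ 3\<close>. Distinctness makes the poles
  simple, and \<open>c b > 1\<close> keeps them away from the points \<open>j\<close> and
  \<open>j / (1 - p)\<close>. The original parameters are at most 1/2 and may coincide.\<close>

locale pole_data = localization +
  fixes c :: "bool \<Rightarrow> rat" and rr :: "bool \<Rightarrow> nat"
  assumes rr_less: "rr b < p" and c_Z: "c b \<in> Z" and c_gt: "c b > 1"
    and c_ne: "c True \<noteq> c False" and p_gt_3: "p > 3"
begin

lemma odd_p: "odd p"
  using prime_p p_gt_3 prime_odd_nat by auto

definition I :: "(bool \<times> nat) set" where "I = (SIGMA b:UNIV. {..rr b})"

definition pole :: "bool \<times> nat \<Rightarrow> rat" where
  "pole k = of_nat (snd k) - of_nat p * c (fst k)"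

definition num :: "rat poly" where
  "num = (\<Prod>b\<in>UNIV. \<Prod>i\<in>{0..<rr b}. [:- (of_nat p * c b - 1 - of_nat i), 1:])"

definition h :: "rat poly" where "h = (\<Prod>b\<in>UNIV. [:- (- c b), 1:])"

text \<open>The residue of \<open>R\<close> at \<open>pole k\<close>, all poles being
  simple.\<close>

definition res :: "bool \<times> nat \<Rightarrow> rat" where
  "res k = poly num (pole k) / (\<Prod>l\<in>I - {k}. pole k - pole l)"

definition R :: "rat \<Rightarrow> rat" where "R t = poly num t / (\<Prod>k\<in>I. t - pole k)"

lemma finite_I [simp]: "finite I" unfolding I_def by simp

lemma I_nonempty: "I \<noteq> {}" unfolding I_def by auto

lemma in_I_iff: "(b, i) \<in> I \<longleftrightarrow> i \<le> rr b" unfolding I_def by simp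

lemma snd_less: "k \<in> I \<Longrightarrow> snd k < p"
  using rr_less le_less_trans unfolding I_def by fastforce

lemma pole_Z: "pole k \<in> Z"
  unfolding pole_def using c_Z by (intro Z_diff Z_mult) auto

lemma pole_lcong: "lcong 1 (pole k) (of_nat (snd k))"
  using lcong_diff[OF lcong_refl[of 1 "of_nat (snd k)"] lcong_1_p_mult[OF c_Z[of "fst k"]]]
  unfolding pole_def by simp

text \<open>Modulo \<open>p\<close> the pole \<open>(b, i)\<close> is just \<open>i\<close>, so the
  only other pole congruent to it can be \<open>(\<not> b, i)\<close>.\<close>

lemma pole_diff_U: assumes "k \<in> I" "l \<in> I" "snd k \<noteq> snd l" shows "pole k - pole l \<in> U"
proof -
  have "of_nat (snd k) - of_nat (snd l) \<in> U" using assms snd_less by (intro U_diff_nat) auto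
  moreover have "lcong 1 (pole k - pole l) (of_nat (snd k) - of_nat (snd l))"
    by (intro lcong_diff pole_lcong)
  ultimately show ?thesis using lcong_U lcong_sym by blast
qed

lemma inj_pole: "inj_on pole I"
proof (rule inj_onI)
  fix k l assume kl: "k \<in> I" "l \<in> I" "pole k = pole l"
  then have s: "snd k = snd l"
    using pole_diff_U[of k l] U_nonzero[of "pole k - pole l"] by auto
  then have "c (fst k) = c (fst l)" using kl(3) p_pos unfolding pole_def by simp
  then have "fst k = fst l" using c_ne by (cases "fst k"; cases "fst l") auto
  with s show "k = l" by (simp add: prod_eq_iff)
qed

lemma card_I: "card I = rr True + rr False + 2"
  unfolding I_def by (subst card_SigmaI) (auto simp: UNIV_bool)

lemma num_monic: "degree num = rr True + rr False" "lead_coeff num = 1"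
proof -
  have nz: "(\<Prod>i\<in>{0..<rr b}. [:- (of_nat p * c b - 1 - of_nat i), 1:]) \<noteq> 0" for b by simp
  show "degree num = rr True + rr False"
    unfolding num_def UNIV_bool
    using degree_mult_eq[OF nz nz] monic_prod_linear(1)[of "\<lambda>i. of_nat p * c _ - 1 - of_nat i"]
    by (simp add: add.commute)
  show "lead_coeff num = 1" unfolding num_def by (simp add: lead_coeff_prod)
qed

lemma h_monic: "degree h = 2" "lead_coeff h = 1"
  unfolding h_def using monic_prod_linear(1)[of "\<lambda>b. - c b" UNIV]
  by (simp_all add: lead_coeff_prod UNIV_bool)

lemma num_nonzero: "num \<noteq> 0" and h_nonzero: "h \<noteq> 0"
  using num_monic(2) h_monic(2) by auto

lemma poly_num: "poly num t = (\<Prod>b\<in>UNIV. pochhammer (1 + t - of_nat p * c b) (rr b))"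
  unfolding num_def by (simp add: poly_prod pochhammer_prod algebra_simps)

lemma poly_h: "poly h t = (t + c True) * (t + c False)"
  unfolding h_def by (simp add: UNIV_bool algebra_simps)

lemma poly_h_pole: "poly h (pole (b, i)) = (pole (b, i) + c b) * (pole (b, i) + c (\<not> b))"
  unfolding poly_h by (cases b) auto

lemma prod_pole:
  "(\<Prod>k\<in>I. t - pole k) = (\<Prod>b\<in>UNIV. pochhammer (t + of_nat p * c b - of_nat (rr b)) (Suc (rr b)))"
proof -
  have "(\<Prod>k\<in>I. t - pole k) = (\<Prod>b\<in>UNIV. \<Prod>i\<le>rr b. t - pole (b, i))"
    unfolding I_def by (subst prod.Sigma) auto
  also have "\<dots> = (\<Prod>b\<in>UNIV. \<Prod>i<Suc (rr b). t - (of_nat i - of_nat p * c b))"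
    by (simp add: pole_def lessThan_Suc_atMost)
  \<comment> \<open>Counting \<open>i\<close> down from \<open>rr b\<close> puts the factors into
    the ascending order of a Pochhammer symbol.\<close>
  also have "\<dots> = (\<Prod>b\<in>UNIV. \<Prod>i<Suc (rr b). t - (of_nat (Suc (rr b) - Suc i) - of_nat p * c b))"
    by (subst prod.nat_diff_reindex[symmetric]) simp
  also have "\<dots> = (\<Prod>b\<in>UNIV. pochhammer (t + of_nat p * c b - of_nat (rr b)) (Suc (rr b)))"
    unfolding pochhammer_prod by (intro prod.cong) (auto simp: of_nat_diff)
  finally show ?thesis .
qed

lemma R_partial_fractions: "t \<notin> pole ` I \<Longrightarrow> R t = (\<Sum>k\<in>I. res k / (t - pole k))"
  unfolding R_def res_def using num_monic card_I inj_pole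
  by (intro lagrange_partial_fractions) auto

text \<open>The quadratic \<open>h\<close> raises the degree of the numerator to the number of
  poles; the constant 1 is the resulting value at infinity.\<close>

lemma hR_partial_fractions:
  assumes "t \<notin> pole ` I"
  shows "poly h t * R t = 1 + (\<Sum>k\<in>I. poly h (pole k) * res k / (t - pole k))"
proof -
  have "degree (h * num) = card I"
    by (simp add: degree_mult_eq[OF h_nonzero num_nonzero] h_monic num_monic card_I)
  moreover have "lead_coeff (h * num) = 1"
    unfolding lead_coeff_mult using h_monic(2) num_monic(2) by simp
  ultimately have "poly (h * num) t / (\<Prod>k\<in>I. t - pole k)
    = 1 + (\<Sum>k\<in>I. poly (h * num) (pole k) / (\<Prod>l\<in>I - {k}. pole k - pole l) / (t - pole k))"
    using assms inj_pole I_nonempty by (intro lagrange_partial_fractions_monic) auto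
  then show ?thesis unfolding R_def res_def by simp
qed

text \<open>The numerator of \<open>t R(t)\<close> has degree one less than the number of poles, so
  the sum of its residues is its leading coefficient.\<close>

lemma sum_pole_res: "(\<Sum>k\<in>I. pole k * res k) = 1"
proof -
  have "degree (pCons 0 num) = Suc (degree num)" using num_nonzero by simp
  then have "(\<Sum>k\<in>I. poly (pCons 0 num) (pole k) / (\<Prod>l\<in>I - {k}. pole k - pole l)) = 1"
    using num_monic card_I inj_pole by (intro lagrange_sum_monic) auto
  then show ?thesis unfolding res_def by simp
qed

text \<open>The index \<open>snd k\<close> is left out here and in \<open>L1\<close> because only
  there the denominator is divisible by \<open>p\<close>. The factor \<open>1 - p\<close> in
  \<open>L1\<close> comes from clearing the denominator of \<open>pt j\<close>.\<close>

definition L0 :: "bool \<times> nat \<Rightarrow> rat" where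
  "L0 k = (\<Sum>j\<in>{..<p} - {snd k}. inverse (of_nat j - pole k))"

definition L1 :: "bool \<times> nat \<Rightarrow> rat" where
  "L1 k = (\<Sum>j\<in>{..<p} - {snd k}. inverse (of_nat j - (1 - of_nat p) * pole k))"

text \<open>The coefficient of \<open>res k\<close> in the difference of the two sums over
  \<open>j\<close>, after the terms \<open>j = snd k\<close> have been split off.\<close>

definition rest :: "bool \<times> nat \<Rightarrow> rat" where
  "rest k = poly h (pole k) * L1 k - c True * c False * L0 k"

abbreviation pt :: "nat \<Rightarrow> rat" where "pt j \<equiv> of_nat j / (1 - of_nat p)"

lemma one_minus_p_nonzero: "1 - of_nat p \<noteq> (0 :: rat)"
  using p_gt_3 by simp

lemma scaled_pole_lcong: "lcong 1 ((1 - of_nat p) * pole k) (of_nat (snd k))"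
proof -
  have "lcong 1 (pole k - of_nat p * pole k) (of_nat (snd k) - 0)"
    by (intro lcong_diff pole_lcong lcong_1_p_mult pole_Z)
  then show ?thesis by (simp add: algebra_simps)
qed

lemma diff_lcong_U:
  assumes "lcong 1 y (of_nat i)" "i < p" "j < p" "i \<noteq> j" shows "of_nat j - y \<in> U"
  using lcong_U[OF lcong_diff[OF lcong_refl[of 1 "of_nat j"] lcong_sym[OF assms(1)]]]
    U_diff_nat[OF assms(2-4)] by simp

text \<open>The sum is \<open>i - (p - 1) c b\<close>, which is negative because
  \<open>i \<le> p - 1\<close> and \<open>c b > 1\<close>.\<close>

lemma pole_plus_c_nonzero:
  assumes "(b, i) \<in> I" shows "pole (b, i) + c b \<noteq> 0"
proof -
  have "rat_of_nat (Suc i) \<le> rat_of_nat p"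
    using snd_less[OF assms] by (intro of_nat_mono) auto
  then have "rat_of_nat i \<le> (rat_of_nat p - 1) * 1" by simp
  also have "\<dots> < (rat_of_nat p - 1) * c b"
    using c_gt p_gt_3 by (intro mult_strict_left_mono) auto
  finally show ?thesis unfolding pole_def by (simp add: algebra_simps)
qed

text \<open>Poles with an index other than \<open>j\<close> are excluded modulo \<open>p\<close>;
  for index \<open>j\<close> the hypothesis \<open>c b > 1\<close> decides.\<close>

lemma not_pole: assumes "j < p" shows "of_nat j \<notin> pole ` I" "pt j \<notin> pole ` I"
proof -
  show "of_nat j \<notin> pole ` I"
  proof
    assume "of_nat j \<in> pole ` I"
    then obtain b i where bi: "(b, i) \<in> I" "of_nat j = pole (b, i)" by auto
    show False
    proof (cases "i = j")
      case True
      then show False using bi c_gt[of b] p_pos unfolding pole_def by simp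
    next
      case False
      then have "of_nat j - pole (b, i) \<in> U"
        using diff_lcong_U[OF pole_lcong[of "(b, i)"], of j] snd_less[OF bi(1)] assms by simp
      then show False using U_nonzero bi(2) by fastforce
    qed
  qed
  show "pt j \<notin> pole ` I"
  proof
    assume "pt j \<in> pole ` I"
    then obtain b i where bi: "(b, i) \<in> I" "pt j = pole (b, i)" by auto
    then have eq: "of_nat j = (1 - of_nat p) * pole (b, i)"
      using one_minus_p_nonzero by (simp add: field_simps)
    show False
    proof (cases "i = j")
      case True
      then have "of_nat p * (pole (b, i) + c b) = 0"
        using eq unfolding pole_def by (simp add: algebra_simps)
      then show False using pole_plus_c_nonzero[OF bi(1)] p_pos by simp
    next
      case False
      then have "of_nat j - (1 - of_nat p) * pole (b, i) \<in> U"
        using diff_lcong_U[OF scaled_pole_lcong[of "(b, i)"], of j] snd_less[OF bi(1)] assms by simp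
      then show False using U_nonzero eq by fastforce
    qed
  qed
qed

text \<open>The terms \<open>j = i\<close> of the two sums over \<open>j\<close> combine to \<open>pole (b, i) / p\<close>.\<close>

lemma main_identity:
  "of_nat p ^ 2 * ((\<Sum>j<p. poly h (pt j) * R (pt j) / (1 - of_nat p))
      - c True * c False * (\<Sum>j<p. R (of_nat j)))
    = of_nat p ^ 3 / (1 - of_nat p) + of_nat p + of_nat p ^ 2 * (\<Sum>k\<in>I. res k * rest k)"
proof -
  have p0: "of_nat p \<noteq> (0 :: rat)" using p_pos by simp
  have scale: "(a / q - y) * q = a - q * y" if "q \<noteq> 0" for a q y :: rat
    using that by (simp add: field_simps)
  have expand: "q ^ 2 * (q / (1 - q) + 1 / q + s) = q ^ 3 / (1 - q) + q + q ^ 2 * s"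
    if "q \<noteq> 0" for q s :: rat
    using that by (simp add: distrib_left power2_eq_square power3_eq_cube)
  have cancel: "y * w * inverse (q * y) = w / q" if "y \<noteq> 0" "q \<noteq> 0" for y w q :: rat
    using that by (simp add: field_simps)
  define S0 where "S0 k = (\<Sum>j<p. inverse (of_nat j - pole k))" for k
  define S1 where "S1 k = (\<Sum>j<p. inverse (of_nat j - (1 - of_nat p) * pole k))" for k
  have split: "(\<Sum>j<p. inverse (of_nat j - y)) = inverse (of_nat i - y)
      + (\<Sum>j\<in>{..<p} - {i}. inverse (of_nat j - y))" if "i < p" for i and y :: rat
    using that by (simp add: sum.remove)
  have 1: "(\<Sum>j<p. poly h (pt j) * R (pt j) / (1 - of_nat p))
      = of_nat p / (1 - of_nat p)
        + (\<Sum>k\<in>I. poly h (pole k) * res k * S1 k)"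
  proof -
    have "poly h (pt j) * R (pt j) / (1 - of_nat p) = 1 / (1 - of_nat p)
        + (\<Sum>k\<in>I. poly h (pole k) * res k * inverse (of_nat j - (1 - of_nat p) * pole k))"
      if "j < p" for j
    proof -
      have "poly h (pole k) * res k / (pt j - pole k) / (1 - of_nat p)
          = poly h (pole k) * res k * inverse (of_nat j - (1 - of_nat p) * pole k)" for k
      proof -
        have "(pt j - pole k) * (1 - of_nat p) = of_nat j - (1 - of_nat p) * pole k"
          using scale[OF one_minus_p_nonzero] .
        then show ?thesis by (metis divide_divide_eq_left divide_inverse)
      qed
      then show ?thesis unfolding hR_partial_fractions[OF not_pole(2)[OF that]]
        by (simp add: add_divide_distrib sum_divide_distrib)
    qed
    then have "(\<Sum>j<p. poly h (pt j) * R (pt j) / (1 - of_nat p)) = (\<Sum>j<p. 1 / (1 - of_nat p)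
        + (\<Sum>k\<in>I. poly h (pole k) * res k * inverse (of_nat j - (1 - of_nat p) * pole k)))"
      by (intro sum.cong) auto
    also have "\<dots> = of_nat p / (1 - of_nat p) + (\<Sum>j<p. \<Sum>k\<in>I. poly h (pole k) * res k
        * inverse (of_nat j - (1 - of_nat p) * pole k))"
      by (simp add: sum.distrib)
    also have "(\<Sum>j<p. \<Sum>k\<in>I. poly h (pole k) * res k * inverse (of_nat j - (1 - of_nat p) * pole k))
      = (\<Sum>k\<in>I. poly h (pole k) * res k * S1 k)"
      unfolding S1_def sum_distrib_left by (rule sum.swap)
    finally show ?thesis .
  qed
  have 2: "(\<Sum>j<p. R (of_nat j)) = (\<Sum>k\<in>I. res k * S0 k)"
  proof -
    have "(\<Sum>j<p. R (of_nat j)) = (\<Sum>j<p. \<Sum>k\<in>I. res k * inverse (of_nat j - pole k))"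
      by (intro sum.cong) (auto simp: R_partial_fractions[OF not_pole(1)] divide_inverse)
    also have "\<dots> = (\<Sum>k\<in>I. res k * S0 k)"
      unfolding S0_def sum_distrib_left by (rule sum.swap)
    finally show ?thesis .
  qed
  \<comment> \<open>At \<open>j = i\<close> the factor \<open>pole k + c b\<close> of
    \<open>h (pole k)\<close> cancels, leaving \<open>(pole k + c (\<not> b)) / p\<close> in the
    first sum against \<open>c (\<not> b) / p\<close> in the second.\<close>
  have 3: "poly h (pole k) * S1 k - c True * c False * S0 k = pole k / of_nat p + rest k"
    if k: "k \<in> I" for k
  proof -
    obtain b i where bi: "k = (b, i)" by (cases k)
    have i: "i < p" using snd_less[OF k] bi by simp
    have "of_nat i - (1 - of_nat p) * pole k = of_nat p * (pole k + c b)"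
      unfolding bi pole_def by (simp add: algebra_simps)
    then have "poly h (pole k) * inverse (of_nat i - (1 - of_nat p) * pole k)
        = (pole k + c (\<not> b)) / of_nat p"
      using cancel[OF pole_plus_c_nonzero p0] k unfolding bi poly_h_pole by simp
    moreover have "c True * c False * inverse (of_nat i - pole k) = c (\<not> b) / of_nat p"
    proof -
      have "c True * c False = c b * c (\<not> b)" by (cases b) auto
      moreover have "of_nat i - pole k = of_nat p * c b" unfolding bi pole_def by simp
      ultimately show ?thesis using c_gt[of b] p0 by (simp add: field_simps)
    qed
    ultimately show ?thesis
      unfolding S0_def S1_def split[OF i] rest_def L0_def L1_def
      by (simp only: bi snd_conv distrib_left add_divide_distrib)
  qed
  have "(\<Sum>j<p. poly h (pt j) * R (pt j) / (1 - of_nat p)) - c True * c False * (\<Sum>j<p. R (of_nat j))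
     = of_nat p / (1 - of_nat p) + (\<Sum>k\<in>I. res k
       * (poly h (pole k) * S1 k - c True * c False * S0 k))"
  proof -
    have "(\<Sum>k\<in>I. res k * (poly h (pole k) * S1 k - c True * c False * S0 k))
        = (\<Sum>k\<in>I. poly h (pole k) * res k * S1 k) - c True * c False * (\<Sum>k\<in>I. res k * S0 k)"
      unfolding sum_distrib_left sum_subtractf[symmetric]
      by (intro sum.cong refl) (simp add: algebra_simps)
    then show ?thesis unfolding 1 2 by simp
  qed
  also have "\<dots> = of_nat p / (1 - of_nat p) + (\<Sum>k\<in>I. res k * (pole k / of_nat p + rest k))"
    by (simp only: 3 cong: sum.cong)
  also have "\<dots> = of_nat p / (1 - of_nat p) + (\<Sum>k\<in>I. pole k * res k) / of_nat p
      + (\<Sum>k\<in>I. res k * rest k)"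
    by (simp add: distrib_left sum.distrib sum_divide_distrib mult.commute)
  \<comment> \<open>Because the weighted residues add up to 1, the terms \<open>pole k / p\<close>
    amount to \<open>1 / p\<close>, which becomes the main term \<open>p\<close> after
    multiplication by \<open>p ^ 2\<close>.\<close>
  finally show ?thesis unfolding sum_pole_res using expand[OF p0] by simp
qed

end


section \<open>The remainder modulo the cube of the prime\<close>

context localization
begin

lemma U_divide_power_p:
  assumes "x \<in> Z" "x \<noteq> 0" shows "\<exists>e v. v \<in> U \<and> x = of_nat p ^ e * v"
proof -
  obtain a b where ab: "\<not> int p dvd b" "x = of_int a / of_int b"
    using assms(1) unfolding Z_def by blast
  have "a \<noteq> 0" using assms(2) ab(2) by auto
  moreover have "\<not> is_unit (int p)" using prime_ip not_prime_unit by blast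
  ultimately obtain a' where a': "a = int p ^ multiplicity (int p) a * a'" "\<not> int p dvd a'"
    using multiplicity_decompose'[of a "int p"] by blast
  have "x = of_nat p ^ multiplicity (int p) a * (of_int a' / of_int b)"
    unfolding ab(2) by (subst a'(1)) simp
  moreover have "of_int a' / of_int b \<in> U"
    using a'(2) ab(1) unfolding U_def by blast
  ultimately show ?thesis by blast
qed

lemma lcong_0_mult_Z: "lcong k x 0 \<Longrightarrow> y \<in> Z \<Longrightarrow> lcong k (x * y) 0"
  using lcong_0_mult[of k x 0 y] lcong_0_iff_Z by simp

lemma lcong_0_mult_Z': "lcong k x 0 \<Longrightarrow> y \<in> Z \<Longrightarrow> lcong k (y * x) 0"
  using lcong_0_mult_Z by (simp add: mult.commute)

lemma lcong_sum_0: "(\<And>i. i \<in> A \<Longrightarrow> lcong k (f i) 0) \<Longrightarrow> lcong k (sum f A) 0"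
  using lcong_sum[of A k f "\<lambda>_. 0"] by simp

end

context pole_data
begin

lemma diff_lcong: "lcong 1 y (of_nat i) \<Longrightarrow> lcong 1 (of_nat j - y) (of_nat j - of_nat i)"
  by (intro lcong_diff) auto

lemma inverse_diff_lcong:
  assumes "lcong 1 y (of_nat i)" "i < p" "j \<in> {..<p} - {i}"
  shows "lcong 1 (inverse (of_nat j - y)) (inverse (of_nat j - of_nat i))"
    "inverse (of_nat j - y) \<in> Z"
proof -
  have U: "of_nat j - y \<in> U" "of_nat j - of_nat i \<in> U"
    using assms diff_lcong_U[OF assms(1,2), of j] U_diff_nat[of i j] by auto
  show "lcong 1 (inverse (of_nat j - y)) (inverse (of_nat j - of_nat i))"
    by (rule lcong_inverse[OF diff_lcong[OF assms(1)] U])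
  show "inverse (of_nat j - y) \<in> Z" using U_Z[OF U_inverse[OF U(1)]] .
qed

lemma sum_inverse_diff_lcong_0:
  assumes "lcong 1 y (of_nat i)" "i < p"
  shows "lcong 1 (\<Sum>j\<in>{..<p} - {i}. inverse (of_nat j - y)) 0"
proof -
  have "lcong 1 (\<Sum>j\<in>{..<p} - {i}. inverse (of_nat j - y))
      (\<Sum>j\<in>{..<p} - {i}. inverse (of_nat j - of_nat i) ^ 1)"
    unfolding power_one_right by (intro lcong_sum inverse_diff_lcong[OF assms])
  also have "lcong 1 \<dots> 0"
    using p_gt_3 odd_p assms(2) by (intro sum_inverse_powers_shift_lcong_0) auto
  finally show ?thesis .
qed

text \<open>The difference is \<open>y - y'\<close> times the sum of
  \<open>1 / ((j - y) (j - y'))\<close>. Modulo \<open>p\<close> that is a sum of inverse squares,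
  hence 0 since \<open>p > 3\<close>, so one power of \<open>p\<close> is gained.\<close>

lemma sum_inverse_diff_lcong:
  assumes "lcong m y y'" "m \<ge> 1" "lcong 1 y (of_nat i)" "i < p"
  shows "lcong (Suc m) (\<Sum>j\<in>{..<p} - {i}. inverse (of_nat j - y))
    (\<Sum>j\<in>{..<p} - {i}. inverse (of_nat j - y'))"
proof -
  have y': "lcong 1 y' (of_nat i)"
    using lcong_trans[OF lcong_sym[OF lcong_mono[OF assms(1,2)]] assms(3)] .
  have "lcong 1 (\<Sum>j\<in>{..<p} - {i}. inverse (of_nat j - y) * inverse (of_nat j - y'))
      (\<Sum>j\<in>{..<p} - {i}. inverse (of_nat j - of_nat i) ^ 2)"
    unfolding power2_eq_square
    by (intro lcong_sum lcong_mult inverse_diff_lcong[OF assms(3,4)] inverse_diff_lcong[OF y' assms(4)])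
  also have "lcong 1 \<dots> 0"
  proof (intro sum_inverse_powers_shift_lcong_0 odd_p assms(4))
    show "\<not> p dvd 2\<^sup>2 - 1" using p_gt_3 by (auto dest: dvd_imp_le)
  qed
  finally have S: "lcong 1 (\<Sum>j\<in>{..<p} - {i}. inverse (of_nat j - y) * inverse (of_nat j - y')) 0" .
  have "lcong m (y - y') 0" using assms(1) by (subst (asm) lcong_iff_diff)
  then have "lcong (Suc m)
      ((y - y') * (\<Sum>j\<in>{..<p} - {i}. inverse (of_nat j - y) * inverse (of_nat j - y'))) 0"
    using S by (rule lcong_0_mult') simp
  also have "(y - y') * (\<Sum>j\<in>{..<p} - {i}. inverse (of_nat j - y) * inverse (of_nat j - y'))
    = (\<Sum>j\<in>{..<p} - {i}. inverse (of_nat j - y)) - (\<Sum>j\<in>{..<p} - {i}. inverse (of_nat j - y'))"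
    unfolding sum_distrib_left sum_subtractf[symmetric]
  proof (rule sum.cong[OF refl])
    fix j assume j: "j \<in> {..<p} - {i}"
    have "of_nat j - y \<noteq> 0" "of_nat j - y' \<noteq> 0"
      using diff_lcong_U[OF assms(3,4), of j] diff_lcong_U[OF y' assms(4), of j] j by auto
    then show "(y - y') * (inverse (of_nat j - y) * inverse (of_nat j - y'))
      = inverse (of_nat j - y) - inverse (of_nat j - y')"
      by (simp add: field_simps)
  qed
  finally show ?thesis by (subst lcong_iff_diff)
qed

lemma poly_h_Z: "poly h (pole k) \<in> Z"
  unfolding poly_h by (intro Z_mult Z_add pole_Z c_Z)

lemma L0_lcong_0: "k \<in> I \<Longrightarrow> lcong 1 (L0 k) 0" and L1_lcong_0: "k \<in> I \<Longrightarrow> lcong 1 (L1 k) 0"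
  unfolding L0_def L1_def
  by (simp_all only: sum_inverse_diff_lcong_0 pole_lcong scaled_pole_lcong snd_less)

lemma rest_lcong_0: assumes "k \<in> I" shows "lcong 1 (rest k) 0"
proof -
  have "lcong 1 (poly h (pole k) * L1 k - c True * c False * L0 k) (0 - 0)"
    using assms
    by (intro lcong_diff lcong_0_mult_Z' L0_lcong_0 L1_lcong_0 poly_h_Z Z_mult c_Z)
  then show ?thesis unfolding rest_def by simp
qed

lemma poly_h_lcong: "lcong m (pole k) (pole l) \<Longrightarrow> lcong m (poly h (pole k)) (poly h (pole l))"
  unfolding poly_h by (intro lcong_mult lcong_add Z_add pole_Z c_Z lcong_refl)

text \<open>The sums \<open>L0\<close> and \<open>L1\<close> gain a power of \<open>p\<close> by the
  previous argument; the change of \<open>h\<close> gains one because it is multiplied by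
  \<open>L1\<close>, itself divisible by \<open>p\<close>.\<close>

lemma rest_lcong:
  assumes "k \<in> I" "l \<in> I" "snd k = snd l" "lcong m (pole k) (pole l)" "m \<ge> 1"
  shows "lcong (Suc m) (rest k) (rest l)"
proof -
  have "lcong m ((1 - of_nat p) * pole k) ((1 - of_nat p) * pole l)"
    using assms(4) by (intro lcong_mult_left) auto
  then have L1: "lcong (Suc m) (L1 k) (L1 l)" unfolding L1_def assms(3)
    using assms snd_less[OF assms(2)] scaled_pole_lcong[of k]
    by (intro sum_inverse_diff_lcong) auto
  have L0: "lcong (Suc m) (L0 k) (L0 l)" unfolding L0_def assms(3)
    using assms snd_less[OF assms(2)] pole_lcong[of k]
    by (intro sum_inverse_diff_lcong) auto
  have "lcong m (poly h (pole k) - poly h (pole l)) 0"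
    using poly_h_lcong[OF assms(4)] by (subst (asm) lcong_iff_diff)
  then have "lcong (Suc m) ((poly h (pole k) - poly h (pole l)) * L1 k) 0"
    using L1_lcong_0[OF assms(1)] by (rule lcong_0_mult') simp
  then have "lcong (Suc m) ((poly h (pole k) - poly h (pole l)) * L1 k + poly h (pole l) * L1 k)
      (0 + poly h (pole l) * L1 l)"
    by (intro lcong_add lcong_mult_left L1 poly_h_Z)
  then have "lcong (Suc m) (poly h (pole k) * L1 k) (poly h (pole l) * L1 l)"
    by (simp add: algebra_simps)
  then show ?thesis unfolding rest_def
    by (intro lcong_diff lcong_mult_left L0 Z_mult c_Z)
qed

text \<open>The residue without the factor belonging to a congruent pole; what is left in the
  denominator is a unit.\<close>

definition reduced_res :: "bool \<times> nat \<Rightarrow> rat" where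
  "reduced_res k = poly num (pole k) / (\<Prod>l\<in>{l\<in>I. snd l \<noteq> snd k}. pole k - pole l)"

lemma poly_num_Z: "poly num (pole k) \<in> Z"
  unfolding poly_num by (intro Z_prod pochhammer_Z Z_diff Z_add Z_mult Z_1 Z_of_nat pole_Z c_Z)

lemma reduced_res_Z: assumes "k \<in> I" shows "reduced_res k \<in> Z"
  unfolding reduced_res_def
  using assms by (intro Z_divide U_prod poly_num_Z pole_diff_U) auto

lemma reduced_res_lcong:
  assumes "k \<in> I" "l \<in> I" "snd k = snd l" "lcong m (pole k) (pole l)"
  shows "lcong m (reduced_res k) (reduced_res l)"
  unfolding reduced_res_def assms(3)
proof (intro lcong_divide poly_num_Z)
  show "lcong m (poly num (pole k)) (poly num (pole l))"
    unfolding poly_num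
    by (intro lcong_prod pochhammer_lcong pochhammer_Z lcong_diff lcong_add lcong_refl assms(4)
        Z_diff Z_add Z_mult Z_1 Z_of_nat pole_Z c_Z)
  show U1: "(\<Prod>l'\<in>{l'\<in>I. snd l' \<noteq> snd l}. pole k - pole l') \<in> U"
    "(\<Prod>l'\<in>{l'\<in>I. snd l' \<noteq> snd l}. pole l - pole l') \<in> U"
    using assms by (intro U_prod pole_diff_U; force)+
  show "lcong m (\<Prod>l'\<in>{l'\<in>I. snd l' \<noteq> snd l}. pole k - pole l')
    (\<Prod>l'\<in>{l'\<in>I. snd l' \<noteq> snd l}. pole l - pole l')"
    by (intro lcong_prod lcong_diff lcong_refl assms(4) Z_diff pole_Z)
qed

lemma res_single:
  assumes "(b, i) \<in> I" "(\<not> b, i) \<notin> I" shows "res (b, i) = reduced_res (b, i)"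
proof -
  have "I - {(b, i)} = {l\<in>I. snd l \<noteq> i}"
  proof (intro equalityI subsetI)
    fix x assume "x \<in> I - {(b, i)}"
    then show "x \<in> {l\<in>I. snd l \<noteq> i}" using assms by (cases x; cases b; cases "fst x") auto
  qed (use assms in auto)
  then show ?thesis unfolding res_def reduced_res_def by simp
qed

lemma res_double:
  assumes "(b, i) \<in> I" "(\<not> b, i) \<in> I"
  shows "res (b, i) = reduced_res (b, i) / (of_nat p * (c (\<not> b) - c b))"
proof -
  have "I - {(b, i)} = insert (\<not> b, i) {l\<in>I. snd l \<noteq> i}"
  proof (intro equalityI subsetI)
    fix x assume "x \<in> I - {(b, i)}"
    then show "x \<in> insert (\<not> b, i) {l\<in>I. snd l \<noteq> i}"
      using assms by (cases x; cases b; cases "fst x") auto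
  qed (use assms in auto)
  then have "(\<Prod>l\<in>I - {(b, i)}. pole (b, i) - pole l)
    = (pole (b, i) - pole (\<not> b, i)) * (\<Prod>l\<in>{l\<in>I. snd l \<noteq> i}. pole (b, i) - pole l)"
    by simp
  moreover have "pole (b, i) - pole (\<not> b, i) = of_nat p * (c (\<not> b) - c b)"
    unfolding pole_def by (simp add: algebra_simps)
  ultimately show ?thesis unfolding res_def reduced_res_def by simp
qed

text \<open>A pole without partner has an integral residue, and \<open>rest\<close> is divisible by
  \<open>p\<close>. For a pair, the contribution is \<open>(q g - q' g') / (p d)\<close> with
  reduced residues \<open>q\<close>, \<open>q'\<close>, values \<open>g\<close>, \<open>g'\<close>
  of \<open>rest\<close>, and distance \<open>p d\<close> of the poles. If \<open>d\<close> has
  valuation \<open>e\<close>, then \<open>p ^ (e + 1)\<close> divides \<open>q - q'\<close>,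
  \<open>p\<close> divides \<open>g\<close>, and \<open>p ^ (e + 2)\<close> divides
  \<open>g - g'\<close>. So \<open>p ^ (e + 2)\<close> divides the numerator, one \<open>p\<close>
  survives the division, and the prefactor \<open>p ^ 2\<close> completes the cube.\<close>

lemma block_lcong_0:
  "lcong 3 (of_nat p ^ 2 * ((if (True, i) \<in> I then res (True, i) * rest (True, i) else 0)
    + (if (False, i) \<in> I then res (False, i) * rest (False, i) else 0))) 0"
proof -
  have single: "lcong 3 (of_nat p ^ 2 * (res (b, i) * rest (b, i))) 0"
    if b: "(b, i) \<in> I" "(\<not> b, i) \<notin> I" for b
    unfolding res_single[OF b]
    using lcong_p_power[of 2] lcong_0_mult_Z'[OF rest_lcong_0[OF b(1)] reduced_res_Z[OF b(1)]]
    by (rule lcong_0_mult') simp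
  have double: ?thesis if b: "(True, i) \<in> I" "(False, i) \<in> I"
  proof -
    define d where "d = c False - c True"
    have d: "d \<noteq> 0" "d \<in> Z" unfolding d_def using c_ne c_Z by auto
    obtain e v where ev: "v \<in> U" "d = of_nat p ^ e * v" using U_divide_power_p[OF d(2,1)] by blast
    have diff: "pole (True, i) - pole (False, i) = of_nat p ^ Suc e * v"
      using ev(2) unfolding d_def pole_def by (simp add: algebra_simps)
    then have pc: "lcong (Suc e) (pole (True, i)) (pole (False, i))"
      using lcong_p_mult[OF U_Z[OF ev(1)], of "Suc e"] by (subst lcong_iff_diff) simp
    let ?q = "\<lambda>b. reduced_res (b, i)" and ?g = "\<lambda>b. rest (b, i)"
    have g: "lcong (Suc (Suc e)) (?g True) (?g False)"
      by (rule rest_lcong[OF b _ pc]) auto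
    have "lcong (Suc e) (?q True - ?q False) 0"
      by (subst lcong_iff_diff[symmetric], rule reduced_res_lcong[OF b _ pc]) simp
    then have "lcong (Suc (Suc e)) ((?q True - ?q False) * ?g True) 0"
      using rest_lcong_0[OF b(1)] by (rule lcong_0_mult') simp
    then have "lcong (Suc (Suc e)) ((?q True - ?q False) * ?g True + ?q False * ?g True)
        (0 + ?q False * ?g False)"
      using g reduced_res_Z[OF b(2)] by (intro lcong_add lcong_mult_left) auto
    then have "lcong (Suc (Suc e)) (?q True * ?g True - ?q False * ?g False) 0"
      by (subst lcong_iff_diff[symmetric]) (simp add: algebra_simps)
    then have "lcong (2 + Suc (Suc e)) (of_nat p ^ 2 * (?q True * ?g True - ?q False * ?g False)) 0"
      by (rule lcong_0_mult[OF lcong_p_power])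
    \<comment> \<open>The two products are not known to be integral, so the multiple by
      \<open>p ^ (e + 1)\<close> is treated and the power is cancelled afterwards.\<close>
    moreover have "of_nat p ^ 2 * (?q True * ?g True - ?q False * ?g False)
      = of_nat p ^ Suc e * (v * (of_nat p ^ 2 * (res (True, i) * ?g True + res (False, i) * ?g False)))"
    proof -
      have rT: "res (True, i) = ?q True / (of_nat p * d)"
        using res_double[of True] b unfolding d_def by simp
      have "of_nat p * (c True - c False) = - (of_nat p * d)" unfolding d_def by (simp add: algebra_simps)
      then have rF: "res (False, i) = - (?q False / (of_nat p * d))"
        using res_double[of False] b by simp
      have "?q True * ?g True - ?q False * ?g False
        = (of_nat p * d) * (res (True, i) * ?g True + res (False, i) * ?g False)"
        unfolding rT rF using d(1) p_pos by (simp add: field_simps)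
      then show ?thesis unfolding ev(2) by simp
    qed
    moreover have "2 + Suc (Suc e) = 3 + Suc e" by simp
    ultimately have "lcong (3 + Suc e)
        (of_nat p ^ Suc e * (v * (of_nat p ^ 2 * (res (True, i) * ?g True + res (False, i) * ?g False))))
        (of_nat p ^ Suc e * 0)"
      by (simp only: mult_zero_right)
    from lcong_cancel_p[OF this]
    have "lcong 3 (v * (of_nat p ^ 2 * (res (True, i) * ?g True + res (False, i) * ?g False))) (v * 0)"
      by simp
    from lcong_cancel_left[OF this ev(1)] show ?thesis using b by simp
  qed
  show ?thesis using single[of True] single[of False] double
    by (cases "(True, i) \<in> I"; cases "(False, i) \<in> I") auto
qed

lemma sum_res_rest_lcong_0: "lcong 3 (of_nat p ^ 2 * (\<Sum>k\<in>I. res k * rest k)) 0"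
proof -
  have inner: "(\<Sum>i\<le>rr b. res (b, i) * rest (b, i))
    = (\<Sum>i<p. if (b, i) \<in> I then res (b, i) * rest (b, i) else 0)" for b
    using rr_less[of b] by (intro sum.mono_neutral_cong_left) (auto simp: in_I_iff)
  have "(\<Sum>k\<in>I. res k * rest k) = (\<Sum>b\<in>UNIV. \<Sum>i\<le>rr b. res (b, i) * rest (b, i))"
    unfolding I_def by (subst sum.Sigma) auto
  also have "\<dots> = (\<Sum>b\<in>UNIV. \<Sum>i<p. if (b, i) \<in> I then res (b, i) * rest (b, i) else 0)"
    by (simp only: inner)
  finally have "of_nat p ^ 2 * (\<Sum>k\<in>I. res k * rest k)
    = (\<Sum>i<p. of_nat p ^ 2 * ((if (True, i) \<in> I then res (True, i) * rest (True, i) else 0)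
    + (if (False, i) \<in> I then res (False, i) * rest (False, i) else 0)))"
    by (simp add: UNIV_bool sum.distrib sum_distrib_left algebra_simps)
  then show ?thesis using lcong_sum_0[OF block_lcong_0] by simp
qed

end

section \<open>Removal of the correction factors and summation over \<open>j\<close>\<close>

context localization
begin

lemma p_lcong_0: "lcong 1 (of_nat p) 0"
  using lcong_p_power[of 1] by simp

lemma one_minus_p_U: "1 - of_nat p \<in> U"
  using lcong_U[OF lcong_sym[OF lcong_diff[OF lcong_refl[of 1 1] p_lcong_0]]] by simp

text \<open>With \<open>q = 1 / (1 - p)\<close> the error is
  \<open>(A q - B) (\<kappa>' - 1) + A q (\<kappa> - \<kappa>')\<close>. The two factors of the
  first product are divisible by \<open>p\<close> and \<open>p ^ 2\<close>, since \<open>q\<close>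
  is 1 and \<open>A\<close> equals \<open>B\<close> modulo \<open>p\<close>; the second product is
  divisible by \<open>p ^ 3\<close>.\<close>

lemma lcong_corrected:
  assumes f: "f = A * \<kappa>" and f': "f' = B * \<kappa>'" and Z: "f \<in> Z" "f' \<in> Z" and U: "\<kappa> \<in> U" "\<kappa>' \<in> U"
    and ff': "lcong 1 f f'" and \<kappa>: "lcong 2 \<kappa> 1" "lcong 3 \<kappa> \<kappa>'"
  shows "lcong 3 (f / (1 - of_nat p) - f') (A / (1 - of_nat p) - B)"
proof -
  have A: "A \<in> Z" and B: "B \<in> Z"
    using Z_divide[OF Z(1) U(1)] Z_divide[OF Z(2) U(2)] U[THEN U_nonzero] f f' by simp_all
  define q :: rat where "q = inverse (1 - of_nat p)"
  have q: "q \<in> Z" unfolding q_def using one_minus_p_U by (intro U_Z U_inverse)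
  have "lcong 1 q (inverse (1 - 0))"
    unfolding q_def using one_minus_p_U
    by (intro lcong_inverse lcong_diff p_lcong_0) auto
  then have q1: "lcong 1 q 1" by simp
  have \<kappa>': "lcong 2 \<kappa>' 1" using lcong_trans[OF lcong_sym[OF lcong_mono[OF \<kappa>(2), of 2]] \<kappa>(1)] by simp
  have "lcong 1 (A * \<kappa>) (A * 1)" "lcong 1 (B * \<kappa>') (B * 1)"
    using A B by (auto intro!: lcong_mult_left lcong_mono[OF \<kappa>(1)] lcong_mono[OF \<kappa>'] simp del: mult_1_right)
  then have AB: "lcong 1 A B" unfolding f[symmetric] f'[symmetric]
    using ff' lcong_sym lcong_trans by (metis mult.right_neutral)
  have "lcong 1 (A * q) (B * 1)" using AB q1 A q by (intro lcong_mult) auto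
  then have "lcong 1 (A * q - B) 0" by (subst (asm) lcong_iff_diff) simp
  moreover have "lcong 2 (\<kappa>' - 1) 0" using \<kappa>' by (subst (asm) lcong_iff_diff)
  ultimately have "lcong 3 ((A * q - B) * (\<kappa>' - 1)) 0" by (rule lcong_0_mult') simp
  moreover have "lcong 3 (A * q * (\<kappa> - \<kappa>')) 0"
    using \<kappa>(2) A q by (intro lcong_0_mult_Z') (auto simp: lcong_iff_diff[symmetric])
  ultimately have "lcong 3 ((A * q - B) * (\<kappa>' - 1) + A * q * (\<kappa> - \<kappa>') + (A * q - B)) (0 + 0 + (A * q - B))"
    by (intro lcong_add) auto
  then show ?thesis unfolding f f' q_def by (simp add: divide_inverse algebra_simps)
qed

end

context pole_data
begin

lemma pt_Z: "pt j \<in> Z"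
  using one_minus_p_U by (intro Z_divide) auto

definition tr :: "bool \<Rightarrow> nat \<Rightarrow> rat \<Rightarrow> rat" where
  "tr b = term_ratio (rr b) (of_nat p * c b)"

definition corr :: "nat \<Rightarrow> rat \<Rightarrow> rat" where
  "corr j x = correction (of_nat p * c True) j x * correction (of_nat p * c False) j x"

text \<open>Two arguments are needed: the linear factors depend on the small argument
  \<open>x\<close> of \<open>term_ratio\<close>, while \<open>R\<close> is evaluated at
  \<open>t = j + x\<close>.\<close>

definition main_part :: "rat \<Rightarrow> rat \<Rightarrow> rat" where
  "main_part t x = (- 1) ^ (rr True + rr False)
    * ((x + of_nat p * c True) * (x + of_nat p * c False)) * R t"

lemma tr_product:
  assumes "j < p" "lcong 1 x 0" "\<And>b. x + of_nat p * c b \<noteq> 0"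
  shows "tr True j x * tr False j x = main_part (of_nat j + x) x * corr j x"
proof -
  have 1: "tr b j x = (- 1) ^ rr b * (x + of_nat p * c b)
      * pochhammer (1 + (of_nat j + x) - of_nat p * c b) (rr b)
      / pochhammer (of_nat j + x + of_nat p * c b - of_nat (rr b)) (Suc (rr b))
      * correction (of_nat p * c b) j x" for b
    unfolding tr_def using assms rr_less c_Z by (intro term_ratio_eq lcong_1_p_mult) auto
  show ?thesis unfolding 1 main_part_def R_def corr_def poly_num prod_pole
    by (simp add: UNIV_bool power_add mult_ac)
qed

lemma tr_Z: "j < p \<Longrightarrow> lcong 1 x 0 \<Longrightarrow> tr b j x \<in> Z"
  unfolding tr_def using c_Z rr_less by (intro term_ratio_Z lcong_1_p_mult)

lemma corr_lcong:
  assumes "j < p" "lcong 1 x 0"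
  shows "lcong 2 (corr j x) 1" "lcong 3 (corr j x) (corr j 0)" "corr j x \<in> U"
proof -
  note cl = correction_lcong[OF lcong_1_p_mult[OF c_Z] assms(2,1)]
  show "corr j x \<in> U" unfolding corr_def using cl by auto
  have "lcong 2 (corr j x) (1 * 1)" unfolding corr_def using cl by (intro lcong_mult) (auto intro: U_Z)
  then show "lcong 2 (corr j x) 1" by simp
  show "lcong 3 (corr j x) (corr j 0)" unfolding corr_def using cl
    by (intro lcong_mult) (auto intro: U_Z)
qed

lemma pt_plus_c_nonzero: assumes "j < p" shows "pt j + c b \<noteq> 0"
proof -
  have "rat_of_nat (Suc j) \<le> rat_of_nat p" using assms by (intro of_nat_mono) auto
  then have "rat_of_nat j \<le> (rat_of_nat p - 1) * 1" by simp
  also have "\<dots> < (rat_of_nat p - 1) * c b"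
    using c_gt p_gt_3 by (intro mult_strict_left_mono) auto
  finally have "of_nat j + (1 - of_nat p) * c b \<noteq> 0" by (simp add: algebra_simps)
  moreover have "of_nat j + (1 - of_nat p) * c b = (1 - of_nat p) * (pt j + c b)"
    using one_minus_p_nonzero by (simp add: distrib_left)
  ultimately show ?thesis by auto
qed

lemma sum_tr_lcong:
  "lcong 3 (\<Sum>j<p. tr True j (of_nat p * pt j) * tr False j (of_nat p * pt j) / (1 - of_nat p)
      - tr True j 0 * tr False j 0) ((- 1) ^ (rr True + rr False) * of_nat p)"
proof -
  let ?s = "(- 1) ^ (rr True + rr False) :: rat"
  have sZ: "?s \<in> Z" by (intro Z_power Z_minus) auto
  \<comment> \<open>For \<open>x = p (pt j)\<close> the argument \<open>j + x\<close> of
    \<open>R\<close> is \<open>pt j\<close> again, so \<open>h\<close> and \<open>R\<close> are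
    taken at the same point.\<close>
  have pt: "of_nat j + of_nat p * pt j = pt j" for j
    using one_minus_p_nonzero by (simp add: field_simps)
  have x: "lcong 1 (of_nat p * pt j) 0" for j using pt_Z by (rule lcong_1_p_mult)
  have mx: "main_part (pt j) (of_nat p * pt j) = ?s * of_nat p ^ 2 * (poly h (pt j) * R (pt j))" for j
    unfolding main_part_def poly_h by (simp add: power2_eq_square algebra_simps)
  have m0: "main_part (of_nat j) 0 = ?s * of_nat p ^ 2 * (c True * c False * R (of_nat j))" for j
    unfolding main_part_def by (simp add: power2_eq_square)
  have "lcong 3 (tr True j (of_nat p * pt j) * tr False j (of_nat p * pt j) / (1 - of_nat p)
      - tr True j 0 * tr False j 0)
      (main_part (pt j) (of_nat p * pt j) / (1 - of_nat p) - main_part (of_nat j) 0)"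
    if j: "j < p" for j
  proof (rule lcong_corrected)
    have "of_nat p * pt j + of_nat p * c b = of_nat p * (pt j + c b)" for b by (simp add: distrib_left)
    then have "of_nat p * pt j + of_nat p * c b \<noteq> 0" for b
      using pt_plus_c_nonzero[OF j] p_pos by simp
    from tr_product[OF j x this]
    show "tr True j (of_nat p * pt j) * tr False j (of_nat p * pt j)
      = main_part (pt j) (of_nat p * pt j) * corr j (of_nat p * pt j)" by (simp only: pt)
    have "0 + of_nat p * c b \<noteq> 0" for b using p_pos c_gt[of b] by simp
    from tr_product[OF j lcong_refl this]
    show "tr True j 0 * tr False j 0 = main_part (of_nat j) 0 * corr j 0" by simp
    show "tr True j (of_nat p * pt j) * tr False j (of_nat p * pt j) \<in> Z" "tr True j 0 * tr False j 0 \<in> Z"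
      by (intro Z_mult tr_Z j x lcong_refl)+
    show "corr j (of_nat p * pt j) \<in> U" "corr j 0 \<in> U" "lcong 2 (corr j (of_nat p * pt j)) 1"
      "lcong 3 (corr j (of_nat p * pt j)) (corr j 0)"
      by (rule corr_lcong[OF j x] corr_lcong[OF j lcong_refl])+
    show "lcong 1 (tr True j (of_nat p * pt j) * tr False j (of_nat p * pt j)) (tr True j 0 * tr False j 0)"
    proof -
      have "lcong 1 (tr b j (of_nat p * pt j)) (tr b j 0)" for b
        unfolding tr_def
        by (intro term_ratio_lcong x lcong_1_p_mult j rr_less c_Z lcong_refl order_refl)
      then show ?thesis by (intro lcong_mult tr_Z j x)
    qed
  qed
  then have "lcong 3 (\<Sum>j<p. tr True j (of_nat p * pt j) * tr False j (of_nat p * pt j) / (1 - of_nat p)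
      - tr True j 0 * tr False j 0)
      (\<Sum>j<p. main_part (pt j) (of_nat p * pt j) / (1 - of_nat p) - main_part (of_nat j) 0)"
    by (intro lcong_sum) auto
  also have "(\<Sum>j<p. main_part (pt j) (of_nat p * pt j) / (1 - of_nat p) - main_part (of_nat j) 0)
    = ?s * (of_nat p ^ 2 * ((\<Sum>j<p. poly h (pt j) * R (pt j) / (1 - of_nat p))
      - c True * c False * (\<Sum>j<p. R (of_nat j))))"
    unfolding mx m0 sum_distrib_left sum_subtractf[symmetric] right_diff_distrib
    by (intro sum.cong refl) (simp add: mult_ac)
  also have "\<dots> = ?s * (of_nat p ^ 3 / (1 - of_nat p) + of_nat p + of_nat p ^ 2 * (\<Sum>k\<in>I. res k * rest k))"
    unfolding main_identity by simp
  also have "lcong 3 \<dots> (?s * (0 + of_nat p + 0))"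
  proof (intro lcong_mult_left sZ lcong_add lcong_refl sum_res_rest_lcong_0)
    have "of_nat p ^ 3 / (1 - of_nat p) = of_nat p ^ 3 * (1 / (1 - of_nat p) :: rat)" by simp
    moreover have "lcong 3 (of_nat p ^ 3 * (1 / (1 - of_nat p))) 0"
      using one_minus_p_U by (intro lcong_p_mult Z_divide) auto
    ultimately show "lcong 3 (of_nat p ^ 3 / (1 - of_nat p)) 0" by simp
  qed
  finally show ?thesis by simp
qed

end

context localization
begin

text \<open>
  The summands depend on \<open>\<alpha>\<close> and \<open>\<beta>\<close> only modulo \<open>p\<^sup>3\<close>, so these can be moved to distinct
  large integers, for which all the poles are simple and distinct from the points of evaluation.
\<close>

theorem sum_term_ratio_lcong:
  assumes "p > 3" "\<alpha> \<in> Z" "\<beta> \<in> Z" "r < p" "s < p"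
  defines "x \<equiv> \<lambda>j. of_nat p * (of_nat j / (1 - of_nat p))"
  shows "lcong 3 (\<Sum>j<p. term_ratio r (of_nat p * \<alpha>) j (x j) * term_ratio s (of_nat p * \<beta>) j (x j)
      / (1 - of_nat p) - term_ratio r (of_nat p * \<alpha>) j 0 * term_ratio s (of_nat p * \<beta>) j 0)
    ((- 1) ^ (r + s) * of_nat p)"
proof -
  obtain m where m: "m > 1" "lcong 3 \<alpha> (of_nat m)" using ex_nat_lcong[OF assms(2)] by blast
  obtain n where n: "n > m" "lcong 3 \<beta> (of_nat n)" using ex_nat_lcong[OF assms(3)] by blast
  define c :: "bool \<Rightarrow> rat" where "c b = (if b then of_nat m else of_nat n)" for b
  define rr where "rr b = (if b then r else s)" for b
  interpret pole_data p c rr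
    by unfold_locales (use assms m n in \<open>auto simp: c_def rr_def\<close>)
  have x: "lcong 1 (x j) 0" for j unfolding x_def using pt_Z by (rule lcong_1_p_mult)
  have one: "lcong 3 (term_ratio r (of_nat p * \<alpha>) j y) (tr True j y)" if "j < p" "lcong 1 y 0" for j y
  proof -
    have "lcong 3 (term_ratio r (of_nat p * \<alpha>) j y) (term_ratio r (of_nat p * of_nat m) j y)"
      using that assms(1-5) m by (intro term_ratio_lcong lcong_mult_left lcong_1_p_mult) auto
    then show ?thesis unfolding tr_def by (simp add: c_def rr_def)
  qed
  have two: "lcong 3 (term_ratio s (of_nat p * \<beta>) j y) (tr False j y)" if "j < p" "lcong 1 y 0" for j y
  proof -
    have "lcong 3 (term_ratio s (of_nat p * \<beta>) j y) (term_ratio s (of_nat p * of_nat n) j y)"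
      using that assms(1-5) n by (intro term_ratio_lcong lcong_mult_left lcong_1_p_mult) auto
    then show ?thesis unfolding tr_def by (simp add: c_def rr_def)
  qed
  have Z: "term_ratio r (of_nat p * \<alpha>) j y \<in> Z" "term_ratio s (of_nat p * \<beta>) j y \<in> Z"
    if "j < p" "lcong 1 y 0" for j y
    using that assms(1-5) by (auto intro!: term_ratio_Z lcong_1_p_mult)
  have "lcong 3 (\<Sum>j<p. term_ratio r (of_nat p * \<alpha>) j (x j) * term_ratio s (of_nat p * \<beta>) j (x j)
      / (1 - of_nat p) - term_ratio r (of_nat p * \<alpha>) j 0 * term_ratio s (of_nat p * \<beta>) j 0)
    (\<Sum>j<p. tr True j (x j) * tr False j (x j) / (1 - of_nat p) - tr True j 0 * tr False j 0)"
    using one two Z x one_minus_p_U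
    by (intro lcong_sum lcong_diff lcong_divide lcong_mult) (auto intro!: Z_mult)
  also have "lcong 3 \<dots> ((- 1) ^ (rr True + rr False) * of_nat p)"
    unfolding x_def by (rule sum_tr_lcong)
  finally show ?thesis by (simp add: rr_def)
qed

end


section \<open>The p-adic gamma function\<close>

context localization
begin

abbreviation units_below :: "nat \<Rightarrow> nat set" where
  "units_below n \<equiv> {j. 0 < j \<and> j < n \<and> \<not> p dvd j}"

lemma totatives_prime_power: "N > 0 \<Longrightarrow> totatives (p ^ N) = units_below (p ^ N)"
proof -
  assume N: "N > 0"
  have "coprime j (p ^ N) \<longleftrightarrow> \<not> p dvd j" for j
  proof
    show "\<not> p dvd j" if "coprime j (p ^ N)"
    proof
      assume "p dvd j"
      then have "is_unit p" using coprime_common_divisor[OF that] dvd_power[of N p] N by blast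
      then show False using prime_p not_prime_unit by blast
    qed
    show "coprime j (p ^ N)" if "\<not> p dvd j"
      using prime_imp_coprime[OF prime_p that]
      by (subst coprime_commute) (simp add: coprime_power_left_iff)
  qed
  moreover have "j \<noteq> p ^ N" if "\<not> p dvd j" for j using N that by auto
  ultimately show ?thesis unfolding totatives_def by (auto intro: le_neq_implies_less)
qed

text \<open>Wilson's theorem for odd prime powers. If the primitive root \<open>g\<close> has order
  \<open>2 t\<close>, the product is \<open>g ^ (t (2 t - 1))\<close>, an odd power of
  \<open>g ^ t\<close>, which is -1.\<close>

lemma prod_units_below_prime_power:
  assumes "odd p" "N > 0" shows "[(\<Prod>j\<in>units_below (p ^ N). int j) = - 1] (mod int p ^ N)"
proof -
  define m where "m = p ^ N"
  have m: "m > 2"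
  proof -
    have "p > 2" using assms(1) p_ge_2 by (cases "p = 2") auto
    also have "p \<le> m" unfolding m_def using assms(2) p_pos by (simp add: self_le_power)
    finally show ?thesis .
  qed
  obtain g where g: "residue_primroot m g"
    using residue_primroot_odd_prime_power_exists[OF prime_p assms(1)] assms(2) unfolding m_def by blast
  have "even (totient m)" using m by (rule totient_even)
  then obtain t where t: "totient m = 2 * t" by (elim evenE)
  have t0: "t > 0" using t m by (metis gr0I mult_0_right not_numeral_less_zero totient_0_iff)
  define h where "h = int g ^ t"
  have ord: "ord m g = 2 * t" and "coprime m g" using g t unfolding residue_primroot_def by auto
  have "[g ^ (2 * t) = 1] (mod m)" using ord ord_works by metis
  then have "[int (g ^ (2 * t)) = int 1] (mod int m)" by (simp only: cong_int_iff)
  then have "[int g ^ (2 * t) = 1] (mod int m)" by simp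
  then have "int m dvd int g ^ (2 * t) - 1" by (simp add: cong_iff_dvd_diff)
  then have dvd: "int m dvd (h - 1) * (h + 1)"
    unfolding h_def by (simp add: algebra_simps power_mult power2_eq_square flip: power_add)
  have "\<not> [g ^ t = 1] (mod m)" unfolding ord_divides using ord t0 by (auto dest: dvd_imp_le)
  then have n1: "\<not> int m dvd h - 1"
    unfolding h_def using cong_int_iff[of "g ^ t" 1 m] by (simp add: cong_iff_dvd_diff)
  \<comment> \<open>The odd prime \<open>p\<close> cannot divide both \<open>h - 1\<close> and
    \<open>h + 1\<close>, so \<open>p ^ N\<close> divides one of them, and it is not
    \<open>h - 1\<close> by the order of \<open>g\<close>.\<close>
  have "int m dvd h + 1"
  proof (cases "int p dvd h - 1")
    case False
    then have "coprime (int m) (h - 1)"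
      unfolding m_def using prime_ip by (simp add: prime_imp_coprime)
    then show ?thesis using dvd by (simp add: coprime_dvd_mult_right_iff)
  next
    case True
    have "\<not> int p dvd h + 1"
    proof
      assume "int p dvd h + 1"
      then have "int p dvd (h + 1) - (h - 1)" using True by (rule dvd_diff)
      then have "int p dvd 2" by simp
      then have "p dvd 2" by presburger
      then show False using assms(1) p_ge_2 by (auto dest!: dvd_imp_le)
    qed
    then have "coprime (int m) (h + 1)"
      unfolding m_def using prime_ip by (simp add: prime_imp_coprime)
    then show ?thesis using dvd n1 by (simp add: coprime_dvd_mult_left_iff)
  qed
  then have h: "[h = - 1] (mod int m)" by (simp add: cong_iff_dvd_diff)
  have "(\<Prod>j\<in>units_below m. int j) = (\<Prod>i<2 * t. int (g ^ i mod m))"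
    using prod.reindex_bij_betw[OF residue_primroot_is_generator[OF _ g], of int] m t
      totatives_prime_power[OF assms(2)] unfolding m_def[symmetric] by simp
  also have "[\<dots> = (\<Prod>i<2 * t. int g ^ i)] (mod int m)"
    by (intro cong_prod) (simp add: zmod_int cong_def)
  also have "(\<Prod>i<2 * t. int g ^ i) = int g ^ (\<Sum>i<2 * t. i)"
    by (simp add: power_sum)
  also have "(\<Sum>i<2 * t. i) = t * (2 * t - 1)"
    using t0 by (simp add: lessThan_atLeast0 Sum_Ico_nat)
  also have "int g ^ (t * (2 * t - 1)) = h ^ (2 * t - 1)" unfolding h_def by (simp add: power_mult)
  also have "[h ^ (2 * t - 1) = (- 1) ^ (2 * t - 1)] (mod int m)" by (intro cong_pow h)
  also have "(- 1 :: int) ^ (2 * t - 1) = - 1" using t0 by simp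
  finally show ?thesis unfolding m_def by simp
qed

lemma gammap_nat_0 [simp]: "gammap_nat p 0 = 1"
  unfolding gammap_nat_def by simp

lemma gammap_nat_Suc:
  "gammap_nat p (Suc n) = - (if p dvd n then 1 else int n) * gammap_nat p n"
proof (cases "p dvd n")
  case True
  then have "units_below (Suc n) = units_below n" by (auto simp: less_Suc_eq)
  then show ?thesis using True unfolding gammap_nat_def by simp
next
  case False
  then have "n > 0" by (cases n) auto
  then have "units_below (Suc n) = insert n (units_below n)" using False by (auto simp: less_Suc_eq)
  then show ?thesis using False unfolding gammap_nat_def by simp
qed

lemma not_dvd_gammap_nat: "\<not> int p dvd gammap_nat p n"
proof (induction n)
  case 0
  then show ?case using p_ge_2 by simp
next
  case (Suc n)
  then show ?case unfolding gammap_nat_Suc using not_dvd_mult[of "int n" "gammap_nat p n"] by auto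
qed

text \<open>The sign \<open>(- 1) ^ (p ^ N) = - 1\<close> cancels the -1 of Wilson's
  theorem.\<close>

lemma gammap_nat_prime_power:
  assumes "odd p" "N > 0" shows "[gammap_nat p (p ^ N) = 1] (mod int p ^ N)"
proof -
  have "gammap_nat p (p ^ N) = - (\<Prod>j\<in>units_below (p ^ N). int j)"
    unfolding gammap_nat_def using assms by simp
  also have "[\<dots> = - (- 1)] (mod int p ^ N)"
    by (subst cong_minus_minus_iff) (rule prod_units_below_prime_power[OF assms])
  finally show ?thesis by simp
qed

text \<open>Both sides satisfy the same recursion in \<open>n\<close> modulo
  \<open>p ^ N\<close>.\<close>

lemma gammap_nat_add_prime_power:
  assumes "odd p" "N > 0" shows "[gammap_nat p (n + p ^ N) = gammap_nat p n] (mod int p ^ N)"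
proof (induction n)
  case 0
  then show ?case using gammap_nat_prime_power[OF assms] by simp
next
  case (Suc n)
  have "p dvd n + p ^ N \<longleftrightarrow> p dvd n" using assms(2) by (simp add: dvd_add_left_iff)
  moreover have "[int (n + p ^ N) = int n] (mod int p ^ N)" by (simp add: cong_def)
  ultimately show ?case using Suc unfolding add_Suc gammap_nat_Suc
    by (intro cong_mult) (auto simp: cong_minus_minus_iff)
qed

text \<open>This p-adic continuity is what makes an extension to \<open>Zp\<close> possible.\<close>

lemma gammap_nat_cong:
  assumes "odd p" "[n = m] (mod p ^ N)" shows "[gammap_nat p n = gammap_nat p m] (mod int p ^ N)"
proof (cases "N = 0")
  case False
  have *: "[gammap_nat p (n + k * p ^ N) = gammap_nat p n] (mod int p ^ N)" for n k
  proof (induction k)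
    case (Suc k)
    have "[gammap_nat p (n + k * p ^ N + p ^ N) = gammap_nat p (n + k * p ^ N)] (mod int p ^ N)"
      using gammap_nat_add_prime_power assms(1) False by blast
    then show ?case using Suc by (simp add: algebra_simps) (metis cong_trans)
  qed simp
  have "[gammap_nat p n = gammap_nat p (n mod p ^ N)] (mod int p ^ N)" for n
    using *[of "n mod p ^ N" "n div p ^ N"] by (simp only: mod_div_mult_eq)
  then show ?thesis using assms(2) unfolding cong_def by metis
qed simp

text \<open>Moving one step from the second argument to the first exchanges a factor
  \<open>- m\<close> for \<open>- (n + 1)\<close>, and \<open>n + 1\<close> is \<open>- m\<close>
  modulo \<open>p ^ N\<close>. So the sign alternates, except where \<open>p\<close> divides
  \<open>n + 1\<close>. The exponent is the representative of \<open>Suc n\<close> modulo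
  \<open>p\<close> among \<open>1, ..., p\<close>.\<close>

lemma gammap_nat_reflection:
  assumes "odd p" "N > 0" "[Suc n + m = 1] (mod p ^ N)"
  shows "[gammap_nat p (Suc n) * gammap_nat p m = (- 1) ^ Suc (n mod p)] (mod int p ^ N)"
  using assms(3)
proof (induction n arbitrary: m)
  case 0
  then have "[m = 0] (mod p ^ N)" using cong_add_lcancel_nat[of 1 m 0] by simp
  then have "[- gammap_nat p m = - 1] (mod int p ^ N)"
    using gammap_nat_cong[OF assms(1), of m 0 N] by (simp add: cong_minus_minus_iff)
  then show ?case by (simp add: gammap_nat_Suc)
next
  case (Suc n)
  have "[Suc n + Suc m = 1] (mod p ^ N)" using Suc.prems by simp
  from Suc.IH[OF this]
  have IH: "[gammap_nat p (Suc n) * gammap_nat p (Suc m) = (- 1) ^ Suc (n mod p)] (mod int p ^ N)" .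
  have "[int (Suc n + Suc m) = int 1] (mod int (p ^ N))"
    using \<open>[Suc n + Suc m = 1] (mod p ^ N)\<close> by (simp only: cong_int_iff)
  then have dvd: "int p ^ N dvd int (Suc n) + int m" by (simp add: cong_iff_dvd_diff add.assoc)
  moreover have "int p dvd int p ^ N" using assms(2) by simp
  ultimately have "int p dvd int (Suc n) + int m" using dvd_trans by blast
  then have pm: "p dvd m \<longleftrightarrow> p dvd Suc n"
    by (metis int_dvd_int_iff dvd_add_right_iff dvd_add_left_iff)
  show ?case
  proof (cases "p dvd Suc n")
    \<comment> \<open>Both exchanged factors are -1, so the sign stays; the exponent falls from
      \<open>p\<close> to 1, which are both odd.\<close>
    case True
    then have 0: "Suc n mod p = 0" by (rule dvd_imp_mod_0)
    then have "Suc (n mod p) = p" using mod_Suc[of n p] by (simp split: if_splits)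
    moreover have "(- 1 :: int) ^ p = - 1" using assms(1) by simp
    ultimately have "(- 1 :: int) ^ Suc (n mod p) = - 1" "(- 1 :: int) ^ Suc (Suc n mod p) = - 1"
      using 0 by (simp_all only: power_one_right One_nat_def[symmetric])
    moreover have "gammap_nat p (Suc (Suc n)) * gammap_nat p m
        = gammap_nat p (Suc n) * gammap_nat p (Suc m)"
      using True pm by (simp add: gammap_nat_Suc[of "Suc n"] gammap_nat_Suc[of m])
    ultimately show ?thesis using IH by simp
  next
    case False
    then have "Suc n mod p = Suc (n mod p)" using mod_Suc[of n p] by (auto simp: dvd_eq_mod_eq_0)
    moreover have "[gammap_nat p (Suc (Suc n)) * gammap_nat p m
        = - (gammap_nat p (Suc n) * gammap_nat p (Suc m))] (mod int p ^ N)"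
    proof -
      have "gammap_nat p (Suc (Suc n)) * gammap_nat p m
          + gammap_nat p (Suc n) * gammap_nat p (Suc m)
          = - ((int (Suc n) + int m) * (gammap_nat p (Suc n) * gammap_nat p m))"
        using False pm by (simp add: gammap_nat_Suc[of "Suc n"] gammap_nat_Suc[of m] algebra_simps)
      then show ?thesis using dvd by (simp add: cong_iff_dvd_diff)
    qed
    moreover have "[- (gammap_nat p (Suc n) * gammap_nat p (Suc m)) = - ((- 1) ^ Suc (n mod p))] (mod int p ^ N)"
      using IH by (simp only: cong_minus_minus_iff)
    ultimately show ?thesis using cong_trans by fastforce
  qed
qed

end

section \<open>Rational approximations of p-adic integers\<close>

lemma Zp_simps:
  "x \<otimes>\<^bsub>Zp p\<^esub> y = (\<lambda>n. x n * y n mod int p ^ n)"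
  "x \<oplus>\<^bsub>Zp p\<^esub> y = (\<lambda>n. (x n + y n) mod int p ^ n)"
  "\<one>\<^bsub>Zp p\<^esub> = (\<lambda>n. 1 mod int p ^ n)" "\<zero>\<^bsub>Zp p\<^esub> = (\<lambda>n. 0)"
  by (simp_all add: Zp_def)

context localization
begin

text \<open>The rational \<open>q\<close> is determined only modulo \<open>p ^ N\<close>, so it can
  be exchanged for a congruent one at any time; ring operations in \<open>Zp\<close> become
  operations on rationals.\<close>

definition represents :: "nat \<Rightarrow> (nat \<Rightarrow> int) \<Rightarrow> rat \<Rightarrow> bool" where
  "represents N x q \<longleftrightarrow> x \<in> carrier (Zp p) \<and> lcong N (of_int (x N)) q"

lemma representsD: "represents N x q \<Longrightarrow> x \<in> carrier (Zp p)" "represents N x q \<Longrightarrow> lcong N (of_int (x N)) q"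
  unfolding represents_def by auto

lemma represents_lcong: "represents N x q \<Longrightarrow> lcong N q q' \<Longrightarrow> represents N x q'"
  unfolding represents_def using lcong_trans by blast

lemma Zp_reduced: "x \<in> carrier (Zp p) \<Longrightarrow> x n mod int p ^ n = x n"
  using Zp_compat[of x p n n] by simp

lemma Zp_ext:
  assumes "x \<in> carrier (Zp p)" "y \<in> carrier (Zp p)" "[x n = y n] (mod int p ^ n)"
  shows "x n = y n"
  using assms(3) unfolding cong_def Zp_reduced[OF assms(1)] Zp_reduced[OF assms(2)] .

lemma lcong_mod: "lcong N (of_int (a mod int p ^ N)) (of_int a)"
  unfolding lcong_of_int_iff by (simp add: cong_def)

lemma represents_of_int: "represents N (Zp_of_int p a) (of_int a)"
  unfolding represents_def using Zp_of_int_closed lcong_mod by (simp add: Zp_of_int_def)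

lemma represents_mult:
  assumes "represents N x q" "represents N y q'" shows "represents N (x \<otimes>\<^bsub>Zp p\<^esub> y) (q * q')"
proof -
  interpret cring "Zp p" by (rule Zp_cring)
  have "lcong N (of_int (x N * y N)) (q * q')"
    using lcong_mult[OF representsD(2)[OF assms(1)] representsD(2)[OF assms(2)]] by auto
  then have "lcong N (of_int (x N * y N mod int p ^ N)) (q * q')"
    using lcong_mod lcong_trans by blast
  then show ?thesis using representsD(1)[OF assms(1)] representsD(1)[OF assms(2)]
    unfolding represents_def by (auto simp: Zp_simps(1)[symmetric]) (simp add: Zp_simps)
qed

lemma represents_add:
  assumes "represents N x q" "represents N y q'" shows "represents N (x \<oplus>\<^bsub>Zp p\<^esub> y) (q + q')"
proof -
  interpret cring "Zp p" by (rule Zp_cring)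
  have "lcong N (of_int (x N + y N)) (q + q')"
    using lcong_add[OF representsD(2)[OF assms(1)] representsD(2)[OF assms(2)]] by auto
  then have "lcong N (of_int ((x N + y N) mod int p ^ N)) (q + q')"
    using lcong_mod lcong_trans by blast
  then show ?thesis using representsD(1)[OF assms(1)] representsD(1)[OF assms(2)]
    unfolding represents_def by (auto simp: Zp_simps(2)[symmetric]) (simp add: Zp_simps)
qed

lemma represents_one: "represents N \<one>\<^bsub>Zp p\<^esub> 1"
  using represents_of_int[of N 1] by (simp add: Zp_simps Zp_of_int_def)

lemma represents_zero: "represents N \<zero>\<^bsub>Zp p\<^esub> 0"
  using represents_of_int[of N 0] by (simp add: Zp_simps Zp_of_int_def)

lemma represents_pow:
  assumes "represents N x q" shows "represents N (x [^]\<^bsub>Zp p\<^esub> (n :: nat)) (q ^ n)"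
proof (induction n)
  case (Suc n)
  then show ?case using represents_mult[OF Suc assms] by (simp add: mult.commute)
qed (simp add: represents_one)

lemma represents_finsum:
  assumes "finite A" "\<And>i. i \<in> A \<Longrightarrow> represents N (f i) (g i)"
  shows "represents N (\<Oplus>\<^bsub>Zp p\<^esub>i\<in>A. f i) (\<Sum>i\<in>A. g i)"
  using assms
proof (induction A rule: finite_induct)
  case empty
  interpret cring "Zp p" by (rule Zp_cring)
  show ?case by (simp add: represents_zero)
next
  case (insert i A)
  interpret cring "Zp p" by (rule Zp_cring)
  have "f \<in> A \<rightarrow> carrier (Zp p)" "f i \<in> carrier (Zp p)" using insert.prems representsD(1) by auto
  then show ?case using insert by (simp add: finsum_insert represents_add)
qed

lemma represents_finprod:
  assumes "finite A" "\<And>i. i \<in> A \<Longrightarrow> represents N (f i) (g i)"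
  shows "represents N (\<Otimes>\<^bsub>Zp p\<^esub>i\<in>A. f i) (\<Prod>i\<in>A. g i)"
  using assms
proof (induction A rule: finite_induct)
  case empty
  interpret cring "Zp p" by (rule Zp_cring)
  show ?case by (simp add: represents_one)
next
  case (insert i A)
  interpret cring "Zp p" by (rule Zp_cring)
  have "f \<in> A \<rightarrow> carrier (Zp p)" "f i \<in> carrier (Zp p)" using insert.prems representsD(1) by auto
  then show ?case using insert by (simp add: finprod_insert represents_mult)
qed

text \<open>The entries are inverted one by one; the inverses are compatible because an inverse
  modulo \<open>p ^ m\<close> is unique.\<close>

lemma Zp_Units:
  assumes x: "x \<in> carrier (Zp p)" and u: "\<not> int p dvd x 1" shows "x \<in> Units (Zp p)"
proof -
  interpret cring "Zp p" by (rule Zp_cring)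
  have "\<exists>y. [x n * y = 1] (mod int p ^ n)" for n
  proof (cases "n = 0")
    case False
    then have "x n mod int p = x 1" using Zp_compat[OF x, of 1 n] by simp
    then have "\<not> int p dvd x n" using u by (metis dvd_mod_iff dvd_refl)
    then have "coprime (x n) (int p ^ n)" using prime_imp_coprime[OF prime_ip]
      by (subst coprime_commute) (simp add: coprime_power_left_iff)
    then show ?thesis using cong_solve_coprime_int by blast
  qed simp
  then obtain z where z: "[x n * z n = 1] (mod int p ^ n)" for n by metis
  define y where "y n = z n mod int p ^ n" for n
  have y: "[x n * y n = 1] (mod int p ^ n)" for n
    using z[of n] unfolding y_def by (simp add: cong_def mod_simps)
  have "y n mod int p ^ m = y m" if "m \<le> n" for m n
  proof -
    have dvd: "int p ^ m dvd int p ^ n" using that by (rule le_imp_power_dvd)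
    have "[x n = x m] (mod int p ^ m)" using Zp_compat[OF x that] Zp_reduced[OF x, of m] by (simp add: cong_def)
    \<comment> \<open>Uniqueness of inverses: this product is reduced modulo \<open>p ^ m\<close>
      both to \<open>y m\<close> and to \<open>y n\<close>.\<close>
    then have "[y n * (x m * y m) = y n * (x n * y m)] (mod int p ^ m)"
      by (intro cong_mult cong_refl) (rule cong_sym)
    also have "y n * (x n * y m) = (x n * y n) * y m" by simp
    also have "[\<dots> = 1 * y m] (mod int p ^ m)" using cong_dvd_modulus[OF y dvd] by (intro cong_mult cong_refl)
    finally have "[y n * (x m * y m) = y m] (mod int p ^ m)" by simp
    moreover have "[y n * (x m * y m) = y n * 1] (mod int p ^ m)" by (intro cong_mult cong_refl y)
    ultimately have "[y n = y m] (mod int p ^ m)" by (metis cong_sym cong_trans mult.right_neutral)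
    then show ?thesis by (simp add: cong_def y_def)
  qed
  then have yc: "y \<in> carrier (Zp p)" by (simp add: Zp_def)
  moreover have "x \<otimes>\<^bsub>Zp p\<^esub> y = \<one>\<^bsub>Zp p\<^esub>" using y by (simp add: Zp_simps cong_def)
  moreover from this have "y \<otimes>\<^bsub>Zp p\<^esub> x = \<one>\<^bsub>Zp p\<^esub>" using m_comm[OF x yc] by simp
  ultimately show ?thesis using x unfolding Units_def by blast
qed

lemma represents_inv:
  assumes "represents N x q" "q \<in> U" "N > 0" shows "represents N (inv\<^bsub>Zp p\<^esub> x) (inverse q)"
proof -
  interpret cring "Zp p" by (rule Zp_cring)
  have x: "x \<in> carrier (Zp p)" using assms representsD by blast
  have xU: "of_int (x N) \<in> U"
    using lcong_U[OF lcong_sym[OF representsD(2)[OF assms(1)]]] assms by simp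
  have "\<not> int p dvd x N"
  proof
    assume "int p dvd x N"
    then have "lcong 1 (of_int (x N)) (of_int 0)" unfolding lcong_of_int_iff by (simp add: cong_0_iff)
    then show False using U_not_lcong_0[OF xU] by simp
  qed
  moreover have "x N mod int p = x 1" using Zp_compat[OF x, of 1 N] assms(3) by simp
  ultimately have "\<not> int p dvd x 1" by (metis dvd_mod_iff dvd_refl)
  then have u: "x \<in> Units (Zp p)" using Zp_Units x by blast
  define y where "y = inv\<^bsub>Zp p\<^esub> x"
  have y: "y \<in> carrier (Zp p)" "x \<otimes>\<^bsub>Zp p\<^esub> y = \<one>\<^bsub>Zp p\<^esub>" unfolding y_def using u by auto
  have "(x \<otimes>\<^bsub>Zp p\<^esub> y) N = \<one>\<^bsub>Zp p\<^esub> N" using y by simp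
  then have "[x N * y N = 1] (mod int p ^ N)" by (simp add: Zp_simps cong_def)
  then have "lcong N (of_int (x N * y N)) (of_int 1)" unfolding lcong_of_int_iff .
  then have "lcong N (of_int (x N) * of_int (y N)) (of_int (x N) * inverse (of_int (x N)))"
    using U_nonzero[OF xU] by simp
  then have "lcong N (of_int (y N)) (inverse (of_int (x N)))" using lcong_cancel_left xU by blast
  also have "lcong N (inverse (of_int (x N))) (inverse q)"
    using representsD(2)[OF assms(1)] xU assms(2) by (rule lcong_inverse)
  finally show ?thesis using y(1) unfolding represents_def y_def by blast
qed

lemma represents_of_rat:
  assumes "q \<in> Z" shows "represents N (Zp_of_rat p q) q"
proof -
  interpret cring "Zp p" by (rule Zp_cring)
  define a where "a = fst (quotient_of q)"
  define b where "b = snd (quotient_of q)"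
  have ab: "q = of_int a / of_int b" "coprime a b" "b > 0"
    unfolding a_def b_def using quotient_of_div[of q a b] quotient_of_coprime[of q a b]
      quotient_of_denom_pos[of q a b] by (auto simp: a_def b_def)
  obtain c d where cd: "\<not> int p dvd d" "q = of_int c / of_int d"
    using assms unfolding Z_def by blast
  \<comment> \<open>\<open>Z\<close> refers to some fraction, \<open>Zp_of_rat\<close> to the
    reduced one.\<close>
  have "\<not> int p dvd b"
  proof
    assume pb: "int p dvd b"
    have "d \<noteq> 0" using cd(1) by auto
    then have "of_int (a * d) = (of_int (c * b) :: rat)"
      using ab(1,3) cd(2) by (simp add: frac_eq_eq)
    then have "a * d = c * b" by (simp only: of_int_eq_iff)
    then have "int p dvd a * d" using pb by simp
    then have "int p dvd a" using cd(1) prime_dvd_mult_iff[OF prime_ip] by blast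
    then have "is_unit (int p)" using coprime_common_divisor[OF ab(2)] pb by blast
    then show False using prime_ip not_prime_unit by blast
  qed
  then have bU: "of_int b \<in> U" by (rule U_of_int)
  have *: "represents N (Zp_of_rat p q) q" if "N > 0" for N
    using represents_mult[OF represents_of_int[of N a] represents_inv[OF represents_of_int[of N b] bU that]]
    unfolding Zp_of_rat_def a_def[symmetric] b_def[symmetric] by (simp add: ab(1) divide_inverse)
  show ?thesis
  proof (cases "N = 0")
    case True
    \<comment> \<open>\<open>represents_inv\<close> needs \<open>N > 0\<close>; membership in the
      carrier is therefore borrowed from \<open>N = 1\<close>.\<close>
    have "Zp_of_rat p q \<in> carrier (Zp p)" using *[of 1] representsD by simp
    moreover have "lcong 0 (of_int (Zp_of_rat p q 0)) q"
      using assms by (subst lcong_iff_diff) (auto simp: lcong_0_iff_Z)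
    ultimately show ?thesis using True unfolding represents_def by simp
  qed (use * in simp)
qed

text \<open>The limit is given entrywise by \<open>gammap_nat\<close> at the least residues of
  \<open>x\<close>; by continuity any other natural number in the class serves as well, with no loss
  of precision.\<close>

lemma gammap_exists:
  assumes "odd p" "x \<in> carrier (Zp p)"
  shows "gammap p x \<in> carrier (Zp p) \<and> (\<forall>N n. [int n = x N] (mod int p ^ N) \<longrightarrow>
    [gammap p x N = gammap_nat p n] (mod int p ^ N))"
proof -
  interpret cring "Zp p" by (rule Zp_cring)
  define y where "y N = gammap_nat p (nat (x N)) mod int p ^ N" for N
  have x0: "x N \<ge> 0" for N using Zp_reduced[OF assms(2), of N] p_pos
    by (metis pos_mod_sign of_nat_0_less_iff zero_less_power)
  have gc: "[gammap_nat p n = gammap_nat p m] (mod int p ^ N)" if "[int n = int m] (mod int p ^ N)" for n m N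
    using gammap_nat_cong[OF assms(1), of n m N] that cong_int_iff[of n m "p ^ N"] by simp
  have y: "[y N = gammap_nat p n] (mod int p ^ N)" if "[int n = x N] (mod int p ^ N)" for N n
    using gc[of "nat (x N)" n N] that x0 unfolding y_def by (simp add: cong_def)
  have yc: "y \<in> carrier (Zp p)"
  proof -
    have "y n mod int p ^ m = y m" if "m \<le> n" for m n
    proof -
      have dvd: "int p ^ m dvd int p ^ n" using that by (rule le_imp_power_dvd)
      have "[int (nat (x n)) = int (nat (x m))] (mod int p ^ m)"
        using Zp_compat[OF assms(2) that] Zp_reduced[OF assms(2), of m] x0 by (simp add: cong_def)
      from gc[OF this] show ?thesis
        unfolding y_def mod_mod_cancel[OF dvd] by (simp add: cong_def)
    qed
    then show ?thesis by (simp add: Zp_def)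
  qed
  have "gammap p x = y"
  proof (cases "x = \<zero>\<^bsub>Zp p\<^esub>")
    case True
    \<comment> \<open>The value prescribed at 0 is also \<open>gammap_nat p 0\<close>, so the
      description covers \<open>x = 0\<close>.\<close>
    have "y N = 1 mod int p ^ N" for N unfolding y_def using True by (simp add: Zp_simps)
    then show ?thesis unfolding gammap_def using True by (auto simp: Zp_simps)
  next
    case False
    have "(THE y. y \<in> carrier (Zp p) \<and> (\<forall>N. \<exists>M. \<forall>n>0. Zp_of_int p (int n) M = x M \<longrightarrow>
        Zp_of_int p (gammap_nat p n) N = y N)) = y"
    proof (rule the_equality, intro conjI allI yc)
      fix N
      have "Zp_of_int p (gammap_nat p n) N = y N" if "Zp_of_int p (int n) N = x N" for n
      proof -
        have "[int n = x N] (mod int p ^ N)" using that Zp_reduced[OF assms(2), of N]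
          by (simp add: Zp_of_int_def cong_def)
        from y[OF this] show ?thesis using Zp_reduced[OF yc, of N] by (simp add: Zp_of_int_def cong_def)
      qed
      then show "\<exists>M. \<forall>n>0. Zp_of_int p (int n) M = x M \<longrightarrow> Zp_of_int p (gammap_nat p n) N = y N" by blast
    next
      fix w assume w: "w \<in> carrier (Zp p) \<and> (\<forall>N. \<exists>M. \<forall>n>0. Zp_of_int p (int n) M = x M \<longrightarrow>
        Zp_of_int p (gammap_nat p n) N = w N)"
      show "w = y"
      proof
        fix N
        obtain M where M: "\<And>n. n > 0 \<Longrightarrow> Zp_of_int p (int n) M = x M \<Longrightarrow> Zp_of_int p (gammap_nat p n) N = w N"
          using w by blast
        define K where "K = max M N"
        \<comment> \<open>The limit is tested on positive integers only, and \<open>x K\<close> may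
          be 0; adding \<open>p ^ K\<close> does not change the class.\<close>
        define n where "n = nat (x K) + p ^ K"
        have n0: "n > 0" unfolding n_def using p_pos by simp
        have nK: "[int n = x K] (mod int p ^ K)" unfolding n_def using x0 by (simp add: cong_def)
        have nL: "[int n = x L] (mod int p ^ L)" if "L \<le> K" for L
        proof -
          have "[int n = x K] (mod int p ^ L)"
            using cong_dvd_modulus[OF nK le_imp_power_dvd[OF that]] .
          then show ?thesis using Zp_compat[OF assms(2) that] Zp_reduced[OF assms(2), of L]
            by (simp add: cong_def)
        qed
        have "Zp_of_int p (int n) M = x M"
          using nL[of M] Zp_reduced[OF assms(2), of M] unfolding K_def by (simp add: Zp_of_int_def cong_def)
        then have "w N = gammap_nat p n mod int p ^ N" using M[OF n0] by (simp add: Zp_of_int_def)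
        also have "\<dots> = y N" using y[OF nL, of N] Zp_reduced[OF yc, of N] unfolding K_def
          by (simp add: cong_def)
        finally show "w N = y N" .
      qed
    qed
    then show ?thesis unfolding gammap_def using False by simp
  qed
  then show ?thesis using yc y by simp
qed

lemma represents_gammap:
  assumes "odd p" "represents N x q" "lcong N q (of_nat n)"
  shows "represents N (gammap p x) (of_int (gammap_nat p n))"
proof -
  have "lcong N (of_int (int n)) (of_int (x N))"
    using lcong_sym[OF lcong_trans[OF representsD(2)[OF assms(2)] assms(3)]] by simp
  then have "[int n = x N] (mod int p ^ N)" unfolding lcong_of_int_iff .
  then show ?thesis using gammap_exists[OF assms(1) representsD(1)[OF assms(2)]]
    unfolding represents_def lcong_of_int_iff by blast
qed

lemma Zp_eqI:
  assumes "\<And>N. N > 0 \<Longrightarrow> \<exists>q. represents N x q \<and> represents N y q" shows "x = y"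
proof
  fix N
  obtain q where q: "represents (Suc N) x q" "represents (Suc N) y q" using assms[of "Suc N"] by auto
  have c: "x \<in> carrier (Zp p)" "y \<in> carrier (Zp p)" using q representsD by auto
  have "lcong (Suc N) (of_int (x (Suc N))) (of_int (y (Suc N)))"
    using lcong_trans[OF representsD(2)[OF q(1)] lcong_sym[OF representsD(2)[OF q(2)]]] .
  then have "x (Suc N) = y (Suc N)" using Zp_ext[OF c] unfolding lcong_of_int_iff by blast
  then show "x N = y N" using Zp_compat[OF c(1), of N "Suc N"] Zp_compat[OF c(2), of N "Suc N"] by simp
qed

text \<open>The \<open>k\<close>-th entry of the difference is 0, so all later entries are divisible
  by \<open>p ^ k\<close> and can be divided by it.\<close>

lemma Zp_cong_if_represents:
  assumes "represents k x q" "represents k y q" shows "Zp_cong p k x y"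
proof -
  interpret cring "Zp p" by (rule Zp_cring)
  have c: "x \<in> carrier (Zp p)" "y \<in> carrier (Zp p)" using assms representsD by auto
  have "lcong k (of_int (x k)) (of_int (y k))"
    using lcong_trans[OF representsD(2)[OF assms(1)] lcong_sym[OF representsD(2)[OF assms(2)]]] .
  then have xy: "x k = y k" using Zp_ext[OF c] unfolding lcong_of_int_iff by blast
  define z where "z = x \<ominus>\<^bsub>Zp p\<^esub> y"
  have z: "z \<in> carrier (Zp p)" unfolding z_def using c by simp
  have "z \<oplus>\<^bsub>Zp p\<^esub> y = x" unfolding z_def using c by (simp add: minus_eq a_assoc l_neg)
  then have "(z k + y k) mod int p ^ k = x k" by (auto simp: Zp_simps)
  then have "[z k + y k = 0 + y k] (mod int p ^ k)" using xy Zp_reduced[OF c(2), of k] by (simp add: cong_def)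
  then have "[z k = 0] (mod int p ^ k)" by (simp only: cong_add_rcancel)
  then have zk: "z k = 0" using Zp_reduced[OF z, of k] by (simp add: cong_def)
  have dvd: "int p ^ k dvd z (n + k)" for n
    using Zp_compat[OF z, of k "n + k"] zk by (simp add: dvd_eq_mod_eq_0)
  \<comment> \<open>Division by \<open>p ^ k\<close> costs \<open>k\<close> digits of precision,
    hence the shifted index.\<close>
  define w where "w n = z (n + k) div int p ^ k" for n
  have zw: "z (n + k) = int p ^ k * w n" for n using dvd[of n] unfolding w_def by simp
  have "w n mod int p ^ m = w m" if "m \<le> n" for m n
  proof -
    have "z (n + k) mod int p ^ (m + k) = z (m + k)" using Zp_compat[OF z] that by simp
    moreover have "int p ^ k * (w n mod int p ^ m) = z (n + k) mod int p ^ (m + k)"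
      unfolding zw mult_mod_right power_add by (simp only: mult.commute)
    ultimately have "int p ^ k * (w n mod int p ^ m) = int p ^ k * w m" by (simp only: zw)
    then show ?thesis using p_pos by simp
  qed
  then have wc: "w \<in> carrier (Zp p)" by (simp add: Zp_def)
  have "z = w \<otimes>\<^bsub>Zp p\<^esub> Zp_of_int p (int p ^ k)"
  proof
    fix n
    have "z n = z (n + k) mod int p ^ n" using Zp_compat[OF z, of n "n + k"] by simp
    then show "z n = (w \<otimes>\<^bsub>Zp p\<^esub> Zp_of_int p (int p ^ k)) n"
      by (simp add: Zp_simps Zp_of_int_def zw mod_simps mult.commute)
  qed
  then show ?thesis using wc unfolding Zp_cong_def z_def[symmetric] cgenideal_def by blast
qed

end


section \<open>The gamma function on rationals\<close>

locale odd_localization = localization +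
  assumes odd_p: "odd p"
begin

text \<open>A rational substitute for the gamma function modulo \<open>p ^ N\<close>; the choice of
  \<open>n\<close> affects it only modulo \<open>p ^ N\<close>. As a value of
  \<open>gammap_nat\<close> it is a unit for every \<open>q\<close>, so division by it is always
  possible.\<close>

definition gam :: "nat \<Rightarrow> rat \<Rightarrow> rat" where
  "gam N q = of_int (gammap_nat p (SOME n. lcong N q (of_nat n)))"

text \<open>The value 1 at multiples of \<open>p\<close> mirrors their omission from the product in
  \<open>gammap_nat\<close>, so the functional equation needs no case distinction.\<close>

definition unit_part :: "rat \<Rightarrow> rat" where
  "unit_part x = (if x \<in> U then x else 1)"

lemma unit_part_U [simp, intro]: "unit_part x \<in> U"
  unfolding unit_part_def by simp

lemma gam_U [simp, intro]: "gam N q \<in> U"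
  unfolding gam_def by (intro U_of_int not_dvd_gammap_nat)

lemma gam_nonzero [simp]: "gam N q \<noteq> 0"
  using gam_U U_nonzero by blast

lemma gam_lcong_gammap_nat:
  assumes "lcong N q (of_nat n)" shows "lcong N (gam N q) (of_int (gammap_nat p n))"
proof -
  have "lcong N q (of_nat (SOME n. lcong N q (of_nat n)))" using assms by (rule someI)
  then have "lcong N (of_nat (SOME n. lcong N q (of_nat n))) (of_nat n)"
    using assms lcong_sym lcong_trans by blast
  then show ?thesis unfolding gam_def lcong_of_int_iff lcong_of_nat_iff
    by (rule gammap_nat_cong[OF odd_p])
qed

lemma represents_gam:
  assumes "represents N x q" "q \<in> Z" shows "represents N (gammap p x) (gam N q)"
proof -
  obtain n where n: "lcong N q (of_nat n)" using ex_nat_lcong[OF assms(2)] by blast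
  show ?thesis
    using represents_lcong[OF represents_gammap[OF odd_p assms(1) n] lcong_sym[OF gam_lcong_gammap_nat[OF n]]] .
qed

lemma gam_0: "lcong N (gam N 0) 1"
  using gam_lcong_gammap_nat[of N 0 0] by simp

lemma gam_plus_1:
  assumes "q \<in> Z" "N > 0" shows "lcong N (gam N (q + 1)) (- unit_part q * gam N q)"
proof -
  obtain n where n: "lcong N q (of_nat n)" using ex_nat_lcong[OF assms(1)] by blast
  have u: "q \<in> U \<longleftrightarrow> \<not> p dvd n"
  proof
    assume "q \<in> U"
    then have "of_nat n \<in> U" using lcong_U[OF n] assms(2) by simp
    then show "\<not> p dvd n" using U_not_lcong_0 lcong_of_nat_iff[of 1 n 0] by (auto simp: cong_0_iff)
  next
    assume "\<not> p dvd n"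
    then have "of_nat n \<in> U" by (rule U_of_nat)
    then show "q \<in> U" using lcong_U[OF lcong_sym[OF n]] assms(2) by simp
  qed
  have "lcong N (q + 1) (of_nat (Suc n))"
    using lcong_add[OF n lcong_refl[of N 1]] by (simp add: add.commute)
  then have "lcong N (gam N (q + 1)) (of_int (gammap_nat p (Suc n)))" by (rule gam_lcong_gammap_nat)
  also have "of_int (gammap_nat p (Suc n)) = - (if p dvd n then 1 else of_nat n) * (of_int (gammap_nat p n) :: rat)"
    unfolding gammap_nat_Suc by simp
  also have "lcong N \<dots> (- unit_part q * gam N q)"
  proof (rule lcong_mult)
    show "lcong N (- (if p dvd n then 1 else of_nat n)) (- unit_part q)"
      using u lcong_minus[OF lcong_sym[OF n]] unfolding unit_part_def by simp
    show "lcong N (of_int (gammap_nat p n)) (gam N q)" using lcong_sym[OF gam_lcong_gammap_nat[OF n]] .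
  qed auto
  finally show ?thesis .
qed

lemma gam_plus_nat:
  assumes "q \<in> Z" "N > 0"
  shows "lcong N (gam N (q + of_nat n)) ((- 1) ^ n * (\<Prod>i<n. unit_part (q + of_nat i)) * gam N q)"
proof (induction n)
  case (Suc n)
  have "lcong N (gam N ((q + of_nat n) + 1)) (- unit_part (q + of_nat n) * gam N (q + of_nat n))"
    using assms by (intro gam_plus_1) auto
  also have "lcong N \<dots> (- unit_part (q + of_nat n)
      * ((- 1) ^ n * (\<Prod>i<n. unit_part (q + of_nat i)) * gam N q))"
    by (intro lcong_mult_left Suc Z_minus U_Z unit_part_U)
  finally show ?case by (simp add: algebra_simps)
qed simp

lemma gam_reflection:
  assumes "q \<in> Z" "N > 0" "lcong 1 q (of_nat (Suc r))" "r < p"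
  shows "lcong N (gam N q * gam N (1 - q)) ((- 1) ^ Suc r)"
proof -
  obtain n where n: "n > 0" "lcong N q (of_nat n)" using ex_nat_lcong[OF assms(1)] by blast
  obtain m where m: "lcong N (1 - q) (of_nat m)" using ex_nat_lcong[of "1 - q"] assms(1) by blast
  obtain n' where n': "n = Suc n'" using n(1) by (cases n) auto
  have "lcong N (q + (1 - q)) (of_nat (Suc n') + of_nat m)" using n m unfolding n' by (intro lcong_add) auto
  then have "lcong N (of_nat (Suc n' + m)) (of_nat 1)"
    by (intro lcong_sym[of N "of_nat 1"]) (simp add: add.assoc)
  then have nm: "[Suc n' + m = 1] (mod p ^ N)" unfolding lcong_of_nat_iff .
  have "lcong 1 (of_nat (Suc n')) (of_nat (Suc r))"
    using lcong_trans[OF lcong_sym[OF lcong_mono[OF n(2), of 1]] assms(3)] assms(2) n' by simp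
  then have "[Suc n' = Suc r] (mod p)" unfolding lcong_of_nat_iff by simp
  then have "[n' = r] (mod p)" using cong_add_lcancel_nat[of 1 n' r p] by simp
  then have r: "n' mod p = r" using assms(4) by (simp add: cong_def)
  have "lcong N (gam N q * gam N (1 - q)) (of_int (gammap_nat p (Suc n')) * of_int (gammap_nat p m))"
    using n m unfolding n' by (intro lcong_mult gam_lcong_gammap_nat U_Z gam_U)
  also have "of_int (gammap_nat p (Suc n')) * of_int (gammap_nat p m)
     = (of_int (gammap_nat p (Suc n') * gammap_nat p m) :: rat)" by simp
  also have "lcong N \<dots> (of_int ((- 1) ^ Suc r))"
    unfolding lcong_of_int_iff using gammap_nat_reflection[OF odd_p assms(2) nm] r by simp
  finally show ?thesis by simp
qed

section \<open>Gamma values at multiples of \<open>p\<close> modulo \<open>p ^ 3\<close>\<close>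

lemma prod_one_plus_lcong:
  assumes "\<And>u. u \<in> A \<Longrightarrow> y u \<in> Z" "finite A"
  shows "lcong 3 (\<Prod>u\<in>A. 1 + of_nat p ^ 2 * y u) (1 + of_nat p ^ 2 * (\<Sum>u\<in>A. y u))"
  using assms(2,1)
proof (induction A rule: finite_induct)
  case (insert u A)
  have Z: "y u \<in> Z" "(\<Sum>u\<in>A. y u) \<in> Z" using insert.prems by auto
  have "lcong 3 ((1 + of_nat p ^ 2 * y u) * (\<Prod>u\<in>A. 1 + of_nat p ^ 2 * y u))
      ((1 + of_nat p ^ 2 * y u) * (1 + of_nat p ^ 2 * (\<Sum>u\<in>A. y u)))"
    using insert Z by (intro lcong_mult_left) auto
  also have "(1 + of_nat p ^ 2 * y u) * (1 + of_nat p ^ 2 * (\<Sum>u\<in>A. y u))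
      = 1 + of_nat p ^ 2 * (y u + (\<Sum>u\<in>A. y u)) + of_nat p ^ 3 * (of_nat p * (y u * (\<Sum>u\<in>A. y u)))"
    by (simp add: power2_eq_square power3_eq_cube algebra_simps)
  also have "lcong 3 \<dots> (1 + of_nat p ^ 2 * (y u + (\<Sum>u\<in>A. y u)) + 0)"
    using Z by (intro lcong_add lcong_p_mult) auto
  finally show ?case using insert by simp
qed simp

text \<open>Pairing \<open>u\<close> with \<open>p - u\<close> gives
  \<open>(p k + u) (p k + p - u) = u (p - u) + p ^ 2 k (k + 1)\<close>. So the square of the left
  side is the square of the right side times a product of terms \<open>1 + p ^ 2 y u\<close>, and
  the \<open>y u\<close> add up to 0 modulo \<open>p\<close> as a multiple of the sum of inverse
  squares. The root can be taken because the sum of the two sides is a unit.\<close>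

lemma prod_shift_lcong:
  assumes "p > 3"
  shows "lcong 3 (\<Prod>u\<in>{0<..<p}. of_nat (p * k) + of_nat u) (\<Prod>u\<in>{0<..<p}. of_nat u)"
proof -
  define A :: rat where "A = (\<Prod>u\<in>{0<..<p}. of_nat (p * k) + of_nat u)"
  define B :: rat where "B = (\<Prod>u\<in>{0<..<p}. of_nat u)"
  define c :: rat where "c = of_nat (k * (k + 1))"
  define y :: "nat \<Rightarrow> rat" where "y u = c * inverse (of_nat u * of_nat (p - u))" for u
  have U: "of_nat u \<in> U" "of_nat (p - u) \<in> U" if "u \<in> {0<..<p}" for u
    using that U_of_nat_less[of u] U_of_nat_less[of "p - u"] by auto
  have rev: "(\<Prod>u\<in>{0<..<p}. f u) = (\<Prod>u\<in>{0<..<p}. f (p - u))" for f :: "nat \<Rightarrow> rat"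
    by (rule prod.reindex_bij_witness[of _ "\<lambda>u. p - u" "\<lambda>u. p - u"]) auto
  have Z: "A \<in> Z" "B \<in> Z" unfolding A_def B_def by auto
  have BU: "B \<in> U" unfolding B_def using U by auto
  have BB: "B * B = (\<Prod>u\<in>{0<..<p}. of_nat u * of_nat (p - u))"
    unfolding B_def prod.distrib using rev[of of_nat] by simp
  have "A * A = (\<Prod>u\<in>{0<..<p}. (of_nat (p * k) + of_nat u) * (of_nat (p * k) + of_nat (p - u)))"
    unfolding A_def prod.distrib using rev[of "\<lambda>u. of_nat (p * k) + of_nat u"] by simp
  also have "\<dots> = (\<Prod>u\<in>{0<..<p}. (of_nat u * of_nat (p - u)) * (1 + of_nat p ^ 2 * y u))"
  proof (rule prod.cong[OF refl])
    fix u assume u: "u \<in> {0<..<p}"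
    have "a * (c * inverse a) = c" if "a \<noteq> 0" for a :: rat using that by simp
    from this[OF U_nonzero[OF U_mult[OF U[OF u]]]]
    have "of_nat u * of_nat (p - u) * y u = c" unfolding y_def .
    then have "(of_nat u * of_nat (p - u)) * (1 + of_nat p ^ 2 * y u)
        = of_nat u * of_nat (p - u) + of_nat p ^ 2 * c" by (simp add: algebra_simps)
    then show "(of_nat (p * k) + of_nat u) * (of_nat (p * k) + of_nat (p - u))
      = (of_nat u * of_nat (p - u)) * (1 + of_nat p ^ 2 * y u)"
      unfolding c_def using u by (simp add: of_nat_diff algebra_simps power2_eq_square)
  qed
  also have "\<dots> = B * B * (\<Prod>u\<in>{0<..<p}. 1 + of_nat p ^ 2 * y u)"
    unfolding BB prod.distrib by simp
  finally have AA: "A * A = B * B * (\<Prod>u\<in>{0<..<p}. 1 + of_nat p ^ 2 * y u)" .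
  have yZ: "y u \<in> Z" if "u \<in> {0<..<p}" for u
    unfolding y_def c_def using U[OF that] by (intro Z_mult U_Z[OF U_inverse] U_mult) auto
  have "lcong 1 (y u) (c * - (inverse (of_nat u) ^ 2))" if u: "u \<in> {0<..<p}" for u
  proof -
    have "lcong 1 (of_nat p - of_nat u) (0 - of_nat u)"
      using lcong_p_power[of 1] by (intro lcong_diff) auto
    then have "lcong 1 (of_nat u * of_nat (p - u)) (of_nat u * (- of_nat u))"
      using u by (intro lcong_mult_left) (auto simp: of_nat_diff)
    then have "lcong 1 (inverse (of_nat u * of_nat (p - u))) (inverse (of_nat u * (- of_nat u)))"
      using U[OF u] by (intro lcong_inverse) auto
    also have "inverse (of_nat u * (- of_nat u)) = - (inverse (of_nat u) ^ 2 :: rat)"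
      by (simp add: power2_eq_square)
    finally show ?thesis unfolding y_def c_def by (intro lcong_mult_left) auto
  qed
  then have "lcong 1 (\<Sum>u\<in>{0<..<p}. y u) (\<Sum>u\<in>{0<..<p}. c * - (inverse (of_nat u) ^ 2))"
    by (rule lcong_sum)
  also have "(\<Sum>u\<in>{0<..<p}. c * - (inverse (of_nat u) ^ 2)) = - c * (\<Sum>u\<in>{0<..<p}. inverse (of_nat u) ^ 2)"
    by (simp add: sum_distrib_left sum_negf)
  also have "lcong 1 \<dots> 0"
  proof (rule lcong_0_mult_Z')
    have "\<not> p dvd 2\<^sup>2 - 1" using assms by (auto dest: dvd_imp_le)
    then show "lcong 1 (\<Sum>u\<in>{0<..<p}. inverse (of_nat u) ^ 2) 0"
      using odd_p by (rule sum_inverse_powers_lcong_0)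
  qed (unfold c_def, auto)
  finally have "lcong 3 (of_nat p ^ 2 * (\<Sum>u\<in>{0<..<p}. y u)) 0"
    by (rule lcong_0_mult'[OF lcong_p_power]) simp
  then have "lcong 3 (1 + of_nat p ^ 2 * (\<Sum>u\<in>{0<..<p}. y u)) (1 + 0)" by (intro lcong_add) auto
  then have "lcong 3 (\<Prod>u\<in>{0<..<p}. 1 + of_nat p ^ 2 * y u) 1"
    using prod_one_plus_lcong[of "{0<..<p}" y] yZ lcong_trans by force
  then have "lcong 3 (A * A) (B * B * 1)" unfolding AA using Z by (intro lcong_mult_left) auto
  then have "lcong 3 (A * A - B * B) 0" by (subst (asm) lcong_iff_diff) simp
  then have eq: "lcong 3 ((A + B) * A) ((A + B) * B)"
    by (subst lcong_iff_diff) (simp add: algebra_simps)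
  have "lcong 1 A B" unfolding A_def B_def
  proof (rule lcong_prod)
    fix u
    show "lcong 1 (of_nat (p * k) + of_nat u) (of_nat u)"
      using lcong_add[OF lcong_1_p_mult[of "of_nat k"] lcong_refl[of 1 "of_nat u"]] by simp
  qed auto
  then have "lcong 1 (A + B) (B + B)" by (intro lcong_add) auto
  moreover have "B + B \<in> U"
  proof -
    have "\<not> p dvd 2" using assms by (auto dest: dvd_imp_le)
    then have "of_nat 2 * B \<in> U" using BU U_of_nat by blast
    then show ?thesis by simp
  qed
  ultimately have "A + B \<in> U" using lcong_U lcong_sym by blast
  from lcong_cancel_left[OF eq this] show ?thesis unfolding A_def B_def .
qed

definition w :: rat where "w = - (\<Prod>u\<in>{0<..<p}. of_nat u)"

text \<open>From \<open>p k\<close> to \<open>p (k + 1)\<close> the gain is \<open>(- 1) ^ p\<close>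
  times the \<open>p - 1\<close> numbers strictly between, a product independent of \<open>k\<close>
  modulo \<open>p ^ 3\<close>.\<close>

lemma gammap_nat_multiple:
  assumes "p > 3" shows "lcong 3 (of_int (gammap_nat p (p * k))) (w ^ k)"
proof (induction k)
  case (Suc k)
  have *: "gammap_nat p (n + m) = (- 1) ^ m * (\<Prod>i<m. if p dvd n + i then 1 else int (n + i)) * gammap_nat p n"
    for n m by (induction m) (auto simp: gammap_nat_Suc)
  have ins: "{..<p} = insert 0 {0<..<p}" using p_pos by auto
  have "(\<Prod>i<p. if p dvd p * k + i then 1 else int (p * k + i)) = (\<Prod>i\<in>{0<..<p}. int (p * k + i))"
    unfolding ins by (subst prod.insert) (auto intro!: prod.cong simp: dvd_add_right_iff nat_dvd_not_less)
  then have "gammap_nat p (p * Suc k) = - (\<Prod>i\<in>{0<..<p}. int (p * k + i)) * gammap_nat p (p * k)"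
    using *[of "p * k" p] odd_p by (simp add: add.commute)
  then have "of_int (gammap_nat p (p * Suc k))
      = - (\<Prod>u\<in>{0<..<p}. of_nat (p * k) + of_nat u) * (of_int (gammap_nat p (p * k)) :: rat)"
    by simp
  also have "lcong 3 \<dots> (- (\<Prod>u\<in>{0<..<p}. of_nat u) * w ^ k)"
    by (intro lcong_mult lcong_minus prod_shift_lcong assms Suc Z_minus Z_prod Z_add Z_of_nat Z_of_int)
  also have "- (\<Prod>u\<in>{0<..<p}. of_nat u) * w ^ k = w * w ^ k" by (simp add: w_def)
  finally show ?case by simp
qed simp

text \<open>In \<open>x ^ p - 1 = (x - 1) (1 + x + ... + x ^ (p - 1))\<close> the second factor is
  \<open>p\<close> modulo \<open>p\<close>, that is, 0.\<close>

lemma power_p_lcong_1: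
  assumes "lcong k x 1" "k > 0" shows "lcong (Suc k) (x ^ p) 1"
proof -
  have x: "x \<in> Z" using lcong_Z[OF assms(1)] by simp
  have "lcong 1 (\<Sum>i<p. x ^ i) (\<Sum>i<p. 1 ^ i)"
    using lcong_mono[OF assms(1), of 1] assms(2) x by (intro lcong_sum lcong_power) auto
  also have "(\<Sum>i<p. 1 ^ i) = (of_nat p :: rat)" by simp
  also have "lcong 1 \<dots> 0" using lcong_p_power[of 1] by simp
  finally have "lcong 1 (\<Sum>i<p. x ^ i) 0" .
  moreover have "lcong k (x - 1) 0" using assms(1) by (subst (asm) lcong_iff_diff)
  ultimately have "lcong (Suc k) ((x - 1) * (\<Sum>i<p. x ^ i)) 0" by (intro lcong_0_mult'[of k _ 1]) auto
  then show ?thesis by (subst lcong_iff_diff) (simp add: power_diff_1_eq)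
qed

lemma w_lcong_1: "lcong 1 w 1"
proof -
  have "[fact (p - 1) = - 1] (mod int p)" using wilson_theorem[OF prime_p] .
  then have "lcong 1 (of_int (fact (p - 1))) (of_int (- 1))" unfolding lcong_of_int_iff by simp
  moreover have "of_int (fact (p - 1)) = (\<Prod>u\<in>{0<..<p}. of_nat u :: rat)"
  proof -
    have "{0<..<p} = {1..p - 1}" using p_pos by auto
    then show ?thesis by (simp add: fact_prod)
  qed
  ultimately have "lcong 1 (\<Prod>u\<in>{0<..<p}. of_nat u) (- 1)" by simp
  from lcong_minus[OF this] show ?thesis unfolding w_def by simp
qed

text \<open>The gamma value at \<open>p y\<close> is \<open>w ^ n\<close> for any natural
  \<open>n\<close> congruent to \<open>y\<close> modulo \<open>p ^ 2\<close>. The four arguments add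
  up to 0, so the total exponent is a multiple of \<open>p ^ 2\<close>; and \<open>w\<close> is 1
  modulo \<open>p\<close> by Wilson's theorem, which makes \<open>w ^ (p ^ 2)\<close> equal to 1
  modulo \<open>p ^ 3\<close>.\<close>

lemma gam_product_lcong_1:
  assumes "p > 3" "x \<in> Z" "\<alpha> \<in> Z"
  shows "lcong 3 (gam 3 (of_nat p * - x) ^ 2 * gam 3 (of_nat p * (x + \<alpha>)) * gam 3 (of_nat p * (x - \<alpha>))) 1"
proof -
  obtain k where k: "lcong 2 (- x) (of_nat k)" using ex_nat_lcong[of "- x"] assms by blast
  obtain l where l: "lcong 2 (x + \<alpha>) (of_nat l)" using ex_nat_lcong[of "x + \<alpha>"] assms by blast
  obtain m where m: "lcong 2 (x - \<alpha>) (of_nat m)" using ex_nat_lcong[of "x - \<alpha>"] assms by blast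
  have *: "lcong 3 (gam 3 (of_nat p * y)) (w ^ n)" if "lcong 2 y (of_nat n)" for y n
  proof -
    have "lcong (2 + 1) (of_nat p ^ 1 * y) (of_nat p ^ 1 * of_nat n)" by (rule lcong_lift_p[OF that])
    then have "lcong 3 (of_nat p * y) (of_nat (p * n))" by simp
    from lcong_trans[OF gam_lcong_gammap_nat[OF this] gammap_nat_multiple[OF assms(1)]] show ?thesis .
  qed
  have w: "w \<in> Z" unfolding w_def by auto
  have "lcong 2 (- x + - x + (x + \<alpha>) + (x - \<alpha>)) (of_nat k + of_nat k + of_nat l + of_nat m)"
    by (intro lcong_add k l m)
  then have "lcong 2 (of_nat 0) (of_nat (k + k + l + m))" by simp
  then have "p ^ 2 dvd k + k + l + m" unfolding lcong_of_nat_iff by (metis cong_0_iff cong_sym)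
  then obtain n where n: "k + k + l + m = p ^ 2 * n" by (elim dvdE)
  have "lcong 3 (gam 3 (of_nat p * - x) ^ 2 * gam 3 (of_nat p * (x + \<alpha>)) * gam 3 (of_nat p * (x - \<alpha>)))
      ((w ^ k) ^ 2 * w ^ l * w ^ m)"
    by (intro lcong_mult lcong_power * k l m Z_mult Z_power U_Z gam_U)
  also have "(w ^ k) ^ 2 * w ^ l * w ^ m = w ^ (k + k + l + m)"
    by (simp add: power_add power2_eq_square)
  also have "\<dots> = ((w ^ p) ^ p) ^ n" unfolding n by (simp add: power_mult power2_eq_square)
  also have "lcong 3 \<dots> (1 ^ n)"
    using power_p_lcong_1[OF power_p_lcong_1[OF w_lcong_1]] w
    by (intro lcong_power) (auto simp: numeral_3_eq_3)
  finally show ?thesis by simp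
qed

section \<open>From gamma quotients to Pochhammer ratios\<close>

lemma pochhammer_unit_parts:
  assumes "lcong 1 y (- of_nat r)" "r < p" "j \<le> p"
  shows "pochhammer y j = (\<Prod>i<j. unit_part (y + of_nat i)) * (if r < j then y + of_nat r else 1)"
  using assms(3)
proof (induction j)
  case (Suc j)
  have c: "lcong 1 (of_nat j - of_nat r) (y + of_nat j)"
    using lcong_add[OF lcong_sym[OF assms(1)] lcong_refl[of 1 "of_nat j"]] by simp
  show ?case
  proof (cases "j = r")
    case True
    then have "y + of_nat j \<notin> U" using U_not_lcong_0 lcong_sym[OF c] by auto
    then have "unit_part (y + of_nat j) = 1" by (simp add: unit_part_def)
    then show ?thesis using Suc True by (simp add: pochhammer_Suc)
  next
    case False
    then have "y + of_nat j \<in> U"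
      using lcong_U[OF c] U_diff_nat[of r j] assms(2) Suc.prems by simp
    then have "unit_part (y + of_nat j) = y + of_nat j" by (simp add: unit_part_def)
    moreover have "r < Suc j \<longleftrightarrow> r < j" using False by auto
    ultimately show ?thesis using Suc by (simp add: pochhammer_Suc mult_ac)
  qed
qed simp

text \<open>Among at most \<open>p\<close> consecutive steps from \<open>y\<close> only the one with
  index \<open>r\<close> meets a multiple of \<open>p\<close>. The functional equation skips that
  factor, and the conditional on the left restores it.\<close>

lemma gam_pochhammer:
  assumes "y \<in> Z" "lcong 1 y (- of_nat r)" "r < p" "j \<le> p"
  shows "lcong 3 (gam 3 (y + of_nat j) * (if r < j then y + of_nat r else 1))
    ((- 1) ^ j * pochhammer y j * gam 3 y)"
proof -
  have "lcong 3 ((if r < j then y + of_nat r else 1) * gam 3 (y + of_nat j))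
    ((if r < j then y + of_nat r else 1) * ((- 1) ^ j * (\<Prod>i<j. unit_part (y + of_nat i)) * gam 3 y))"
    using assms(1) by (intro lcong_mult_left gam_plus_nat) auto
  then show ?thesis unfolding pochhammer_unit_parts[OF assms(2-4)] by (simp only: mult_ac)
qed

lemma minus_one_power_U: "(- 1) ^ n \<in> U"
  by (intro U_power U_minus) auto

text \<open>
  Here \<open>x\<close> is the solution of \<open>x = j + p x\<close>, that is, \<open>x = j / (1 - p)\<close>, so that every argument
  of \<open>gam\<close> is of the form \<open>p y\<close> for some \<open>y\<close> up to an integer.
\<close>

lemma gam_ratio_lcong_term_ratio:
  assumes p3: "p > 3" and \<alpha>: "\<alpha> \<in> Z" and r: "r < p" and j: "j < p"
    and a: "a = of_nat p * \<alpha> - of_nat r" and x: "x \<in> Z" "x = of_nat j + of_nat p * x"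
  shows "lcong 3 (gam 3 (- x) ^ 2 * (gam 3 (a + x) / gam 3 a * (gam 3 (1 - a + x) / gam 3 (1 - a)))
      * ((if r < j then of_nat p * (\<alpha> + x) else 1)
        * (if p - 1 - r < j then of_nat p * (1 + x - \<alpha>) else 1)))
    (term_ratio r (of_nat p * \<alpha>) j (of_nat p * x))" (is "lcong 3 (?L * (?F1 * ?F2)) _")
proof -
  define X where "X = of_nat p * x"
  define e where "e = of_nat p * \<alpha>"
  have X: "lcong 1 X 0" and e: "lcong 1 e 0"
    unfolding X_def e_def by (rule lcong_1_p_mult[OF x(1)], rule lcong_1_p_mult[OF \<alpha>])
  have Z: "X \<in> Z" "e \<in> Z" using X e lcong_0_Z by auto
  have ae: "a = e - of_nat r" and xX: "x = of_nat j + X" using a x(2) unfolding X_def e_def .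
  have aZ: "a \<in> Z" unfolding ae using Z by auto
  have pr: "lcong 1 y (y - of_nat p)" for y
    using lcong_sym[OF lcong_diff[OF lcong_refl[of 1 y] p_lcong_0]] by simp
  have prj: "of_nat (p - Suc r) = (of_nat p - 1 - of_nat r :: rat)" using r by (simp add: of_nat_diff)
  have P1: "pochhammer (1 + X) j \<in> U" by (rule pochhammer_Suc_U[OF X j])
  have P2: "pochhammer (a + X) r \<in> U"
    using pochhammer_diff_U[OF lcong_0_add[OF X e] r] unfolding ae by (simp add: algebra_simps)
  \<comment> \<open>The multiple of \<open>p\<close> would be met at index \<open>j\<close>, just
    beyond the \<open>j\<close> steps taken from \<open>- x\<close> to \<open>- X\<close>.\<close>
  have eq1: "lcong 3 (gam 3 (- x)) (gam 3 (- X) / pochhammer (1 + X) j)"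
  proof -
    have "lcong 1 (- x) (- of_nat j)"
      unfolding xX using lcong_diff[OF lcong_refl[of 1 "- of_nat j"] X] by simp
    from gam_pochhammer[OF _ this j, of j]
    have "lcong 3 (gam 3 (- X)) ((- 1) ^ j * pochhammer (- x) j * gam 3 (- x))"
      using Z_minus[OF x(1)] j unfolding xX by simp
    also have "pochhammer (- x) j = (- 1) ^ j * pochhammer (1 + X) j"
      unfolding pochhammer_minus xX by (simp add: algebra_simps)
    also have "(- 1) ^ j * ((- 1) ^ j * pochhammer (1 + X) j) * gam 3 (- x)
        = pochhammer (1 + X) j * gam 3 (- x)" by (simp flip: power_add mult_2)
    finally have "lcong 3 (pochhammer (1 + X) j * gam 3 (- x))
        (pochhammer (1 + X) j * (gam 3 (- X) / pochhammer (1 + X) j))"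
      using lcong_sym U_nonzero[OF P1] by simp
    then show ?thesis using lcong_cancel_left P1 by blast
  qed
  have eq2: "lcong 3 (gam 3 (a + x) * ?F1) ((- 1) ^ j * pochhammer (a + X) j * gam 3 (a + X))"
  proof -
    have "lcong 1 (a + X) (- of_nat r)"
      using lcong_add[OF lcong_0_add[OF e X] lcong_refl[of 1 "- of_nat r"]] unfolding ae
      by (simp add: algebra_simps)
    from gam_pochhammer[OF _ this r, of j]
    have "lcong 3 (gam 3 (a + X + of_nat j) * (if r < j then a + X + of_nat r else 1))
      ((- 1) ^ j * pochhammer (a + X) j * gam 3 (a + X))" using Z_add[OF aZ Z(1)] j by simp
    moreover have "a + X + of_nat r = of_nat p * (\<alpha> + x)"
      unfolding ae e_def X_def by (simp add: algebra_simps)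
    moreover have "a + X + of_nat j = a + x" unfolding xX by simp
    ultimately show ?thesis by (simp only:)
  qed
  have eq3: "lcong 3 (gam 3 (1 - a + x) * ?F2)
      ((- 1) ^ j * pochhammer (1 - a + X) j * gam 3 (1 - a + X))"
  proof -
    \<comment> \<open>Modulo \<open>p\<close> the start \<open>1 - a + X\<close> is
      \<open>r + 1\<close>, that is \<open>- (p - 1 - r)\<close>; this is the index at which a
      multiple of \<open>p\<close> is met.\<close>
    have "lcong 1 (1 - a + X) (1 - a + X - of_nat p)" by (rule pr)
    also have "1 - a + X - of_nat p = - of_nat (p - 1 - r) + (X - e)"
      using prj unfolding ae by simp
    also have "lcong 1 \<dots> (- of_nat (p - 1 - r) + (0 - 0))"
      by (intro lcong_add lcong_diff X e lcong_refl)
    finally have "lcong 1 (1 - a + X) (- of_nat (p - 1 - r))" by simp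
    from gam_pochhammer[OF _ this, of j]
    have "lcong 3 (gam 3 (1 - a + X + of_nat j)
        * (if p - 1 - r < j then 1 - a + X + of_nat (p - 1 - r) else 1))
      ((- 1) ^ j * pochhammer (1 - a + X) j * gam 3 (1 - a + X))"
      using Z_add[OF Z_diff[OF Z_1 aZ] Z(1)] j p_pos by simp
    moreover have "1 - a + X + of_nat (p - 1 - r) = of_nat p * (1 + x - \<alpha>)"
      using prj unfolding ae e_def X_def by (simp add: algebra_simps)
    moreover have "1 - a + X + of_nat j = 1 - a + x" unfolding xX by simp
    ultimately show ?thesis by (simp only:)
  qed
  have eq4: "lcong 3 (gam 3 (a + X)) ((- 1) ^ r * gam 3 (e + X) / pochhammer (a + X) r)"
  proof -
    have "lcong 1 (a + X) (- of_nat r)"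
      using lcong_add[OF lcong_0_add[OF e X] lcong_refl[of 1 "- of_nat r"]] unfolding ae
      by (simp add: algebra_simps)
    from gam_pochhammer[OF _ this r, of r]
    have "lcong 3 (gam 3 (e + X)) ((- 1) ^ r * pochhammer (a + X) r * gam 3 (a + X))"
      using Z_add[OF aZ Z(1)] r unfolding ae by (simp add: algebra_simps)
    then have "lcong 3 ((- 1) ^ r * gam 3 (e + X)) ((- 1) ^ r * ((- 1) ^ r * pochhammer (a + X) r * gam 3 (a + X)))"
      by (intro lcong_mult_left U_Z minus_one_power_U)
    also have "(- 1) ^ r * ((- 1) ^ r * pochhammer (a + X) r * gam 3 (a + X))
      = pochhammer (a + X) r * gam 3 (a + X)" by (simp flip: power_add mult_2 mult.assoc)
    finally have "lcong 3 (pochhammer (a + X) r * gam 3 (a + X))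
       (pochhammer (a + X) r * ((- 1) ^ r * gam 3 (e + X) / pochhammer (a + X) r))"
      using lcong_sym U_nonzero[OF P2] by simp
    then show ?thesis using lcong_cancel_left P2 by blast
  qed
  \<comment> \<open>The step from \<open>X - e\<close> to \<open>1 + X - e\<close> only changes the
    sign, as \<open>p\<close> divides \<open>X - e\<close>; \<open>r\<close> more steps lead to
    \<open>1 - a + X\<close>.\<close>
  have eq5: "lcong 3 (gam 3 (1 - a + X)) ((- 1) ^ Suc r * pochhammer (1 + X - e) r * gam 3 (X - e))"
  proof -
    have Xe: "lcong 1 (X - e) 0" using lcong_diff[OF X e] by simp
    then have "unit_part (X - e) = 1" using U_not_lcong_0 unfolding unit_part_def by auto
    then have 1: "lcong 3 (gam 3 (1 + X - e)) (- gam 3 (X - e))"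
      using gam_plus_1[of "X - e" 3] Z by (auto simp: algebra_simps)
    have "lcong 1 (1 + X - e) (1 + X - e - of_nat p)" by (rule pr)
    also have "1 + X - e - of_nat p = - of_nat (p - 1) + (X - e)"
      using r by (simp add: of_nat_diff)
    also have "lcong 1 \<dots> (- of_nat (p - 1) + 0)"
      by (intro lcong_add Xe lcong_refl)
    finally have "lcong 1 (1 + X - e) (- of_nat (p - 1))" by simp
    from gam_pochhammer[OF _ this, of r]
    have "lcong 3 (gam 3 (1 + X - e + of_nat r)) ((- 1) ^ r * pochhammer (1 + X - e) r * gam 3 (1 + X - e))"
      using Z_diff[OF Z_add[OF Z_1 Z(1)] Z(2)] r p_pos by (auto split: if_splits)
    also have "lcong 3 \<dots> ((- 1) ^ r * pochhammer (1 + X - e) r * (- gam 3 (X - e)))"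
      using Z by (intro lcong_mult_left 1 Z_mult U_Z[OF minus_one_power_U] pochhammer_Z) auto
    finally show ?thesis unfolding ae by (simp add: algebra_simps)
  qed
  have eq6: "lcong 3 (gam 3 a * gam 3 (1 - a)) ((- 1) ^ Suc r)"
  proof -
    have "lcong 1 (1 - a) (of_nat (Suc r))"
      unfolding ae using lcong_diff[OF lcong_refl[of 1 "of_nat (Suc r)"] e] by (simp add: algebra_simps)
    from gam_reflection[OF _ _ this r, of 3] show ?thesis
      using Z_diff[OF Z_1 aZ] by (simp add: mult.commute)
  qed
  have F: "?F1 \<in> Z" "?F2 \<in> Z" using x(1) \<alpha> by auto
  have Zg: "gam 3 y \<in> Z" for y by (rule U_Z[OF gam_U])
  have T1: "lcong 3 (gam 3 (a + x) * ?F1)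
      ((- 1) ^ j * pochhammer (a + X) j * ((- 1) ^ r * gam 3 (e + X) / pochhammer (a + X) r))"
    using aZ Z by (intro lcong_trans[OF eq2] lcong_mult_left eq4 Z_mult pochhammer_Z
        U_Z[OF minus_one_power_U]) auto
  have T2: "lcong 3 (gam 3 (1 - a + x) * ?F2)
      ((- 1) ^ j * pochhammer (1 - a + X) j * ((- 1) ^ Suc r * pochhammer (1 + X - e) r * gam 3 (X - e)))"
    using aZ Z by (intro lcong_trans[OF eq3] lcong_mult_left eq5 Z_mult pochhammer_Z
        U_Z[OF minus_one_power_U]) auto
  have m1: "lcong 3 (gam 3 (- x) ^ 2 * (gam 3 (a + x) * ?F1 * (gam 3 (1 - a + x) * ?F2)) / (gam 3 a * gam 3 (1 - a)))
    ((gam 3 (- X) / pochhammer (1 + X) j) ^ 2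
      * ((- 1) ^ j * pochhammer (a + X) j * ((- 1) ^ r * gam 3 (e + X) / pochhammer (a + X) r)
        * ((- 1) ^ j * pochhammer (1 - a + X) j * ((- 1) ^ Suc r * pochhammer (1 + X - e) r * gam 3 (X - e))))
      / (- 1) ^ Suc r)"
    by (rule lcong_divide[OF lcong_mult[OF lcong_power[OF eq1 Zg]
          lcong_mult[OF T1 T2 Z_mult[OF Zg F(1)] Z_mult[OF Zg F(2)]]] eq6])
      (intro Z_mult Z_power Zg F U_mult gam_U minus_one_power_U)+
  have m2: "gam 3 (- x) ^ 2 * (gam 3 (a + x) * ?F1 * (gam 3 (1 - a + x) * ?F2)) / (gam 3 a * gam 3 (1 - a))
      = ?L * (?F1 * ?F2)"
    by (simp only: times_divide_eq_left times_divide_eq_right divide_divide_eq_left mult_ac)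
  have m3: "(gam 3 (- X) / pochhammer (1 + X) j) ^ 2
      * ((- 1) ^ j * pochhammer (a + X) j * ((- 1) ^ r * gam 3 (e + X) / pochhammer (a + X) r)
        * ((- 1) ^ j * pochhammer (1 - a + X) j * ((- 1) ^ Suc r * pochhammer (1 + X - e) r * gam 3 (X - e))))
      / (- 1) ^ Suc r
    = (gam 3 (- X) ^ 2 * gam 3 (e + X) * gam 3 (X - e)) * term_ratio r e j X"
  proof -
    have poch: "pochhammer (1 + X - e) (r + j) = pochhammer (1 + X - e) r * pochhammer (1 - a + X) j"
      using pochhammer_product'[of "1 + X - e" r j] unfolding ae by (simp add: algebra_simps)
    have aX: "X + e - of_nat r = a + X" unfolding ae by simp
    have cancel: "(g / y) ^ 2 * (s * A * (s' * h / B) * (s * C * (- s' * D * k))) / (- s')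
        = (s * s) * ((g ^ 2 * h * k) * (s' * (D * C) * A / (B * y ^ 2)))" if "s' \<noteq> 0"
      for g y s A s' h B C D k :: rat using that by (simp add: power_divide mult_ac)
    have "(- 1 :: rat) ^ j * (- 1) ^ j = 1" by (simp flip: power_add mult_2)
    then show ?thesis unfolding term_ratio_def aX poch
      using cancel[of "(- 1) ^ r" "gam 3 (- X)" "pochhammer (1 + X) j" "(- 1) ^ j"
          "pochhammer (a + X) j" "gam 3 (e + X)" "pochhammer (a + X) r" "pochhammer (1 - a + X) j"
          "pochhammer (1 + X - e) r" "gam 3 (X - e)"] by simp
  qed
  \<comment> \<open>All gamma values left are at multiples of \<open>p\<close>, and their product is
    1.\<close>
  have m4: "lcong 3 ((gam 3 (- X) ^ 2 * gam 3 (e + X) * gam 3 (X - e)) * term_ratio r e j X)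
      (1 * term_ratio r e j X)"
  proof (rule lcong_mult)
    have "- X = of_nat p * - x" "e + X = of_nat p * (x + \<alpha>)" "X - e = of_nat p * (x - \<alpha>)"
      unfolding X_def e_def by (simp_all add: algebra_simps)
    then show "lcong 3 (gam 3 (- X) ^ 2 * gam 3 (e + X) * gam 3 (X - e)) 1"
      using gam_product_lcong_1[OF p3 x(1) \<alpha>] by simp
    show "term_ratio r e j X \<in> Z" by (rule term_ratio_Z[OF e X r j])
  qed (auto intro!: Z_mult intro: U_Z[OF gam_U])
  show ?thesis using lcong_trans[OF m1[unfolded m2 m3] m4] unfolding X_def e_def mult_1 .
qed

end


section \<open>The summands of hyperG\<close>

lemma floor_diff_fraction:
  assumes "0 < c" "c < d" "j < m"
  shows "\<lfloor>of_nat c / of_nat d - of_nat j / of_nat m :: rat\<rfloor> = (if j * d \<le> c * m then 0 else - 1)"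
proof -
  have d: "(of_nat d :: rat) > 0" and m: "(of_nat m :: rat) > 0" using assms by auto
  have floor: "\<lfloor>u - v\<rfloor> = (if v \<le> u then 0 else - 1)" if "0 < u" "u < 1" "0 \<le> v" "v < 1" for u v :: rat
    using that by (auto simp: floor_eq_iff)
  have "rat_of_nat c / of_nat d < 1" "rat_of_nat c / of_nat d > 0"
    "rat_of_nat j / of_nat m < 1" "rat_of_nat j / of_nat m \<ge> 0"
    using assms d m by (simp_all add: divide_simps)
  moreover have "rat_of_nat j / of_nat m \<le> of_nat c / of_nat d \<longleftrightarrow> j * d \<le> c * m"
  proof -
    have "rat_of_nat j / of_nat m \<le> of_nat c / of_nat d \<longleftrightarrow> rat_of_nat (j * d) \<le> of_nat (c * m)"
      using d m by (simp add: pos_divide_le_eq pos_le_divide_eq)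
    then show ?thesis by (simp only: of_nat_le_iff)
  qed
  ultimately show ?thesis using floor[of "of_nat c / of_nat d" "of_nat j / of_nat m"] by simp
qed

context odd_localization
begin

text \<open>The floor will be 0 or -1, so \<open>nat\<close> loses nothing.\<close>

definition part :: "rat \<Rightarrow> rat \<Rightarrow> rat" where
  "part b t = gam 3 (frac (b - t)) / gam 3 b * (- of_nat p) ^ nat (- \<lfloor>b - t\<rfloor>)"

text \<open>The share of the parameters \<open>b\<close> and \<open>1 - b\<close>, with two of the
  four gamma values at \<open>t\<close>. The sign \<open>(- 1) ^ j\<close> is dropped since it
  occurs to the fourth power.\<close>

definition pair_factor :: "rat \<Rightarrow> rat \<Rightarrow> rat" where
  "pair_factor b t = gam 3 t ^ 2 * (part b t * part (1 - b) t)"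

lemma pair_factor_flip: "pair_factor (1 - b) t = pair_factor b t"
  unfolding pair_factor_def by (simp add: mult.commute)

lemma part_Z: assumes "\<lfloor>b - t\<rfloor> \<in> {0, - 1}" shows "part b t \<in> Z"
  unfolding part_def by (intro Z_mult Z_divide Z_power Z_minus U_Z[OF gam_U] gam_U Z_of_nat)

text \<open>Where the fractional part adds 1, the functional equation removes it again; the minus
  sign it brings cancels that of \<open>- p\<close>.\<close>

lemma part_lcong:
  assumes "b - t \<in> Z" "\<lfloor>b - t\<rfloor> \<in> {0, - 1}"
  shows "lcong 3 (part b t)
    (gam 3 (b - t) / gam 3 b * (if \<lfloor>b - t\<rfloor> = - 1 then of_nat p * unit_part (b - t) else 1))"
proof (cases "\<lfloor>b - t\<rfloor> = - 1")
  case True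
  then have "frac (b - t) = b - t + 1" by (simp add: frac_def)
  then have "part b t = (- of_nat p / gam 3 b) * gam 3 (b - t + 1)"
    unfolding part_def using True by simp
  also have "lcong 3 \<dots> ((- of_nat p / gam 3 b) * (- unit_part (b - t) * gam 3 (b - t)))"
    using assms(1) by (intro lcong_mult_left gam_plus_1 Z_divide gam_U Z_minus Z_of_nat) auto
  finally show ?thesis using True by (simp add: mult_ac)
next
  case False
  then have "\<lfloor>b - t\<rfloor> = 0" using assms(2) by auto
  then show ?thesis unfolding part_def by (simp add: frac_def)
qed

text \<open>The hypothesis \<open>factors\<close> isolates the arithmetic of \<open>p\<close> modulo
  \<open>d\<close>: the powers of \<open>p\<close> produced by the floors have to match the
  multiples of \<open>p\<close> met by the Pochhammer symbols.\<close>

lemma pair_factor_lcong_term_ratio: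
  assumes "p > 3" "\<alpha> \<in> Z" "r < p" "j < p"
    and "a = of_nat p * \<alpha> - of_nat r" "x \<in> Z" "x = of_nat j + of_nat p * x"
    and floor: "\<lfloor>a + x\<rfloor> \<in> {0, - 1}" "\<lfloor>1 - a + x\<rfloor> \<in> {0, - 1}"
    and factors: "(if \<lfloor>a + x\<rfloor> = - 1 then of_nat p * unit_part (a + x) else 1)
        * (if \<lfloor>1 - a + x\<rfloor> = - 1 then of_nat p * unit_part (1 - a + x) else 1)
      = (if r < j then of_nat p * (\<alpha> + x) else 1)
        * (if p - 1 - r < j then of_nat p * (1 + x - \<alpha>) else 1)"
  shows "lcong 3 (pair_factor a (- x)) (term_ratio r (of_nat p * \<alpha>) j (of_nat p * x))"
proof -
  have aZ: "a \<in> Z" using assms by auto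
  have Z: "a + x \<in> Z" "1 - a + x \<in> Z" using aZ assms(6) by auto
  have "lcong 3 (part a (- x) * part (1 - a) (- x))
     ((gam 3 (a + x) / gam 3 a * (if \<lfloor>a + x\<rfloor> = - 1 then of_nat p * unit_part (a + x) else 1))
      * (gam 3 (1 - a + x) / gam 3 (1 - a)
        * (if \<lfloor>1 - a + x\<rfloor> = - 1 then of_nat p * unit_part (1 - a + x) else 1)))"
    by (rule lcong_mult[OF part_lcong[of a "- x", unfolded diff_minus_eq_add, OF Z(1) floor(1)]
          part_lcong[of "1 - a" "- x", unfolded diff_minus_eq_add, OF Z(2) floor(2)]
          part_Z[of a "- x", unfolded diff_minus_eq_add, OF floor(1)]
          part_Z[of "1 - a" "- x", unfolded diff_minus_eq_add, OF floor(2)]])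
  also have "(gam 3 (a + x) / gam 3 a * (if \<lfloor>a + x\<rfloor> = - 1 then of_nat p * unit_part (a + x) else 1))
      * (gam 3 (1 - a + x) / gam 3 (1 - a)
        * (if \<lfloor>1 - a + x\<rfloor> = - 1 then of_nat p * unit_part (1 - a + x) else 1))
    = (gam 3 (a + x) / gam 3 a * (gam 3 (1 - a + x) / gam 3 (1 - a)))
      * ((if \<lfloor>a + x\<rfloor> = - 1 then of_nat p * unit_part (a + x) else 1)
        * (if \<lfloor>1 - a + x\<rfloor> = - 1 then of_nat p * unit_part (1 - a + x) else 1))"
    by (simp only: mult_ac)
  also note factors
  finally have "lcong 3 (gam 3 (- x) ^ 2 * (part a (- x) * part (1 - a) (- x)))
     (gam 3 (- x) ^ 2 * ((gam 3 (a + x) / gam 3 a * (gam 3 (1 - a + x) / gam 3 (1 - a)))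
      * ((if r < j then of_nat p * (\<alpha> + x) else 1)
        * (if p - 1 - r < j then of_nat p * (1 + x - \<alpha>) else 1))))"
    by (intro lcong_mult_left Z_power U_Z[OF gam_U])
  also have "lcong 3 \<dots> (term_ratio r (of_nat p * \<alpha>) j (of_nat p * x))"
    using gam_ratio_lcong_term_ratio[OF assms(1-7)] by (simp only: mult.assoc)
  finally show ?thesis unfolding pair_factor_def .
qed

text \<open>In the class of -1, \<open>(p - 1) div d\<close> equals \<open>(p + 1) / d - 1\<close>.
  For \<open>d = 2\<close> the two classes coincide and are assigned to the first case, so that
  \<open>d - 2\<close> is positive in the second.\<close>

lemma residue_cases:
  assumes "d \<ge> 2" "[int p = 1] (mod int d) \<or> [int p = - 1] (mod int d)"
  defines "r \<equiv> (p - 1) div d"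
  shows "p = d * r + 1 \<or> d > 2 \<and> p + 1 = d * (r + 1)"
proof -
  have p: "p - 1 + 1 = p" using p_pos by simp
  have minus: ?thesis if "int d dvd int p + 1" "d > 2"
  proof -
    have "int d dvd int (p + 1)" using that by (simp add: add.commute)
    then have "d dvd p + 1" by (simp only: int_dvd_int_iff)
    then obtain k where k: "p + 1 = d * k" by (elim dvdE)
    then obtain k' where k': "k = Suc k'" by (cases k) auto
    have "p - 1 = d * k' + (d - 2)" using k k' that(2) by simp
    then have "r = k'" unfolding r_def using that(2) by (intro div_nat_eqI) auto
    then show ?thesis using k k' that(2) by simp
  qed
  have plus: ?thesis if "int d dvd int p - 1"
  proof -
    have "int p - 1 = int (p - 1)" using p_pos by (simp add: of_nat_diff)
    then have "d dvd p - 1" using that by (simp only: int_dvd_int_iff)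
    then show ?thesis unfolding r_def using p by simp
  qed
  show ?thesis
  proof (cases "d = 2")
    case True
    have "even (int p - 1)" using odd_p by simp
    then show ?thesis using plus True by simp
  next
    case False
    then show ?thesis using assms plus minus by (auto simp: cong_iff_dvd_diff)
  qed
qed

lemma d_unit:
  assumes "d \<ge> 2" "[int p = 1] (mod int d) \<or> [int p = - 1] (mod int d)"
  shows "of_nat d \<in> U" "1 / of_nat d \<in> Z"
proof -
  have "\<not> p dvd d"
  proof
    assume "p dvd d"
    then have pd: "int p dvd int d" by simp
    have "int d dvd int p - 1 \<or> int d dvd int p + 1" using assms(2) by (auto simp: cong_iff_dvd_diff)
    then have "int p dvd int p - 1 \<or> int p dvd int p + 1" using pd dvd_trans by blast
    then have "int p dvd 1" by (auto simp: dvd_diff_right_iff dvd_add_right_iff)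
    then show False using p_ge_2 by simp
  qed
  then show U: "of_nat d \<in> U" by (rule U_of_nat)
  show "1 / of_nat d \<in> Z" using U by (intro Z_divide) auto
qed

text \<open>The point is where the floors drop to -1. For \<open>p = d r + 1\<close> this happens
  right after \<open>j = r\<close> and \<open>j = p - 1 - r\<close>, when a Pochhammer symbol has
  passed a multiple of \<open>p\<close>. For \<open>p + 1 = d (r + 1)\<close> the parameters
  \<open>a\<close> and \<open>1 - a\<close> change places and the second drop comes one step early,
  at \<open>j = p - 1 - r\<close> itself.\<close>

lemma pair_factor_lcong:
  assumes p3: "p > 3" and d: "d \<ge> 2" "[int p = 1] (mod int d) \<or> [int p = - 1] (mod int d)"
    and j: "j < p - 1"
  shows "lcong 3 (pair_factor (1 / of_nat d) (of_nat j / (of_nat p - 1)))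
    (term_ratio ((p - 1) div d) (of_nat p * (1 / of_nat d)) j (of_nat p * (of_nat j / (1 - of_nat p))))"
proof -
  define r where "r = (p - 1) div d"
  define \<alpha> :: rat where "\<alpha> = 1 / of_nat d"
  define x :: rat where "x = of_nat j / (1 - of_nat p)"
  have p1: "(1 - of_nat p :: rat) \<noteq> 0" "(of_nat p - 1 :: rat) = of_nat (p - 1)"
    using p3 by (simp_all add: of_nat_diff)
  have t: "of_nat j / (of_nat p - 1) = - x"
    unfolding x_def by (simp add: minus_divide_right)
  have xeq: "x = of_nat j + of_nat p * x"
  proof -
    have "x * (1 - of_nat p) = of_nat j" unfolding x_def using p1(1) by simp
    then show ?thesis by (simp add: algebra_simps)
  qed
  have xZ: "x \<in> Z" unfolding x_def using one_minus_p_U by (intro Z_divide) auto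
  have \<alpha>Z: "\<alpha> \<in> Z" unfolding \<alpha>_def using d_unit[OF d] by simp
  have px: "lcong 1 (of_nat p * x) 0" "lcong 1 (of_nat p * \<alpha>) 0"
    using lcong_1_p_mult xZ \<alpha>Z by blast+
  have "r \<le> p - 1" unfolding r_def by (rule div_le_dividend)
  then have r: "r < p" "r \<le> p - 1" using p_pos by auto
  have d0: "(of_nat d :: rat) \<noteq> 0" using d by simp
  have j': "j < p" using j by simp
  have x': "- x = of_nat j / of_nat (p - 1)" using t unfolding p1(2) by (rule sym)
  have floor1: "\<lfloor>\<alpha> + x\<rfloor> = (if j * d \<le> p - 1 then 0 else - 1)"
  proof -
    have "\<lfloor>of_nat 1 / of_nat d - - x\<rfloor> = (if j * d \<le> 1 * (p - 1) then 0 else - 1)"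
      unfolding x' using d j by (intro floor_diff_fraction) auto
    then show ?thesis by (simp add: \<alpha>_def)
  qed
  have floor2: "\<lfloor>1 - \<alpha> + x\<rfloor> = (if j * d \<le> (d - 1) * (p - 1) then 0 else - 1)"
  proof -
    have "1 - \<alpha> = of_nat (d - 1) / of_nat d"
      unfolding \<alpha>_def using d d0 by (simp add: of_nat_diff field_simps)
    moreover have "\<lfloor>of_nat (d - 1) / of_nat d - - x\<rfloor> = (if j * d \<le> (d - 1) * (p - 1) then 0 else - 1)"
      unfolding x' using d j by (intro floor_diff_fraction) auto
    ultimately show ?thesis by simp
  qed
  define a where "a = of_nat p * \<alpha> - of_nat r"
  have a: "a + x \<in> U" if "j \<noteq> r"
  proof -
    have "lcong 1 (a + x) (0 - of_nat r + (of_nat j + 0))"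
      unfolding a_def by (subst xeq, intro lcong_add lcong_diff px lcong_refl)
    then have "lcong 1 (of_nat j - of_nat r) (a + x)" by (subst lcong_sym) simp_all
    then show ?thesis by (rule lcong_U) (use U_diff_nat[OF r(1) j'] that in auto)
  qed
  have prj: "of_nat (p - 1 - r) = (of_nat p - 1 - of_nat r :: rat)" using r p_pos by (simp add: of_nat_diff)
  have a'eq: "1 - a + x = of_nat j - of_nat (p - 1 - r) + of_nat p * (1 + x - \<alpha>)"
    unfolding a_def prj by (subst xeq) (simp add: algebra_simps)
  have a'cong: "lcong 1 (1 - a + x) (of_nat j - of_nat (p - 1 - r) + 0)"
    unfolding a'eq using xZ \<alpha>Z by (intro lcong_add lcong_refl lcong_1_p_mult) auto
  have a': "1 - a + x \<in> U" if "j \<noteq> p - 1 - r"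
    by (rule lcong_U[OF lcong_sym[OF a'cong]]) (use U_diff_nat[of "p - 1 - r" j] j' that p_pos in auto)
  have up: "unit_part y = y" if "y \<in> U" for y using that by (simp add: unit_part_def)
  have up1: "unit_part (1 - a + x) = 1" if "j = p - 1 - r"
    using a'cong that U_not_lcong_0[of "1 - a + x"] by (auto simp: unit_part_def)
  have main: "lcong 3 (pair_factor a (- x)) (term_ratio r (of_nat p * \<alpha>) j (of_nat p * x))"
    if "(a = \<alpha> \<or> 1 - a = \<alpha>)" and factors: "(if \<lfloor>a + x\<rfloor> = - 1 then of_nat p * unit_part (a + x) else 1)
        * (if \<lfloor>1 - a + x\<rfloor> = - 1 then of_nat p * unit_part (1 - a + x) else 1)
      = (if r < j then of_nat p * (\<alpha> + x) else 1)
        * (if p - 1 - r < j then of_nat p * (1 + x - \<alpha>) else 1)"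
  proof (rule pair_factor_lcong_term_ratio[OF p3 \<alpha>Z r(1) j' a_def xZ xeq _ _ factors])
    have "a = \<alpha> \<and> 1 - a = 1 - \<alpha> \<or> a = 1 - \<alpha> \<and> 1 - a = \<alpha>" using that(1) by auto
    then show "\<lfloor>a + x\<rfloor> \<in> {0, - 1}" "\<lfloor>1 - a + x\<rfloor> \<in> {0, - 1}"
      using floor1 floor2 by (auto split: if_splits)
  qed
  have "lcong 3 (pair_factor \<alpha> (- x)) (term_ratio r (of_nat p * \<alpha>) j (of_nat p * x))"
    using residue_cases[OF d] unfolding r_def[symmetric]
  proof
    assume p: "p = d * r + 1"
    have "(of_nat p :: rat) = of_nat d * of_nat r + 1" by (subst p) simp
    then have aa: "a = \<alpha>" unfolding a_def \<alpha>_def using d0 by (simp add: field_simps)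
    have 1: "j * d \<le> p - 1 \<longleftrightarrow> \<not> r < j"
      using d p by (simp add: mult.commute[of j d] not_less)
    have 2: "j * d \<le> (d - 1) * (p - 1) \<longleftrightarrow> \<not> p - 1 - r < j"
    proof -
      have "(d - 1) * (p - 1) = (d - 1) * r * d" "p - 1 - r = (d - 1) * r"
        using p by (simp_all add: diff_mult_distrib diff_mult_distrib2 mult_ac)
      then show ?thesis using d by (simp add: not_less)
    qed
    have "lcong 3 (pair_factor a (- x)) (term_ratio r (of_nat p * \<alpha>) j (of_nat p * x))"
    proof (rule main)
      have u1: "unit_part (\<alpha> + x) = \<alpha> + x" if "r < j" using up a that aa by simp
      have u2: "unit_part (1 - \<alpha> + x) = 1 + x - \<alpha>" if "p - 1 - r < j" using up a' that aa by simp
      show "(if \<lfloor>a + x\<rfloor> = - 1 then of_nat p * unit_part (a + x) else 1)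
          * (if \<lfloor>1 - a + x\<rfloor> = - 1 then of_nat p * unit_part (1 - a + x) else 1)
        = (if r < j then of_nat p * (\<alpha> + x) else 1)
          * (if p - 1 - r < j then of_nat p * (1 + x - \<alpha>) else 1)"
        unfolding aa floor1 floor2 1 2 using u1 u2 by simp
    qed (simp add: aa)
    then show ?thesis using aa by simp
  next
    assume "2 < d \<and> p + 1 = d * (r + 1)"
    then have d2: "d > 2" and p: "p + 1 = d * (r + 1)" by auto
    have "(of_nat (p + 1) :: rat) = of_nat (d * (r + 1))" by (subst p) simp
    then have "(of_nat p :: rat) = of_nat d * of_nat r + of_nat d - 1" by (simp add: algebra_simps)
    then have aa: "a = 1 - \<alpha>" unfolding a_def \<alpha>_def using d0 by (simp add: field_simps)
    have pr: "p - 1 = r * d + (d - 2)" using p d2 by (simp add: algebra_simps)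
    have 1: "j * d \<le> p - 1 \<longleftrightarrow> \<not> r < j"
    proof
      assume "j * d \<le> p - 1"
      then have "j * d < (r + 1) * d" using pr d2 by simp
      then have "j < r + 1" using mult_less_cancel2 by blast
      then show "\<not> r < j" by simp
    next
      assume "\<not> r < j"
      then have "j * d \<le> r * d" by (intro mult_le_mono1) simp
      then show "j * d \<le> p - 1" unfolding pr by (rule trans_le_add1)
    qed
    \<comment> \<open>\<open>(d - 1) (p - 1)\<close> falls short of the multiple
      \<open>(p - 1 - r) d\<close> by \<open>d - 2 > 0\<close>, so the bound on \<open>j\<close>
      becomes strict.\<close>
    have key: "(d - 1) * (p - 1) + (d - 2) = (p - 1 - r) * d"
    proof -
      have "int ((d - 1) * (p - 1) + (d - 2)) = (int d - 1) * (int p - 1) + (int d - 2)"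
        using d2 p_pos by (simp add: of_nat_diff)
      also have "\<dots> = int d * int p - (int p + 1)" by (simp add: algebra_simps)
      also have "int p + 1 = int d * (int r + 1)" using arg_cong[OF p, of int] by (simp add: algebra_simps)
      also have "int d * int p - int d * (int r + 1) = (int p - 1 - int r) * int d"
        by (simp add: algebra_simps)
      also have "\<dots> = int ((p - 1 - r) * d)" using r p_pos by (simp add: of_nat_diff)
      finally show ?thesis by (simp only: of_nat_eq_iff)
    qed
    have 2: "j * d \<le> (d - 1) * (p - 1) \<longleftrightarrow> \<not> p - 1 - r \<le> j"
    proof
      assume "j * d \<le> (d - 1) * (p - 1)"
      then have "j * d < (p - 1 - r) * d" using key d2 by linarith
      then show "\<not> p - 1 - r \<le> j" by simp
    next
      assume "\<not> p - 1 - r \<le> j"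
      then have "(j + 1) * d \<le> (p - 1 - r) * d" by (intro mult_le_mono1) simp
      then show "j * d \<le> (d - 1) * (p - 1)" unfolding key[symmetric] using d2 by simp
    qed
    \<comment> \<open>A consequence of \<open>d \<ge> 3\<close>. It ensures
      \<open>j \<noteq> r\<close> once \<open>j \<ge> p - 1 - r\<close>, so that
      \<open>a + x\<close> is a unit there.\<close>
    have rr: "r < p - 1 - r"
    proof -
      have "3 * (r + 1) \<le> d * (r + 1)" using d2 by (intro mult_le_mono1) simp
      then have "3 * (r + 1) \<le> p + 1" unfolding p .
      then have "r + r + 1 < p" by simp
      then show ?thesis by simp
    qed
    have "lcong 3 (pair_factor a (- x)) (term_ratio r (of_nat p * \<alpha>) j (of_nat p * x))"
    proof (rule main)
      have e1: "a + x = 1 + x - \<alpha>" "1 - a + x = \<alpha> + x" using aa by simp_all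
      have u1: "unit_part (1 + x - \<alpha>) = 1 + x - \<alpha>" if "p - 1 - r \<le> j" using up a that rr e1 by simp
      have u2: "unit_part (\<alpha> + x) = \<alpha> + x" if "p - 1 - r \<noteq> j" using up a' that e1 by simp
      have u3: "unit_part (\<alpha> + x) = 1" "\<alpha> + x = of_nat p * (1 + x - \<alpha>)" if "p - 1 - r = j"
        using up1 a'eq that e1 by auto
      have f1: "\<lfloor>1 + x - \<alpha>\<rfloor> = (if p - 1 - r \<le> j then - 1 else 0)"
        using floor2 2 by (simp add: algebra_simps)
      have f2: "\<lfloor>\<alpha> + x\<rfloor> = (if r < j then - 1 else 0)" using floor1 1 by simp
      show "(if \<lfloor>a + x\<rfloor> = - 1 then of_nat p * unit_part (a + x) else 1)
          * (if \<lfloor>1 - a + x\<rfloor> = - 1 then of_nat p * unit_part (1 - a + x) else 1)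
        = (if r < j then of_nat p * (\<alpha> + x) else 1)
          * (if p - 1 - r < j then of_nat p * (1 + x - \<alpha>) else 1)"
      proof (cases "p - 1 - r = j")
        \<comment> \<open>At this \<open>j\<close> the premature factor \<open>p\<close> is made up
          for by \<open>\<alpha> + x = p (1 + x - \<alpha>)\<close>, whose unit part is 1: both
          sides are \<open>p ^ 2 (1 + x - \<alpha>)\<close>.\<close>
        case True
        then have c: "(p - 1 - r \<le> j) = True" "(r < j) = True" "(p - 1 - r < j) = False"
          and u1': "unit_part (1 + x - \<alpha>) = 1 + x - \<alpha>"
          using rr u1 by auto
        have "of_nat p * (1 + x - \<alpha>) * (of_nat p * 1) = of_nat p * (\<alpha> + x) * 1"
          by (subst u3(2)[OF True]) (simp add: mult_ac)
        then show ?thesis by (simp only: e1 f1 f2 c u1' u3(1)[OF True] if_True if_False simp_thms)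
      next
        case False
        then show ?thesis unfolding e1 f1 f2 u2[OF False] using u1 by (auto simp: mult.commute)
      qed
    qed (simp add: aa)
    then show ?thesis unfolding aa using pair_factor_flip by simp
  qed
  then show ?thesis unfolding t r_def \<alpha>_def x_def .
qed

end

section \<open>Hypergeometric summands, the sign \<open>s(p)\<close> and the last point\<close>

lemma pochhammer_reflect:
  "pochhammer (e - of_nat r) r = (- 1) ^ r * pochhammer (1 - e) r" for e :: "'a :: field_char_0"
  using pochhammer_minus[of "of_nat r - e" r] by (simp add: algebra_simps)

text \<open>The symbol \<open>(e - r)_r = (- 1) ^ r (1 - e)_r\<close> in the denominator cancels the
  sign and the first \<open>r\<close> factors of the numerator.\<close>

lemma term_ratio_0:
  assumes "pochhammer (1 - e) r \<noteq> 0"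
  shows "term_ratio r e k 0 = pochhammer (e - of_nat r) k * pochhammer (1 - (e - of_nat r)) k / fact k ^ 2"
proof -
  have "pochhammer (1 - e) (r + k) = pochhammer (1 - e) r * pochhammer (1 - (e - of_nat r)) k"
    using pochhammer_product'[of "1 - e" r k] by (simp add: algebra_simps)
  moreover have "(- 1 :: rat) ^ r * (- 1) ^ r = 1" by (simp flip: power_add mult_2)
  ultimately show ?thesis unfolding term_ratio_def using assms
    by (simp add: pochhammer_reflect pochhammer_fact[symmetric] mult_ac)
qed

context odd_localization
begin

text \<open>The first alternative belongs to \<open>p = d r + 1\<close>, the second to
  \<open>p + 1 = d (r + 1)\<close>.\<close>

lemma parameter_cases:
  assumes "d \<ge> 2" "[int p = 1] (mod int d) \<or> [int p = - 1] (mod int d)"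
  defines "a \<equiv> of_nat p * (1 / of_nat d) - of_nat ((p - 1) div d) :: rat"
  shows "a = 1 / of_nat d \<or> a = 1 - 1 / of_nat d"
proof -
  define r where "r = (p - 1) div d"
  have d0: "(of_nat d :: rat) \<noteq> 0" using assms(1) by simp
  consider "p = d * r + 1" | "p + 1 = d * (r + 1)"
    using residue_cases[OF assms(1,2)] unfolding r_def by blast
  then show ?thesis
  proof cases
    case 1
    have "(of_nat p :: rat) = of_nat d * of_nat r + 1" by (subst 1) simp
    then have "a = 1 / of_nat d" unfolding a_def r_def[symmetric] using d0 by (simp add: field_simps)
    then show ?thesis ..
  next
    case 2
    have "(of_nat (p + 1) :: rat) = of_nat (d * (r + 1))" by (subst 2) simp
    then have "(of_nat p :: rat) = of_nat d * of_nat r + of_nat d - 1" by (simp add: algebra_simps)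
    then have "a = 1 - 1 / of_nat d" unfolding a_def r_def[symmetric] using d0 by (simp add: field_simps)
    then show ?thesis ..
  qed
qed

text \<open>Modulo \<open>p\<close>, \<open>1 - a\<close> is \<open>r + 1\<close>, which is the
  exponent in the reflection formula; the product does not see which of \<open>a\<close> and
  \<open>1 - a\<close> is \<open>1 / d\<close>.\<close>

lemma gam_reflection_fraction:
  assumes "d \<ge> 2" "[int p = 1] (mod int d) \<or> [int p = - 1] (mod int d)" "N > 0"
  shows "lcong N (gam N (1 / of_nat d) * gam N (1 - 1 / of_nat d)) ((- 1) ^ Suc ((p - 1) div d))"
proof -
  define r where "r = (p - 1) div d"
  define a :: rat where "a = of_nat p * (1 / of_nat d) - of_nat r"
  have aZ: "1 - a \<in> Z" unfolding a_def using d_unit[OF assms(1,2)] by auto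
  have "lcong 1 (1 - a) (of_nat (Suc r))"
    using lcong_diff[OF lcong_refl[of 1 "of_nat (Suc r)"] lcong_1_p_mult[OF d_unit(2)[OF assms(1,2)]]]
    unfolding a_def by (simp add: algebra_simps)
  moreover have "r < p" unfolding r_def using p_pos by (metis Suc_pred' div_le_dividend le_imp_less_Suc)
  ultimately have "lcong N (gam N (1 - a) * gam N (1 - (1 - a))) ((- 1) ^ Suc r)"
    using aZ assms(3) by (intro gam_reflection) auto
  moreover have "a = 1 / of_nat d \<or> a = 1 - 1 / of_nat d"
    using parameter_cases[OF assms(1,2)] unfolding a_def r_def .
  ultimately show ?thesis unfolding r_def by (auto simp: mult.commute)
qed

lemma pochhammer_fraction:
  assumes "d \<ge> 2" "[int p = 1] (mod int d) \<or> [int p = - 1] (mod int d)"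
  shows "pochhammer (1 / of_nat d) k * pochhammer (1 - 1 / of_nat d) k / fact k ^ 2
    = term_ratio ((p - 1) div d) (of_nat p * (1 / of_nat d)) k 0"
proof -
  define r where "r = (p - 1) div d"
  have "r < p" unfolding r_def using p_pos by (metis Suc_pred' div_le_dividend le_imp_less_Suc)
  have "lcong 1 (- (of_nat p * (1 / of_nat d))) (- 0)"
    by (intro lcong_minus lcong_1_p_mult d_unit(2)[OF assms])
  then have "pochhammer (1 + - (of_nat p * (1 / of_nat d))) r \<in> U"
    using \<open>r < p\<close> by (intro pochhammer_Suc_U) auto
  from U_nonzero[OF this] have "pochhammer (1 - of_nat p * (1 / of_nat d) :: rat) r \<noteq> 0"
    by simp
  from term_ratio_0[OF this, of k] parameter_cases[OF assms]
  show ?thesis unfolding r_def by (auto simp: mult.commute)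
qed

text \<open>The index \<open>j = p - 1\<close> belongs to the truncated series but not to G. Here
  \<open>x = - p\<close>, and the numerator contains \<open>p (\<alpha> - 1)\<close>, at index
  \<open>r\<close> of \<open>(x + e - r)_j\<close>, and \<open>- p \<alpha>\<close>, at index
  \<open>p - 1\<close> of \<open>(1 + x - e)_(r + j)\<close>.\<close>

lemma term_ratio_last:
  assumes p3: "p > 3" and d: "d \<ge> 2" "[int p = 1] (mod int d) \<or> [int p = - 1] (mod int d)"
  shows "lcong 2 (term_ratio ((p - 1) div d) (of_nat p * (1 / of_nat d)) (p - 1) (- of_nat p)) 0"
proof -
  define r where "r = (p - 1) div d"
  define \<alpha> :: rat where "\<alpha> = 1 / of_nat d"
  have \<alpha>Z: "\<alpha> \<in> Z" unfolding \<alpha>_def by (rule d_unit(2)[OF d])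
  have "r \<le> (p - 1) div 2" unfolding r_def using d by (intro div_le_mono2) auto
  then have rp: "r < p - 1" using p3 by auto
  have pX: "lcong 1 (- of_nat p) 0" using lcong_minus[OF p_lcong_0] by simp
  have e: "lcong 1 (of_nat p * \<alpha>) 0" by (rule lcong_1_p_mult[OF \<alpha>Z])
  define B where "B = pochhammer (- of_nat p + of_nat p * \<alpha> - of_nat r) (p - 1)"
  define A where "A = pochhammer (1 + - of_nat p - of_nat p * \<alpha>) (r + (p - 1))"
  define D where "D = pochhammer (- of_nat p + of_nat p * \<alpha> - of_nat r) r * pochhammer (1 + - of_nat p) (p - 1) ^ 2"
  have DU: "D \<in> U" unfolding D_def
    using rp p_pos by (intro U_mult U_power pochhammer_Suc_U[OF pX] pochhammer_diff_U lcong_0_add pX e) auto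
  have factor: "\<exists>c\<in>Z. pochhammer y n = (y + of_nat i) * c" if "y \<in> Z" "i < n" for y n i
  proof -
    have "pochhammer y n = (y + of_nat i) * (\<Prod>k\<in>{0..<n} - {i}. y + of_nat k)"
      unfolding pochhammer_prod using that(2) by (subst prod.remove[of _ i]) auto
    moreover have "(\<Prod>k\<in>{0..<n} - {i}. y + of_nat k) \<in> Z" using that(1) by auto
    ultimately show ?thesis by blast
  qed
  have "- of_nat p + of_nat p * \<alpha> - of_nat r \<in> Z" using \<alpha>Z by auto
  then obtain b where b: "b \<in> Z" "B = (of_nat p * (\<alpha> - 1)) * b"
    using factor[of "- of_nat p + of_nat p * \<alpha> - of_nat r" r "p - 1"] rp unfolding B_def
    by (auto simp: algebra_simps)
  have aZ: "1 + - of_nat p - of_nat p * \<alpha> \<in> Z" using \<alpha>Z by auto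
  have A: "A \<in> Z" unfolding A_def by (rule pochhammer_Z[OF aZ])
  have "lcong 2 (A * B) 0"
  proof (cases "r = 0")
    case False
    then obtain a where a: "a \<in> Z" "A = (1 + - of_nat p - of_nat p * \<alpha> + of_nat (p - 1)) * a"
      using factor[OF aZ, of "p - 1" "r + (p - 1)"] unfolding A_def by auto
    have "1 + - of_nat p - of_nat p * \<alpha> + of_nat (p - 1) = - (of_nat p * \<alpha>)"
      using p_pos by (simp add: of_nat_diff)
    then have AB: "A * B = of_nat p ^ 2 * (- \<alpha> * a * ((\<alpha> - 1) * b))"
      unfolding a b by (simp add: power2_eq_square)
    show ?thesis unfolding AB
      by (intro lcong_p_mult Z_mult Z_minus Z_diff \<alpha>Z a(1) b(1) Z_1)
  next
    \<comment> \<open>The second symbol is now too short to contain \<open>- p \<alpha>\<close>, but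
      \<open>r = 0\<close> forces \<open>d = p + 1\<close>, and
      \<open>\<alpha> - 1 = - p \<alpha>\<close> yields the second factor \<open>p\<close>.\<close>
    case True
    have "\<not> p = d * r + 1" using True p3 by simp
    then have "p + 1 = d" using residue_cases[OF d] True unfolding r_def[symmetric] by simp
    then have "(of_nat d :: rat) = of_nat p + 1" by (simp flip: of_nat_Suc)
    then have "\<alpha> - 1 = - (of_nat p * \<alpha>)"
      unfolding \<alpha>_def by (simp add: field_simps)
    then have AB: "A * B = of_nat p ^ 2 * (- \<alpha> * b * A)" unfolding b by (simp add: power2_eq_square)
    show ?thesis unfolding AB by (intro lcong_p_mult Z_mult Z_minus \<alpha>Z A b(1))
  qed
  then have "lcong 2 ((- 1) ^ r * inverse D * (A * B)) ((- 1) ^ r * inverse D * 0)"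
    by (intro lcong_mult_left Z_mult U_Z[OF minus_one_power_U] U_Z[OF U_inverse[OF DU]])
  moreover have "term_ratio r (of_nat p * \<alpha>) (p - 1) (- of_nat p) = (- 1) ^ r * inverse D * (A * B)"
    unfolding term_ratio_def A_def B_def D_def divide_inverse by (simp only: mult_ac)
  ultimately show ?thesis unfolding r_def \<alpha>_def by simp
qed

lemma represents_part:
  assumes b: "b \<in> Z" and "t \<in> Z" "\<lfloor>b - t\<rfloor> \<in> {0, - 1}"
  shows "represents 3 (gammap_rat p (frac (b - t)) \<otimes>\<^bsub>Zp p\<^esub> inv\<^bsub>Zp p\<^esub> gammap_rat p b \<otimes>\<^bsub>Zp p\<^esub>
    Zp_of_int p (- int p) [^]\<^bsub>Zp p\<^esub> (- \<lfloor>b - t\<rfloor>)) (part b t)"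
proof -
  have "frac (b - t) \<in> Z" unfolding frac_def using b assms(2) by auto
  then have 1: "represents 3 (gammap_rat p (frac (b - t))) (gam 3 (frac (b - t)))"
    by (intro represents_gam represents_of_rat)
  have 2: "represents 3 (inv\<^bsub>Zp p\<^esub> gammap_rat p b) (inverse (gam 3 b))"
    using b by (intro represents_inv represents_gam represents_of_rat) auto
  have "- k = int (nat (- k))" if "k \<in> {0, - 1}" for k :: int using that by auto
  from this[OF assms(3)] have "- \<lfloor>b - t\<rfloor> = int (nat (- \<lfloor>b - t\<rfloor>))" .
  then have e: "Zp_of_int p (- int p) [^]\<^bsub>Zp p\<^esub> (- \<lfloor>b - t\<rfloor>)
      = Zp_of_int p (- int p) [^]\<^bsub>Zp p\<^esub> nat (- \<lfloor>b - t\<rfloor>)"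
    by (metis int_pow_int)
  have 3: "represents 3 (Zp_of_int p (- int p) [^]\<^bsub>Zp p\<^esub> (- \<lfloor>b - t\<rfloor>))
      (of_int (- int p) ^ nat (- \<lfloor>b - t\<rfloor>))"
    unfolding e by (intro represents_pow represents_of_int)
  show ?thesis using represents_mult[OF represents_mult[OF 1 2] 3]
    unfolding part_def by (simp add: divide_inverse)
qed

lemma represents_hyperG:
  assumes d1: "d1 \<ge> 2" "[int p = 1] (mod int d1) \<or> [int p = - 1] (mod int d1)"
    and d2: "d2 \<ge> 2" "[int p = 1] (mod int d2) \<or> [int p = - 1] (mod int d2)"
  shows "represents 3 (hyperG p [1 / of_nat d1, 1 - 1 / of_nat d1, 1 / of_nat d2, 1 - 1 / of_nat d2])
    (- 1 / (of_nat p - 1) * (\<Sum>j\<in>{0..p - 2}.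
      pair_factor (1 / of_nat d1) (of_nat j / (of_nat p - 1))
      * pair_factor (1 / of_nat d2) (of_nat j / (of_nat p - 1))))"
proof -
  define ms :: "rat list" where "ms = [1 / of_nat d1, 1 - 1 / of_nat d1, 1 / of_nat d2, 1 - 1 / of_nat d2]"
  have p1: "(of_nat p - 1 :: rat) \<in> U" using U_minus[OF one_minus_p_U] by simp
  have "- 1 / (of_nat p - 1) \<in> Z" using p1 by (intro Z_divide Z_minus) auto
  moreover
  have "represents 3 (let t = of_nat j / (of_nat p - 1) in
       (Zp_of_int p ((- 1) ^ j) \<otimes>\<^bsub>Zp p\<^esub> gammap_rat p t) [^]\<^bsub>Zp p\<^esub> length ms \<otimes>\<^bsub>Zp p\<^esub>
       (\<Otimes>\<^bsub>Zp p\<^esub>i\<in>{..<length ms}.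
          gammap_rat p (frac (ms ! i - t)) \<otimes>\<^bsub>Zp p\<^esub> inv\<^bsub>Zp p\<^esub> gammap_rat p (ms ! i) \<otimes>\<^bsub>Zp p\<^esub>
          Zp_of_int p (- int p) [^]\<^bsub>Zp p\<^esub> (- \<lfloor>ms ! i - t\<rfloor>)))
      (pair_factor (1 / of_nat d1) (of_nat j / (of_nat p - 1))
      * pair_factor (1 / of_nat d2) (of_nat j / (of_nat p - 1)))" if j: "j \<in> {0..p - 2}" for j
  proof -
    define t :: rat where "t = of_nat j / (of_nat p - 1)"
    have tZ: "t \<in> Z" unfolding t_def using p1 by (intro Z_divide) auto
    have jp: "j < p - 1" using j p_ge_2 by auto
    have tp: "t = of_nat j / of_nat (p - 1)" unfolding t_def using p_pos by (simp add: of_nat_diff)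
    have fl: "\<lfloor>1 / of_nat d - t\<rfloor> \<in> {0, - 1}" "\<lfloor>1 - 1 / of_nat d - t\<rfloor> \<in> {0, - 1}"
      and dZ: "1 / of_nat d \<in> Z" "1 - 1 / of_nat d \<in> Z"
      if d: "d \<ge> 2" "[int p = 1] (mod int d) \<or> [int p = - 1] (mod int d)" for d
    proof -
      have "\<lfloor>of_nat 1 / of_nat d - t\<rfloor> = (if j * d \<le> 1 * (p - 1) then 0 else - 1)"
        unfolding tp using d jp by (intro floor_diff_fraction) auto
      then show "\<lfloor>1 / of_nat d - t\<rfloor> \<in> {0, - 1}" by simp
      have e: "1 - 1 / of_nat d = (of_nat (d - 1) / of_nat d :: rat)"
        using d by (simp add: of_nat_diff field_simps)
      have "\<lfloor>of_nat (d - 1) / of_nat d - t\<rfloor> = (if j * d \<le> (d - 1) * (p - 1) then 0 else - 1)"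
        unfolding tp using d jp by (intro floor_diff_fraction) auto
      then show "\<lfloor>1 - 1 / of_nat d - t\<rfloor> \<in> {0, - 1}" unfolding e by simp
      show "1 / of_nat d \<in> Z" "1 - 1 / of_nat d \<in> Z" using d_unit(2)[OF d] by auto
    qed
    have m: "represents 3 (gammap_rat p (frac (ms ! i - t)) \<otimes>\<^bsub>Zp p\<^esub> inv\<^bsub>Zp p\<^esub> gammap_rat p (ms ! i) \<otimes>\<^bsub>Zp p\<^esub>
          Zp_of_int p (- int p) [^]\<^bsub>Zp p\<^esub> (- \<lfloor>ms ! i - t\<rfloor>)) (part (ms ! i) t)" if "i \<in> {..<length ms}" for i
    proof -
      have "i \<in> {0, 1, 2, 3}" using that unfolding ms_def by auto
      then have "ms ! i \<in> {1 / of_nat d1, 1 - 1 / of_nat d1, 1 / of_nat d2, 1 - 1 / of_nat d2}"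
        unfolding ms_def by auto
      then show ?thesis using fl[OF d1] fl[OF d2] dZ[OF d1] dZ[OF d2] tZ
        by (intro represents_part) auto
    qed
    have "represents 3 ((Zp_of_int p ((- 1) ^ j) \<otimes>\<^bsub>Zp p\<^esub> gammap_rat p t) [^]\<^bsub>Zp p\<^esub> length ms \<otimes>\<^bsub>Zp p\<^esub>
       (\<Otimes>\<^bsub>Zp p\<^esub>i\<in>{..<length ms}.
          gammap_rat p (frac (ms ! i - t)) \<otimes>\<^bsub>Zp p\<^esub> inv\<^bsub>Zp p\<^esub> gammap_rat p (ms ! i) \<otimes>\<^bsub>Zp p\<^esub>
          Zp_of_int p (- int p) [^]\<^bsub>Zp p\<^esub> (- \<lfloor>ms ! i - t\<rfloor>)))
      ((of_int ((- 1) ^ j) * gam 3 t) ^ length ms * (\<Prod>i\<in>{..<length ms}. part (ms ! i) t))"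
      using m tZ by (intro represents_mult represents_pow represents_finprod represents_of_int
          represents_gam represents_of_rat) auto
    moreover have "(of_int ((- 1) ^ j) * gam 3 t) ^ length ms * (\<Prod>i\<in>{..<length ms}. part (ms ! i) t)
      = pair_factor (1 / of_nat d1) t * pair_factor (1 / of_nat d2) t"
    proof -
      have l: "length ms = 4" unfolding ms_def by simp
      have "{..<4::nat} = {0, 1, 2, 3}" by auto
      then have "(\<Prod>i\<in>{..<length ms}. part (ms ! i) t) = part (1 / of_nat d1) t * part (1 - 1 / of_nat d1) t
         * (part (1 / of_nat d2) t * part (1 - 1 / of_nat d2) t)"
        unfolding l by (simp add: ms_def mult.assoc)
      moreover have "(of_int ((- 1) ^ j) * gam 3 t) ^ 4 = gam 3 t ^ 2 * gam 3 t ^ 2"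
        by (simp add: power_mult_distrib flip: power_mult power_add)
      ultimately show ?thesis unfolding pair_factor_def l by simp
    qed
    ultimately show ?thesis unfolding Let_def t_def by simp
  qed
  ultimately show ?thesis unfolding hyperG_def ms_def[symmetric]
    by (intro represents_mult represents_of_rat represents_finsum) auto
qed

end


section \<open>The supercongruence\<close>

definition coeff_pair :: "nat \<Rightarrow> nat \<Rightarrow> rat" where
  "coeff_pair d k = pochhammer (1 / of_nat d) k * pochhammer (1 - 1 / of_nat d) k / fact k ^ 2"

lemma trunc_hypergeom_eq:
  "trunc_hypergeom [1 / of_nat d1, 1 - 1 / of_nat d1, 1 / of_nat d2, 1 - 1 / of_nat d2] [1, 1, 1] 1 m
    = (\<Sum>k = 0..m. coeff_pair d1 k * coeff_pair d2 k)"
  unfolding trunc_hypergeom_def coeff_pair_def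
  by (intro sum.cong) (simp_all add: pochhammer_fact[symmetric] power2_eq_square mult_ac)

context odd_localization
begin

text \<open>The prefactor \<open>- 1 / (p - 1)\<close> of G is the \<open>1 / (1 - p)\<close> of
  \<open>sum_term_ratio_lcong\<close>; the term \<open>j = p - 1\<close> needed there may be added
  because it vanishes modulo \<open>p ^ 3\<close>.\<close>

lemma hyperG_sum_lcong:
  assumes p3: "p > 3"
    and d1: "d1 \<ge> 2" "[int p = 1] (mod int d1) \<or> [int p = - 1] (mod int d1)"
    and d2: "d2 \<ge> 2" "[int p = 1] (mod int d2) \<or> [int p = - 1] (mod int d2)"
  shows "lcong 3 (- 1 / (of_nat p - 1) * (\<Sum>j\<in>{0..p - 2}.
      pair_factor (1 / of_nat d1) (of_nat j / (of_nat p - 1))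
      * pair_factor (1 / of_nat d2) (of_nat j / (of_nat p - 1))))
    ((\<Sum>k = 0..p - 1. coeff_pair d1 k * coeff_pair d2 k)
      + (- 1) ^ ((p - 1) div d1 + (p - 1) div d2) * of_nat p)"
proof -
  define x :: "nat \<Rightarrow> rat" where "x j = of_nat p * (of_nat j / (1 - of_nat p))" for j
  define f where "f d = term_ratio ((p - 1) div d) (of_nat p * (1 / of_nat d))" for d
  define q :: rat where "q = 1 / (1 - of_nat p)"
  have qZ: "q \<in> Z" unfolding q_def using one_minus_p_U by (intro Z_divide) auto
  have qeq: "- 1 / (of_nat p - 1) = q" unfolding q_def using p3 by (simp add: field_simps)
  have fZ: "f d j (x j) \<in> Z"
    if "j < p" "d \<ge> 2" "[int p = 1] (mod int d) \<or> [int p = - 1] (mod int d)" for d j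
  proof -
    have "(p - 1) div d < p" by (rule le_less_trans[OF div_le_dividend]) (use p_pos in simp)
    moreover have "of_nat j / (1 - of_nat p) \<in> Z" using one_minus_p_U by (intro Z_divide) auto
    ultimately show ?thesis unfolding f_def x_def
      using that(1) d_unit(2)[OF that(2,3)] by (intro term_ratio_Z lcong_1_p_mult)
  qed
  have pf: "lcong 3 (pair_factor (1 / of_nat d) (of_nat j / (of_nat p - 1))) (f d j (x j))"
    if "j < p - 1" "d \<ge> 2" "[int p = 1] (mod int d) \<or> [int p = - 1] (mod int d)" for d j
    unfolding f_def x_def by (rule pair_factor_lcong[OF p3 that(2,3,1)])
  have "lcong 3 (\<Sum>j\<in>{0..p - 2}. pair_factor (1 / of_nat d1) (of_nat j / (of_nat p - 1))
      * pair_factor (1 / of_nat d2) (of_nat j / (of_nat p - 1)))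
     (\<Sum>j\<in>{0..p - 2}. f d1 j (x j) * f d2 j (x j))"
  proof (intro lcong_sum lcong_mult)
    fix j assume "j \<in> {0..p - 2}"
    then have j: "j < p - 1" "j < p" using p3 by auto
    show "lcong 3 (pair_factor (1 / of_nat d1) (of_nat j / (of_nat p - 1))) (f d1 j (x j))"
      "lcong 3 (pair_factor (1 / of_nat d2) (of_nat j / (of_nat p - 1))) (f d2 j (x j))"
      by (rule pf[OF j(1) d1], rule pf[OF j(1) d2])
    then show "pair_factor (1 / of_nat d1) (of_nat j / (of_nat p - 1)) \<in> Z"
      "pair_factor (1 / of_nat d2) (of_nat j / (of_nat p - 1)) \<in> Z"
      using fZ[OF j(2) d1] fZ[OF j(2) d2] lcong_Z by blast+
  qed
  then have 1: "lcong 3 (q * (\<Sum>j\<in>{0..p - 2}. pair_factor (1 / of_nat d1) (of_nat j / (of_nat p - 1))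
      * pair_factor (1 / of_nat d2) (of_nat j / (of_nat p - 1))))
     (q * (\<Sum>j\<in>{0..p - 2}. f d1 j (x j) * f d2 j (x j)))"
    by (intro lcong_mult_left qZ)
  have last: "lcong 3 (q * (f d1 (p - 1) (x (p - 1)) * f d2 (p - 1) (x (p - 1)))) 0"
  proof (rule lcong_0_mult_Z'[OF _ qZ])
    have "of_nat (p - 1) / (1 - of_nat p) = (- 1 :: rat)"
      using p3 by (simp add: of_nat_diff divide_eq_eq)
    then have "x (p - 1) = - of_nat p" unfolding x_def by (simp only: mult_minus1_right)
    then have l: "lcong 2 (f d1 (p - 1) (x (p - 1))) 0" "lcong 2 (f d2 (p - 1) (x (p - 1))) 0"
      unfolding f_def using term_ratio_last[OF p3] d1 d2 by auto
    have "lcong (2 + 2) (f d1 (p - 1) (x (p - 1)) * f d2 (p - 1) (x (p - 1))) 0"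
      by (rule lcong_0_mult[OF l])
    then show "lcong 3 (f d1 (p - 1) (x (p - 1)) * f d2 (p - 1) (x (p - 1))) 0"
      by (rule lcong_mono) simp
  qed
  have ins: "{..<p} = insert (p - 1) {0..p - 2}" "p - 1 \<notin> {0..p - 2}" using p3 by auto
  have "lcong 3 (q * (\<Sum>j\<in>{0..p - 2}. f d1 j (x j) * f d2 j (x j)) + 0)
      (q * (\<Sum>j\<in>{0..p - 2}. f d1 j (x j) * f d2 j (x j))
        + q * (f d1 (p - 1) (x (p - 1)) * f d2 (p - 1) (x (p - 1))))"
    by (intro lcong_add lcong_refl lcong_sym[OF last])
  also have "q * (\<Sum>j\<in>{0..p - 2}. f d1 j (x j) * f d2 j (x j))
        + q * (f d1 (p - 1) (x (p - 1)) * f d2 (p - 1) (x (p - 1)))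
      = (\<Sum>j<p. f d1 j (x j) * f d2 j (x j) / (1 - of_nat p) - f d1 j 0 * f d2 j 0)
        + (\<Sum>j<p. f d1 j 0 * f d2 j 0)"
  proof -
    have "(\<Sum>j<p. f d1 j (x j) * f d2 j (x j) / (1 - of_nat p) - f d1 j 0 * f d2 j 0)
        + (\<Sum>j<p. f d1 j 0 * f d2 j 0) = q * (\<Sum>j<p. f d1 j (x j) * f d2 j (x j))"
      unfolding q_def sum_distrib_left sum.distrib[symmetric] by simp
    also have "\<dots> = q * (\<Sum>j\<in>{0..p - 2}. f d1 j (x j) * f d2 j (x j))
        + q * (f d1 (p - 1) (x (p - 1)) * f d2 (p - 1) (x (p - 1)))"
      unfolding ins(1) using ins(2) by (simp add: distrib_left)
    finally show ?thesis by simp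
  qed
  also have "lcong 3 \<dots> ((- 1) ^ ((p - 1) div d1 + (p - 1) div d2) * of_nat p
      + (\<Sum>j<p. f d1 j 0 * f d2 j 0))"
  proof (rule lcong_add[OF _ lcong_refl])
    have "(p - 1) div d < p" for d by (rule le_less_trans[OF div_le_dividend]) (use p_pos in simp)
    then show "lcong 3 (\<Sum>j<p. f d1 j (x j) * f d2 j (x j) / (1 - of_nat p) - f d1 j 0 * f d2 j 0)
      ((- 1) ^ ((p - 1) div d1 + (p - 1) div d2) * of_nat p)"
      unfolding f_def x_def using d_unit(2)[OF d1] d_unit(2)[OF d2]
      by (intro sum_term_ratio_lcong p3)
  qed
  also have "(\<Sum>j<p. f d1 j 0 * f d2 j 0) = (\<Sum>k = 0..p - 1. coeff_pair d1 k * coeff_pair d2 k)"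
  proof -
    have "{..<p} = {0..p - 1}" using p_pos by auto
    then show ?thesis unfolding coeff_pair_def f_def
      using pochhammer_fraction[OF d1] pochhammer_fraction[OF d2] by simp
  qed
  finally have "lcong 3 (q * (\<Sum>j\<in>{0..p - 2}. f d1 j (x j) * f d2 j (x j)))
     ((\<Sum>k = 0..p - 1. coeff_pair d1 k * coeff_pair d2 k)
      + (- 1) ^ ((p - 1) div d1 + (p - 1) div d2) * of_nat p)" by (simp add: add.commute)
  from lcong_trans[OF 1 this] show ?thesis unfolding qeq .
qed

text \<open>A finite check: \<open>d\<close> divides 2 or 4, and \<open>j\<close> is 0 or 1, so that
  \<open>t\<close> is 0 or 1/2.\<close>

lemma hyperG_sum_lcong_3:
  assumes p3: "p = 3"
    and d1: "d1 \<ge> 2" "[int p = 1] (mod int d1) \<or> [int p = - 1] (mod int d1)"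
    and d2: "d2 \<ge> 2" "[int p = 1] (mod int d2) \<or> [int p = - 1] (mod int d2)"
  shows "lcong 3 (- 1 / (of_nat p - 1) * (\<Sum>j\<in>{0..p - 2}.
      pair_factor (1 / of_nat d1) (of_nat j / (of_nat p - 1))
      * pair_factor (1 / of_nat d2) (of_nat j / (of_nat p - 1))))
    ((\<Sum>k = 0..p - 1. coeff_pair d1 k * coeff_pair d2 k)
      + (- 1) ^ ((p - 1) div d1 + (p - 1) div d2) * of_nat p)"
proof -
  have d: "d = 2 \<or> d = 4" if "d \<ge> 2" "[int p = 1] (mod int d) \<or> [int p = - 1] (mod int d)" for d
    using residue_cases[OF that] unfolding p3
  proof
    assume "3 = d * ((3 - 1) div d) + 1"
    then have "d dvd 2" by (metis Suc_eq_plus1 Suc_inject dvd_triv_left numeral_3_eq_3 numeral_2_eq_2)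
    then have "d \<le> 2" by (rule dvd_imp_le) simp
    then show ?thesis using that(1) by simp
  next
    assume a: "2 < d \<and> 3 + 1 = d * ((3 - 1) div d + 1)"
    then have "d dvd 3 + 1" by (metis dvd_triv_left)
    then have "d dvd 4" by simp
    then have "d \<le> 4" by (rule dvd_imp_le) simp
    then show ?thesis using a \<open>d dvd 4\<close> by (cases "d = 3") auto
  qed
  have p3r: "of_nat p = (3 :: rat)" "int p = 3" "(p - 1) div 2 = 1" "(p - 1) div 4 = 0" using p3 by simp_all
  \<comment> \<open>The value of \<open>pair_factor\<close> at \<open>t = 1/2\<close>. For
    \<open>d = 2\<close> both fractional parts are 0. For \<open>d = 4\<close> they are the two
    parameters in exchanged order, so only \<open>- 3\<close> and the square of the gamma value at
    1/2 remain, and that square is 1 by reflection.\<close>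
  define v :: "nat \<Rightarrow> rat" where "v d = (if d = 2 then 1 else - 3)" for d
  have g0: "lcong 3 (gam 3 0 ^ 2) 1"
    using lcong_power[OF gam_0 U_Z[OF gam_U], of 3 2] by simp
  have pf0: "lcong 3 (pair_factor (1 / of_nat d) 0) 1" if "d \<ge> 2" for d
  proof -
    have "rat_of_nat d \<ge> 2" using of_nat_mono[OF that, where 'a = rat] by simp
    then have "\<lfloor>1 / rat_of_nat d\<rfloor> = 0" "\<lfloor>1 - 1 / rat_of_nat d\<rfloor> = 0"
      by (simp_all add: floor_eq_iff field_simps)
    then have "pair_factor (1 / of_nat d) 0 = gam 3 0 ^ 2"
      unfolding pair_factor_def part_def by (simp add: frac_def)
    then show ?thesis using g0 by simp
  qed
  have pf1: "lcong 3 (pair_factor (1 / of_nat d) (1 / 2)) (v d)" if "d = 2 \<or> d = 4" for d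
    using that
  proof
    assume d: "d = 2"
    have "pair_factor (1 / of_nat d) (1 / 2) = gam 3 0 ^ 2"
      unfolding pair_factor_def part_def d by (simp add: power2_eq_square)
    then show ?thesis using g0 d by (simp add: v_def)
  next
    assume d: "d = 4"
    have "\<lfloor>1 / 4 - 1 / 2 :: rat\<rfloor> = - 1" "\<lfloor>3 / 4 - 1 / 2 :: rat\<rfloor> = 0"
      by (simp_all add: floor_eq_iff)
    then have "pair_factor (1 / of_nat d) (1 / 2) = - 3 * (gam 3 (1 / 2) * gam 3 (1 - 1 / 2))"
      unfolding pair_factor_def part_def d by (simp add: frac_def p3r power2_eq_square)
    also have "lcong 3 \<dots> (- 3 * 1)"
    proof (rule lcong_mult_left)
      have "[int p = 1] (mod int 2) \<or> [int p = - 1] (mod int 2)" unfolding p3r by (simp add: cong_def)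
      from gam_reflection_fraction[OF _ this, of 3]
      show "lcong 3 (gam 3 (1 / 2) * gam 3 (1 - 1 / 2)) 1"
        unfolding p3r by (simp add: power2_eq_square)
    qed (auto intro: Z_minus)
    finally show ?thesis using d by (simp add: v_def)
  qed
  have vZ: "v d \<in> Z" for d unfolding v_def by (auto intro: Z_minus)
  have "lcong 3 (pair_factor (1 / of_nat d1) 0 * pair_factor (1 / of_nat d2) 0
      + pair_factor (1 / of_nat d1) (1 / 2) * pair_factor (1 / of_nat d2) (1 / 2)) (1 * 1 + v d1 * v d2)"
    using pf0[OF d1(1)] pf0[OF d2(1)] pf1[OF d[OF d1]] pf1[OF d[OF d2]] vZ lcong_Z
    by (intro lcong_add lcong_mult) auto
  moreover have "- 1 / 2 \<in> Z" using Z_I[of 2 "- 1"] p3r by simp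
  ultimately have e1: "lcong 3 (- 1 / 2 * (pair_factor (1 / of_nat d1) 0 * pair_factor (1 / of_nat d2) 0
      + pair_factor (1 / of_nat d1) (1 / 2) * pair_factor (1 / of_nat d2) (1 / 2)))
      (- 1 / 2 * (1 * 1 + v d1 * v d2))" by (rule lcong_mult_left)
  have e2: "- 1 / (of_nat p - 1) * (\<Sum>j\<in>{0..p - 2}.
      pair_factor (1 / of_nat d1) (of_nat j / (of_nat p - 1))
      * pair_factor (1 / of_nat d2) (of_nat j / (of_nat p - 1)))
    = - 1 / 2 * (pair_factor (1 / of_nat d1) 0 * pair_factor (1 / of_nat d2) 0
      + pair_factor (1 / of_nat d1) (1 / 2) * pair_factor (1 / of_nat d2) (1 / 2))"
  proof -
    have "{0..p - 2} = {0, 1}" using p3 by auto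
    then show ?thesis by (simp add: p3r)
  qed
  have e3: "lcong 3 (- 1 / 2 * (1 * 1 + v d1 * v d2))
    ((\<Sum>k = 0..p - 1. coeff_pair d1 k * coeff_pair d2 k)
      + (- 1) ^ ((p - 1) div d1 + (p - 1) div d2) * of_nat p)"
  proof -
    have "{0..p - 1} = {0, 1, 2}" using p3 by auto
    then have S: "(\<Sum>k = 0..p - 1. coeff_pair d1 k * coeff_pair d2 k)
      = coeff_pair d1 0 * coeff_pair d2 0 + coeff_pair d1 1 * coeff_pair d2 1
        + coeff_pair d1 2 * coeff_pair d2 2" by simp
    have c: "coeff_pair d 0 = 1" "coeff_pair 2 1 = 1 / 4" "coeff_pair 4 1 = 3 / 16"
      "coeff_pair 2 2 = 9 / 64" "coeff_pair 4 2 = 105 / 1024" for d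
      unfolding coeff_pair_def by (simp_all add: numeral_2_eq_2 pochhammer_Suc)
    \<comment> \<open>In the four cases below, \<open>a / b\<close> is the exact difference of the
      two sides divided by 27; \<open>b\<close> is a power of 2.\<close>
    have L: "lcong 3 y z" if "y - z = 27 * (of_int a / of_int b)" "\<not> 3 dvd b" for y z and a b :: int
      unfolding lcong_def using that Z_I[of b a] p3r by (intro bexI[of _ "of_int a / of_int b"]) auto
    show ?thesis unfolding S using d[OF d1] d[OF d2]
    proof (elim disjE)
      assume "d1 = 2" "d2 = 2"
      then show "lcong 3 (- 1 / 2 * (1 * 1 + v d1 * v d2))
        (coeff_pair d1 0 * coeff_pair d2 0 + coeff_pair d1 1 * coeff_pair d2 1
          + coeff_pair d1 2 * coeff_pair d2 2 + (- 1) ^ ((p - 1) div d1 + (p - 1) div d2) * of_nat p)"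
        by (intro L[of _ _ "- 771" 4096]) (simp_all add: c v_def p3r del: One_nat_def)
    next
      assume "d1 = 2" "d2 = 4"
      then show "lcong 3 (- 1 / 2 * (1 * 1 + v d1 * v d2))
        (coeff_pair d1 0 * coeff_pair d2 0 + coeff_pair d1 1 * coeff_pair d2 1
          + coeff_pair d1 2 * coeff_pair d2 2 + (- 1) ^ ((p - 1) div d1 + (p - 1) div d2) * of_nat p)"
        by (intro L[of _ _ 7133 65536]) (simp_all add: c v_def p3r del: One_nat_def)
    next
      assume "d1 = 4" "d2 = 2"
      then show "lcong 3 (- 1 / 2 * (1 * 1 + v d1 * v d2))
        (coeff_pair d1 0 * coeff_pair d2 0 + coeff_pair d1 1 * coeff_pair d2 1
          + coeff_pair d1 2 * coeff_pair d2 2 + (- 1) ^ ((p - 1) div d1 + (p - 1) div d2) * of_nat p)"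
        by (intro L[of _ _ 7133 65536]) (simp_all add: c v_def p3r del: One_nat_def)
    next
      assume "d1 = 4" "d2 = 4"
      then show "lcong 3 (- 1 / 2 * (1 * 1 + v d1 * v d2))
        (coeff_pair d1 0 * coeff_pair d2 0 + coeff_pair d1 1 * coeff_pair d2 1
          + coeff_pair d1 2 * coeff_pair d2 2 + (- 1) ^ ((p - 1) div d1 + (p - 1) div d2) * of_nat p)"
        by (intro L[of _ _ "- 351299" 1048576]) (simp_all add: c v_def p3r del: One_nat_def)
    qed
  qed
  show ?thesis unfolding e2 by (rule lcong_trans[OF e1 e3])
qed

lemma represents_s_sign:
  assumes d1: "d1 \<ge> 2" "[int p = 1] (mod int d1) \<or> [int p = - 1] (mod int d1)"
    and d2: "d2 \<ge> 2" "[int p = 1] (mod int d2) \<or> [int p = - 1] (mod int d2)" and N: "N > 0"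
  shows "represents N (s_sign p d1 d2) ((- 1) ^ ((p - 1) div d1 + (p - 1) div d2))"
proof -
  have e: "(of_nat d - 1) / of_nat d = (1 - 1 / of_nat d :: rat)" if "d \<ge> 2" for d
    using that by (simp add: field_simps)
  have r: "represents N (gammap_rat p (1 / of_nat d)) (gam N (1 / of_nat d))"
    "represents N (gammap_rat p ((of_nat d - 1) / of_nat d)) (gam N (1 - 1 / of_nat d))"
    if d: "d \<ge> 2" "[int p = 1] (mod int d) \<or> [int p = - 1] (mod int d)" for d
    unfolding e[OF d(1)] using d_unit(2)[OF d]
    by (auto intro!: represents_gam represents_of_rat)
  have s: "represents N (s_sign p d1 d2) (gam N (1 / of_nat d1) * gam N (1 - 1 / of_nat d1)
      * gam N (1 / of_nat d2) * gam N (1 - 1 / of_nat d2))"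
    unfolding s_sign_def by (intro represents_mult r d1 d2)
  have "lcong N (gam N (1 / of_nat d1) * gam N (1 - 1 / of_nat d1)
      * (gam N (1 / of_nat d2) * gam N (1 - 1 / of_nat d2)))
    ((- 1) ^ Suc ((p - 1) div d1) * (- 1) ^ Suc ((p - 1) div d2))"
    by (intro lcong_mult[OF gam_reflection_fraction gam_reflection_fraction] d1 d2 N Z_mult U_Z[OF gam_U])
  from represents_lcong[OF s[unfolded mult.assoc] this[unfolded mult.assoc]]
  show ?thesis by (simp add: power_add)
qed

end

theorem theorem2p6:
  fixes d1 d2 p :: nat
  assumes "d1 \<ge> 2" and "d2 \<ge> 2"
    and "prime p" and "odd p"
    and "[int p = 1] (mod int d1) \<or> [int p = - 1] (mod int d1)"
    and "[int p = 1] (mod int d2) \<or> [int p = - 1] (mod int d2)"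
  shows "s_sign p d1 d2 = Zp_of_int p ((- 1) ^ ((p - 1) div d1 + (p - 1) div d2))
    \<and> Zp_cong p 3
        (hyperG p [1 / of_nat d1, 1 - 1 / of_nat d1, 1 / of_nat d2, 1 - 1 / of_nat d2])
        (Zp_of_rat p (trunc_hypergeom
            [1 / of_nat d1, 1 - 1 / of_nat d1, 1 / of_nat d2, 1 - 1 / of_nat d2] [1, 1, 1] 1 (p - 1))
          \<oplus>\<^bsub>Zp p\<^esub> s_sign p d1 d2 \<otimes>\<^bsub>Zp p\<^esub> Zp_of_int p (int p))"
proof -
  interpret odd_localization p
    using assms(3,4) by unfold_locales
  note d1 = assms(1,5) and d2 = assms(2,6)
  let ?t = "\<Sum>k = 0..p - 1. coeff_pair d1 k * coeff_pair d2 k"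
  let ?s = "(- 1) ^ ((p - 1) div d1 + (p - 1) div d2)"
  \<comment> \<open>An equality in \<open>Zp\<close>, not just a congruence, because the reflection
    formula is available modulo every power of \<open>p\<close>.\<close>
  have "s_sign p d1 d2 = Zp_of_int p ?s"
  proof (rule Zp_eqI)
    fix N :: nat assume N: "N > 0"
    have "represents N (Zp_of_int p ?s) ?s" using represents_of_int[of N ?s] by simp
    then show "\<exists>q. represents N (s_sign p d1 d2) q \<and> represents N (Zp_of_int p ?s) q"
      using represents_s_sign[OF d1 d2 N] by blast
  qed
  moreover have "Zp_cong p 3
      (hyperG p [1 / of_nat d1, 1 - 1 / of_nat d1, 1 / of_nat d2, 1 - 1 / of_nat d2])
      (Zp_of_rat p (trunc_hypergeom
          [1 / of_nat d1, 1 - 1 / of_nat d1, 1 / of_nat d2, 1 - 1 / of_nat d2] [1, 1, 1] 1 (p - 1))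
        \<oplus>\<^bsub>Zp p\<^esub> s_sign p d1 d2 \<otimes>\<^bsub>Zp p\<^esub> Zp_of_int p (int p))"
  proof (rule Zp_cong_if_represents)
    have "coeff_pair d k \<in> Z"
      if "k \<in> {0..p - 1}" "d \<ge> 2" "[int p = 1] (mod int d) \<or> [int p = - 1] (mod int d)" for d k
    proof -
      have "\<not> p dvd fact k" using that(1) prime_p p_pos by (auto simp: prime_dvd_fact_iff)
      then have "fact k \<in> U" using U_of_nat[of "fact k"] by simp
      then show ?thesis unfolding coeff_pair_def using d_unit(1)[OF that(2,3)]
        by (intro Z_divide Z_mult pochhammer_Z U_power Z_diff) auto
    qed
    then have tZ: "?t \<in> Z" by (intro Z_sum Z_mult) (use d1 d2 in simp_all)
    show "represents 3 (Zp_of_rat p (trunc_hypergeom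
          [1 / of_nat d1, 1 - 1 / of_nat d1, 1 / of_nat d2, 1 - 1 / of_nat d2] [1, 1, 1] 1 (p - 1))
        \<oplus>\<^bsub>Zp p\<^esub> s_sign p d1 d2 \<otimes>\<^bsub>Zp p\<^esub> Zp_of_int p (int p)) (?t + ?s * of_int (int p))"
      unfolding trunc_hypergeom_eq
      by (intro represents_add represents_mult represents_of_rat represents_of_int
          represents_s_sign d1 d2 tZ) simp
    have "p > 3 \<or> p = 3" using odd_p p_ge_2 by (cases "p = 2") auto
    then have "lcong 3 (- 1 / (of_nat p - 1) * (\<Sum>j\<in>{0..p - 2}.
        pair_factor (1 / of_nat d1) (of_nat j / (of_nat p - 1))
        * pair_factor (1 / of_nat d2) (of_nat j / (of_nat p - 1)))) (?t + ?s * of_nat p)"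
      using hyperG_sum_lcong[OF _ d1 d2] hyperG_sum_lcong_3[OF _ d1 d2] by blast
    from represents_lcong[OF represents_hyperG[OF d1 d2] this]
    show "represents 3
        (hyperG p [1 / of_nat d1, 1 - 1 / of_nat d1, 1 / of_nat d2, 1 - 1 / of_nat d2])
        (?t + ?s * of_int (int p))" by simp
  qed
  ultimately show ?thesis ..
qed

end
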